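(* Let $\mathbf{K}$ be one of the following two classes of countable structures: (1) the random $\eta$-hypergraphs $M(\eta)$, for $\eta\in 2^\omega$ with $\eta(0)=\eta(1)=0$; (2) the random $\zeta$-free $\eta$-hypergraphs $M(\eta,\zeta)$, for $\eta\in2^\omega$ with $\eta(0)=\eta(1)=0$ and $\zeta\in\omega^\omega$ with $\zeta(n)\ge n$ if $\eta(n)=1$ and $\zeta(n)=0$ otherwise. If $M=M(x)$ and $N=M(y)$ are in $\mathbf{K}$ with parameters $x\neq y$ (where $x,y$ are values of $\eta$ in case (1) and of the pair $(\eta,\zeta)$ in case (2)), then $Aut(M)\not\cong Aut(N)$ as abstract groups. Moreover, every $M\in\mathbf{K}$ has the strong small index property.
   Context: For $\eta\in2^\omega$ with $\eta(0)=\eta(1)=0$, $L(\eta)$ is the relational language with exactly one relation symbol $R_n$ of arity $n$ for each $n$ with $\eta(n)=1$. $\mathbf{K}(\eta)$ is the class of finite $L(\eta)$-structures in which each $R_n$ is symmetric and irreflexive (if $R_n(a_1,\dots,a_n)$ holds then the $a_i$ are distinct, and $R_n(a_1,\dots,a_n)$ iff $R_n(a_{\sigma(1)},\dots,a_{\sigma(n)})$ for every permutation $\sigma$). This is an amalgamation class and its Fraïssé limit $M(\eta)$ is the random $\eta$-hypergraph. For $\zeta$ as in (2), $\mathbf{K}(\eta,\zeta)$ is the class of $K\in\mathbf{K}(\eta)$ such that for every $n$ with $\zeta(n)>n$, $K$ does not embed the structure of size $\zeta(n)$ in which every tuple of $n$ distinct elements is in $R_n$; it is an amalgamation class and its Fraïssé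 limit $M(\eta,\zeta)$ is the random $\zeta$-free $\eta$-hypergraph. For $G=Aut(M)$, $G_{(A)}$ and $G_{\{A\}}$ denote pointwise and setwise stabilizers of $A\subseteq M$. $M$ has the strong small index property if for every subgroup $H\le Aut(M)$ of index $<2^{\aleph_0}$ there is a finite $A\subseteq M$ with $G_{(A)}\le H\le G_{\{A\}}$. *)

theory Defs
  imports
    "HOL-Algebra.Algebra"
    "HOL-Combinatorics.Combinatorics"
    "HOL-Library.Equipollence"
    "HOL-Library.Countable_Set"
begin

section \<open>Relational structures\<close>

text \<open>
  All languages considered here have at most one relation symbol of each arity, so the symbol
  \<open>R\<^sub>n\<close> is identified with its arity \<open>n\<close>, and a language is a predicate \<open>\<eta>\<close> on arities.
  A relation symbol that does not belong to the language is interpreted by the empty relation;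
  hence embeddings and isomorphisms need not mention the language.
\<close>

record 'a rstruct =
  univ :: "'a set"
  rel :: "nat \<Rightarrow> 'a list set"

definition L_structure :: "(nat \<Rightarrow> bool) \<Rightarrow> 'a rstruct \<Rightarrow> bool" where
  "L_structure \<eta> M \<longleftrightarrow>
     (\<forall>n. \<forall>xs \<in> rel M n. \<eta> n \<and> length xs = n \<and> set xs \<subseteq> univ M)"

definition substruct :: "'a rstruct \<Rightarrow> 'a set \<Rightarrow> 'a rstruct" where
  "substruct M A = \<lparr>univ = A, rel = (\<lambda>n. {xs \<in> rel M n. set xs \<subseteq> A})\<rparr>"

definition embedding :: "('a \<Rightarrow> 'b) \<Rightarrow> 'a rstruct \<Rightarrow> 'b rstruct \<Rightarrow> bool" where
  "embedding f A M \<longleftrightarrow>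
     inj_on f (univ A) \<and> f ` univ A \<subseteq> univ M \<and>
     (\<forall>n xs. length xs = n \<and> set xs \<subseteq> univ A \<longrightarrow> (xs \<in> rel A n \<longleftrightarrow> map f xs \<in> rel M n))"

definition embeds :: "'a rstruct \<Rightarrow> 'b rstruct \<Rightarrow> bool" where
  "embeds A M \<longleftrightarrow> (\<exists>f. embedding f A M)"

definition isomorphism :: "('a \<Rightarrow> 'b) \<Rightarrow> 'a rstruct \<Rightarrow> 'b rstruct \<Rightarrow> bool" where
  "isomorphism f M N \<longleftrightarrow> embedding f M N \<and> f ` univ M = univ N"

text \<open>Automorphisms are taken in \<open>Bij (univ M)\<close>, so that they are determined by their values on
  the universe.\<close>

definition Aut :: "'a rstruct \<Rightarrow> ('a \<Rightarrow> 'a) monoid" where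
  "Aut M = (BijGroup (univ M))\<lparr>carrier := {f \<in> Bij (univ M). isomorphism f M M}\<rparr>"


section \<open>Fra\<iuml>ss\<eacute> limits\<close>

text \<open>Classes of finite structures closed under isomorphism are represented by their members with
  universe contained in \<^typ>\<open>nat\<close>.\<close>

definition age :: "(nat \<Rightarrow> bool) \<Rightarrow> 'a rstruct \<Rightarrow> nat rstruct set" where
  "age \<eta> M = {A. L_structure \<eta> A \<and> finite (univ A) \<and> embeds A M}"

definition ultrahomogeneous :: "'a rstruct \<Rightarrow> bool" where
  "ultrahomogeneous M \<longleftrightarrow>
     (\<forall>A B f. finite A \<and> A \<subseteq> univ M \<and> finite B \<and> B \<subseteq> univ M \<and>
        isomorphism f (substruct M A) (substruct M B) \<longrightarrow>
        (\<exists>g \<in> carrier (Aut M). \<forall>a \<in> A. g a = f a))"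

definition fraisse_limit :: "(nat \<Rightarrow> bool) \<Rightarrow> nat rstruct set \<Rightarrow> 'a rstruct \<Rightarrow> bool" where
  "fraisse_limit \<eta> K M \<longleftrightarrow>
     L_structure \<eta> M \<and> countable (univ M) \<and> ultrahomogeneous M \<and> age \<eta> M = K"


section \<open>Random hypergraphs\<close>

definition eta_param :: "(nat \<Rightarrow> bool) \<Rightarrow> bool" where
  "eta_param \<eta> \<longleftrightarrow> \<not> \<eta> 0 \<and> \<not> \<eta> 1"

definition zeta_param :: "(nat \<Rightarrow> bool) \<Rightarrow> (nat \<Rightarrow> nat) \<Rightarrow> bool" where
  "zeta_param \<eta> \<zeta> \<longleftrightarrow> (\<forall>n. if \<eta> n then \<zeta> n \<ge> n else \<zeta> n = 0)"

definition irreflexive_rel :: "'a list set \<Rightarrow> bool" where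
  "irreflexive_rel R \<longleftrightarrow> (\<forall>xs \<in> R. distinct xs)"

definition symmetric_rel :: "nat \<Rightarrow> 'a list set \<Rightarrow> bool" where
  "symmetric_rel n R \<longleftrightarrow>
     (\<forall>\<sigma> xs. \<sigma> permutes {..<n} \<and> length xs = n \<longrightarrow> (xs \<in> R \<longleftrightarrow> permute_list \<sigma> xs \<in> R))"

definition K_eta :: "(nat \<Rightarrow> bool) \<Rightarrow> nat rstruct set" where
  "K_eta \<eta> = {K. L_structure \<eta> K \<and> finite (univ K) \<and>
     (\<forall>n. \<eta> n \<longrightarrow> irreflexive_rel (rel K n) \<and> symmetric_rel n (rel K n))}"

definition complete_hypergraph :: "nat \<Rightarrow> nat \<Rightarrow> nat rstruct" where
  "complete_hypergraph n m =
     \<lparr>univ = {..<m},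
      rel = (\<lambda>k. if k = n then {xs. length xs = n \<and> distinct xs \<and> set xs \<subseteq> {..<m}} else {})\<rparr>"

definition reduct :: "nat \<Rightarrow> 'a rstruct \<Rightarrow> 'a rstruct" where
  "reduct n M = \<lparr>univ = univ M, rel = (\<lambda>k. if k = n then rel M n else {})\<rparr>"

text \<open>Being free of the complete \<open>n\<close>-uniform hypergraph on \<open>\<zeta> n\<close> points is a condition on \<open>R\<^sub>n\<close>
  alone: the other relations may hold or fail on the forbidden configuration. Hence the reduct.\<close>

definition K_eta_zeta :: "(nat \<Rightarrow> bool) \<Rightarrow> (nat \<Rightarrow> nat) \<Rightarrow> nat rstruct set" where
  "K_eta_zeta \<eta> \<zeta> =
     {K \<in> K_eta \<eta>. \<forall>n. \<zeta> n > n \<longrightarrow> \<not> embeds (complete_hypergraph n (\<zeta> n)) (reduct n K)}"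

text \<open>Fra\<iuml>ss\<eacute> limits are unique only up to isomorphism: the following predicates say
  that \<open>M\<close> is a copy of \<open>M(\<eta>)\<close>, respectively of \<open>M(\<eta>,\<zeta>)\<close>.\<close>

definition random_hypergraph :: "(nat \<Rightarrow> bool) \<Rightarrow> 'a rstruct \<Rightarrow> bool" where
  "random_hypergraph \<eta> M \<longleftrightarrow> fraisse_limit \<eta> (K_eta \<eta>) M"

definition random_free_hypergraph ::
    "(nat \<Rightarrow> bool) \<Rightarrow> (nat \<Rightarrow> nat) \<Rightarrow> 'a rstruct \<Rightarrow> bool" where
  "random_free_hypergraph \<eta> \<zeta> M \<longleftrightarrow> fraisse_limit \<eta> (K_eta_zeta \<eta> \<zeta>) M"


section \<open>The strong small index property\<close>

definition pointwise_stab :: "'a rstruct \<Rightarrow> 'a set \<Rightarrow> ('a \<Rightarrow> 'a) set" where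
  "pointwise_stab M A = {g \<in> carrier (Aut M). \<forall>a \<in> A. g a = a}"

definition setwise_stab :: "'a rstruct \<Rightarrow> 'a set \<Rightarrow> ('a \<Rightarrow> 'a) set" where
  "setwise_stab M A = {g \<in> carrier (Aut M). g ` A = A}"

text \<open>The set \<^term>\<open>UNIV :: nat set set\<close> has cardinality \<open>2\<^sup>\<aleph>\<^sup>0\<close>.\<close>

definition strong_small_index_property :: "'a rstruct \<Rightarrow> bool" where
  "strong_small_index_property M \<longleftrightarrow>
     (\<forall>H. subgroup H (Aut M) \<and> (rcosets\<^bsub>Aut M\<^esub> H) \<prec> (UNIV :: nat set set) \<longrightarrow>
        (\<exists>A. finite A \<and> A \<subseteq> univ M \<and> pointwise_stab M A \<subseteq> H \<and> H \<subseteq> setwise_stab M A))"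

end

theory Submission
  imports Defs
begin

text \<open>
  Since \<open>M\<close> has at most one relation of each arity, it is a hypergraph on the natural numbers whose
  edges of size \<open>n\<close> are the supports of the tuples in \<open>R\<^sub>n\<close>; case (1) is case (2) with \<open>\<zeta> n = n\<close>.

  Small index property. Finite hypergraphs extend to finite hypergraphs in which all partial
  automorphisms extend, by valuations that encode each edge as an odd parity; a second layer of
  valuations on the forbidden cliques destroys the cliques. Hence tuples of automorphisms have a
  comeager notion of genericity, and generic tuples that agree on a finite invariant set are
  conjugate over it. If \<open>H\<close> has index \<open>< 2\<^sup>\<aleph>\<^sup>0\<close> but is not open, then one
  chooses \<open>a\<^sub>n \<in> H\<close> and \<open>b\<^sub>n \<notin> H\<close> so close to the identity that all \<open>2\<^sup>\<aleph>\<^sup>0\<close> sequences \<open>c\<close> with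
  \<open>c\<^sub>n \<in> {a\<^sub>n, b\<^sub>n}\<close> are conjugate; the conjugating elements lie in distinct cosets of \<open>H\<close>. Free amalgamation
  gives that the stabilizers of \<open>A\<close> and \<open>B\<close> generate the stabilizer of \<open>A \<inter> B\<close>, and so a finite \<open>A\<close> of
  least size with stabilizer inside \<open>H\<close> is \<open>H\<close>-invariant.

  Reconstruction. The pointwise stabilizers of finite sets are the subgroups of small index without
  proper subgroups of finite index, so an isomorphism of the groups is induced by a bijection of the
  points. The parameters are then read off by comparing, over a fixed pattern of edges of
  size \<open>< k\<close>, the possible patterns of edges of size \<open>k\<close>.
\<close>

section \<open>Extending partial automorphisms of finite hypergraphs\<close>

text \<open>Forbidden cliques have edges of size n \<ge> 2, so two points of such a clique always
  lie on a common edge. Hence a union without mixed edges contains no new clique, and free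
  amalgamation works. The parity layer may create forbidden cliques, which is why a second layer has
  to follow it. Extending partial automorphisms inside a finite hypergraph is what makes finite
  invariant sets cofinal for comeagerly many tuples; two generic tuples are then conjugated by a
  back-and-forth through finite invariant pieces. In the index argument the conjugating elements
  must converge. Therefore each new pair \<open>a\<^sub>n\<close>, \<open>b\<^sub>n\<close> is
  chosen to be the identity wherever the conjugators built so far have been decided. The
  reconstruction meets an obstacle: the permutation group does not determine the edges, since
  exchanging k-element edges and k-element nonedges leaves it unchanged. By homogeneity it does
  determine which maps between finite sets are partial isomorphisms, and the parameters are compared
  through these.\<close>

definition admissible :: "(nat \<Rightarrow> bool) \<Rightarrow> (nat \<Rightarrow> nat) \<Rightarrow> 'v set \<Rightarrow> 'v set set \<Rightarrow> bool" where
  "admissible \<eta> \<zeta> V F \<longleftrightarrow>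
     (\<forall>e\<in>F. e \<subseteq> V \<and> finite e \<and> \<eta> (card e)) \<and>
     (\<forall>n S. n < \<zeta> n \<longrightarrow> S \<subseteq> V \<longrightarrow> card S = \<zeta> n \<longrightarrow> (\<exists>e\<subseteq>S. card e = n \<and> e \<notin> F))"

text \<open>Only edges inside \<open>A\<close> and inside its image count, so a single edge set
  describes all its induced subhypergraphs.\<close>

definition edge_embedding :: "'v set \<Rightarrow> 'v set set \<Rightarrow> ('v \<Rightarrow> 'w) \<Rightarrow> 'w set set \<Rightarrow> bool" where
  "edge_embedding A F f F' \<longleftrightarrow> inj_on f A \<and> (\<forall>e\<subseteq>A. f ` e \<in> F' \<longleftrightarrow> e \<in> F)"

definition edge_automorphism :: "'v set \<Rightarrow> 'v set set \<Rightarrow> ('v \<Rightarrow> 'v) \<Rightarrow> bool" where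
  "edge_automorphism B F q \<longleftrightarrow> bij_betw q B B \<and> edge_embedding B F q F"

lemma extend_inj_to_bij:
  assumes "finite W" "A \<subseteq> W" "p ` A \<subseteq> W" "inj_on p A"
  obtains \<pi> where "bij_betw \<pi> W W" "\<And>x. x \<in> A \<Longrightarrow> \<pi> x = p x"
proof -
  have "card (W - A) = card (W - p ` A)"
    using assms by (simp add: card_Diff_subset finite_subset card_image)
  then obtain h where h: "bij_betw h (W - A) (W - p ` A)"
    using assms(1) by (metis finite_Diff finite_same_card_bij)
  define \<pi> where "\<pi> x = (if x \<in> A then p x else h x)" for x
  have 1: "bij_betw \<pi> A (p ` A)" using assms(4) by (auto simp: bij_betw_def inj_on_def \<pi>_def)
  have 2: "bij_betw \<pi> (W - A) (W - p ` A)"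
    using h by (rule bij_betw_cong[THEN iffD1, rotated]) (auto simp: \<pi>_def)
  have "bij_betw \<pi> (A \<union> (W - A)) (p ` A \<union> (W - p ` A))"
    by (rule bij_betw_combine[OF 1 2]) auto
  moreover have "A \<union> (W - A) = W" "p ` A \<union> (W - p ` A) = W" using assms by auto
  ultimately show ?thesis using that[of \<pi>] by (simp add: \<pi>_def)
qed

text \<open>This is where n \<ge> 2 enters: any two points of a forbidden clique lie on a common
  edge, so a set containing two points that no edge joins is never such a clique.\<close>

lemma subset_card_containing_pair:
  assumes "finite S" "v \<in> S" "w \<in> S" "v \<noteq> w" "2 \<le> n" "n \<le> card S"
  obtains e where "e \<subseteq> S" "card e = n" "v \<in> e" "w \<in> e"
proof -
  have "card (S - {v, w}) = card S - 2" using assms by (simp add: card_Diff_subset)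
  then have "n - 2 \<le> card (S - {v, w})" using assms by simp
  then obtain T where T: "T \<subseteq> S - {v, w}" "card T = n - 2" "finite T" by (rule obtain_subset_with_card_n)
  have vw: "w \<notin> T" "v \<notin> insert w T" using T assms(4) by auto
  have "card (insert v (insert w T)) = n"
    using T(2,3) assms(5) vw by (simp add: card_insert_disjoint)
  moreover have "insert v (insert w T) \<subseteq> S" using T(1) assms(2,3) by blast
  ultimately show ?thesis using that by blast
qed

text \<open>The edges of the hypergraph built next are decided by a parity; flipping truth values
  along an even set therefore preserves them.\<close>

lemma odd_card_xor:
  assumes "finite e"
  shows "odd (card {v\<in>e. P v \<noteq> Q v}) \<longleftrightarrow> odd (card {v\<in>e. P v}) \<noteq> odd (card {v\<in>e. Q v})"
  using assms
proof (induction e)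
  case (insert v e)
  have *: "{u \<in> insert v e. R u} = (if R v then insert v {u\<in>e. R u} else {u\<in>e. R u})" for R by auto
  show ?case unfolding * using insert by auto
qed simp

text \<open>A vertex of \<open>B\<close> is a pair of \<open>x \<in> W\<close> and a set \<open>C\<close> of subsets of \<open>W\<close>. A set \<open>e\<close> of vertices with
  distinct first components, whose set is \<open>S\<close>, is an edge iff \<open>S \<in> C\<close> for an odd number of its
  vertices. This parity is invariant under permutations of \<open>W\<close> combined with, for each \<open>S\<close>, an even
  number of flips of the truth value of \<open>S \<in> C\<close>.\<close>

lemma hypergraph_EPPA:
  fixes W :: "'a::linorder set"
  assumes W: "finite W" and F: "\<And>e. e \<in> F \<Longrightarrow> e \<subseteq> W \<and> e \<noteq> {} \<and> P (card e)"
  obtains B :: "('a \<times> 'a set set) set" and F0 and i where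
    "finite B" "\<And>e. e \<in> F0 \<Longrightarrow> e \<subseteq> B \<and> P (card e)" "i ` W \<subseteq> B" "edge_embedding W F i F0"
    "\<And>A p. A \<subseteq> W \<Longrightarrow> p ` A \<subseteq> W \<Longrightarrow> edge_embedding A F p F \<Longrightarrow>
        \<exists>q. edge_automorphism B F0 q \<and> (\<forall>x\<in>A. q (i x) = i (p x))"
proof -
  \<comment> \<open>Each edge of \<open>F\<close> is counted at exactly one of its vertices, its
    minimum, and every other set at none. So the copy of a set under \<open>i\<close> has odd parity
    exactly when the set is an edge.\<close>
  define C where "C x = {S\<in>F. x = Min S}" for x
  define i where "i x = (x, C x)" for x
  define B where "B = W \<times> Pow (Pow W)"
  define F0 where "F0 = {e. e \<subseteq> B \<and> inj_on fst e \<and> P (card e) \<and> odd (card {v\<in>e. fst ` e \<in> snd v})}"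
  have CX: "C x \<subseteq> Pow W" for x using F by (auto simp: C_def)
  have CS: "S \<in> C x \<Longrightarrow> x \<in> S" for S x
    using F W by (auto simp: C_def intro!: Min_in) (meson W F Min_in finite_subset)
  have fB: "finite B" using W by (simp add: B_def)
  have iX: "i ` W \<subseteq> B" using CX by (auto simp: i_def B_def)
  have emb: "edge_embedding W F i F0"
    unfolding edge_embedding_def
  proof (intro conjI allI impI)
    show "inj_on i W" by (auto simp: inj_on_def i_def)
    fix e assume e: "e \<subseteq> W"
    have fe: "fst ` i ` e = e" by (force simp: i_def)
    have inj: "inj_on i e" by (auto simp: inj_on_def i_def)
    have s: "{v\<in>i ` e. e \<in> snd v} = i ` {x\<in>e. e \<in> C x}" by (auto simp: i_def)
    have c: "card {v\<in>i ` e. e \<in> snd v} = card {x\<in>e. e \<in> C x}"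
      unfolding s by (rule card_image) (auto simp: inj_on_def i_def)
    have d: "{x\<in>e. e \<in> C x} = (if e \<in> F then {Min e} else {})"
      using CS[of e "Min e"] by (auto simp: C_def)
    have "i ` e \<subseteq> B" "inj_on fst (i ` e)" using iX e by (blast, auto simp: inj_on_def i_def)
    then show "i ` e \<in> F0 \<longleftrightarrow> e \<in> F"
      unfolding F0_def mem_Collect_eq fe c d card_image[OF inj] using F by auto
  qed
  have ext: "\<exists>q. edge_automorphism B F0 q \<and> (\<forall>x\<in>A. q (i x) = i (p x))"
    if A: "A \<subseteq> W" "p ` A \<subseteq> W" and p: "edge_embedding A F p F" for A p
  proof -
    obtain \<pi> where \<pi>: "bij_betw \<pi> W W" "\<And>x. x \<in> A \<Longrightarrow> \<pi> x = p x"
      using extend_inj_to_bij[OF W A] p by (auto simp: edge_embedding_def)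
    note \<pi>inj = bij_betw_imp_inj_on[OF \<pi>(1)]
    have \<pi>i: "\<pi> ` S = \<pi> ` S' \<longleftrightarrow> S = S'" if "S \<subseteq> W" "S' \<subseteq> W" for S S'
      using \<pi>(1) that by (meson bij_betw_def inj_on_image_eq_iff)
    \<comment> \<open>The points of \<open>A\<close> at which the value of \<open>S\<close> must be
      flipped if \<open>q\<close> is to map \<open>i x\<close> to \<open>i (p x)\<close>.\<close>
    define T0 where "T0 S = {x\<in>S \<inter> A. (S \<in> C x) \<noteq> (\<pi> ` S \<in> C (\<pi> x))}" for S
    \<comment> \<open>Since \<open>p\<close> preserves edges, \<open>S\<close> and its image are
      both edges or both nonedges. The values differ at \<open>Min S\<close> and at the preimage of
      the minimum of the image, unless these two points coincide, or nowhere.\<close>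
    have T0even: "even (card (T0 S))" if S: "S \<subseteq> A" for S
    proof (cases "S \<in> F")
      case False
      have "\<pi> ` S = p ` S" using \<pi>(2) S by (intro image_cong) auto
      then have "\<pi> ` S \<notin> F" using False p S by (auto simp: edge_embedding_def)
      then have "T0 S = {}" using False by (auto simp: T0_def C_def)
      then show ?thesis by simp
    next
      case True
      have e: "\<pi> ` S = p ` S" using \<pi>(2) S by (intro image_cong) auto
      then have F': "\<pi> ` S \<in> F" using True p S by (auto simp: edge_embedding_def)
      have fS: "finite S" using S A W by (meson finite_subset)
      have m: "Min S \<in> S" using True F fS by (meson Min_in)
      have "Min (\<pi> ` S) \<in> \<pi> ` S" using F' F fS by (meson Min_in finite_imageI)
      then obtain y where y: "y \<in> S" "\<pi> y = Min (\<pi> ` S)" by (metis imageE)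
      have "\<pi> x = \<pi> y \<longleftrightarrow> x = y" if "x \<in> S" for x
        using inj_on_eq_iff[OF \<pi>inj] that y(1) S A by blast
      then have *: "S \<in> C x \<longleftrightarrow> x = Min S" "\<pi> ` S \<in> C (\<pi> x) \<longleftrightarrow> x = y" if "x \<in> S" for x
        using that True F' y(2) by (simp_all add: C_def)
      have "T0 S = {x\<in>S. (x = Min S) \<noteq> (x = y)}"
        using S by (auto simp: T0_def * cong: conj_cong)
      also have "\<dots> = (if y = Min S then {} else {Min S, y})" using y m by auto
      finally show ?thesis by auto
    qed
    \<comment> \<open>Nothing is prescribed outside \<open>A\<close>: if \<open>S\<close> is not
      inside \<open>A\<close>, flipping one further point of \<open>S - A\<close> makes the number
      of flips even.\<close>
    have "\<exists>T. T \<subseteq> S \<and> even (card T) \<and> T \<inter> A = T0 S" if S: "S \<subseteq> W" for S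
    proof -
      have T0S: "T0 S \<subseteq> S" "T0 S \<subseteq> A" by (auto simp: T0_def)
      have fT: "finite (T0 S)" using finite_subset[OF S W] by (simp add: T0_def)
      consider "even (card (T0 S))" | "odd (card (T0 S))" "\<not> S \<subseteq> A" using T0even by blast
      then show ?thesis
      proof cases
        case 1 then show ?thesis using T0S by (intro exI[of _ "T0 S"]) blast
      next
        case 2
        then obtain y where y: "y \<in> S" "y \<notin> A" by blast
        then have "even (card (insert y (T0 S)))" using 2(1) fT T0S by (subst card_insert_disjoint) auto
        with y T0S show ?thesis by (intro exI[of _ "insert y (T0 S)"]) blast
      qed
    qed
    then have "\<forall>S. \<exists>T. S \<subseteq> W \<longrightarrow> T \<subseteq> S \<and> even (card T) \<and> T \<inter> A = T0 S" by blast
    from choice[OF this] obtain T where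
      T: "\<And>S. S \<subseteq> W \<Longrightarrow> T S \<subseteq> S \<and> even (card (T S)) \<and> T S \<inter> A = T0 S" by blast
    define q where "q v = (\<pi> (fst v), {\<pi> ` S | S. S \<subseteq> W \<and> (S \<in> snd v) \<noteq> (fst v \<in> T S)})" for v
    have qS: "\<pi> ` S \<in> snd (q v) \<longleftrightarrow> (S \<in> snd v) \<noteq> (fst v \<in> T S)" if "S \<subseteq> W" for S v
    proof -
      have "\<pi> ` S \<in> snd (q v) \<longleftrightarrow> (\<exists>S'\<subseteq>W. \<pi> ` S = \<pi> ` S' \<and> (S' \<in> snd v) \<noteq> (fst v \<in> T S'))"
        unfolding q_def by auto
      also have "\<dots> \<longleftrightarrow> (\<exists>S'\<subseteq>W. S = S' \<and> (S' \<in> snd v) \<noteq> (fst v \<in> T S'))"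
        using \<pi>i[OF that] by (intro ex_cong1 conj_cong) simp_all
      finally show ?thesis using that by simp
    qed
    have \<pi>S: "\<pi> ` S \<subseteq> W" if "S \<subseteq> W" for S
      using image_mono[OF that] bij_betw_imp_surj_on[OF \<pi>(1)] by metis
    have fstq: "fst (q v) = \<pi> (fst v)" for v unfolding q_def fst_conv by (rule refl)
    have qB: "q ` B \<subseteq> B"
    proof
      fix u assume "u \<in> q ` B"
      then obtain v where v: "v \<in> B" and u: "u = q v" by blast
      have "fst u \<in> W" using v bij_betwE[OF \<pi>(1)] by (simp add: u fstq B_def mem_Times_iff)
      moreover have "snd u \<subseteq> Pow W"
      proof
        fix t assume "t \<in> snd u"
        then obtain S where "t = \<pi> ` S" "S \<subseteq> W" unfolding u q_def by auto
        then show "t \<in> Pow W" using \<pi>S by simp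
      qed
      ultimately show "u \<in> B" by (simp add: B_def mem_Times_iff)
    qed
    have qinj: "inj_on q B"
    proof (rule inj_onI)
      fix v w assume vw: "v \<in> B" "w \<in> B" "q v = q w"
      then have "\<pi> (fst v) = \<pi> (fst w)" using fstq by metis
      then have f: "fst v = fst w" using vw inj_on_eq_iff[OF \<pi>inj] by (simp add: B_def mem_Times_iff)
      have "S \<in> snd v \<longleftrightarrow> S \<in> snd w" if "S \<subseteq> W" for S
        using qS[OF that, of v] qS[OF that, of w] vw(3) f by metis
      then have "snd v = snd w" using vw by (auto simp: B_def)
      with f show "v = w" by (simp add: prod_eq_iff)
    qed
    have qbij: "bij_betw q B B" using qB qinj fB by (simp add: bij_betw_def endo_inj_surj)
    have "edge_embedding B F0 q F0"
      unfolding edge_embedding_def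
    proof (intro conjI allI impI)
      fix e assume e: "e \<subseteq> B"
      have fe: "finite e" using finite_subset[OF e fB] .
      have S: "fst ` e \<subseteq> W" using e by (auto simp: B_def)
      have inj: "inj_on q e" using qinj e inj_on_subset by blast
      have f: "fst ` q ` e = \<pi> ` fst ` e" by (simp add: fstq image_image)
      have fq: "fst \<circ> q = \<pi> \<circ> fst" by (simp add: fun_eq_iff fstq)
      have i1: "inj_on fst (q ` e) \<longleftrightarrow> inj_on fst e"
      proof -
        have "inj_on fst (q ` e) \<longleftrightarrow> inj_on (\<pi> \<circ> fst) e" using comp_inj_on_iff[OF inj, of fst] fq by simp
        also have "\<dots> \<longleftrightarrow> inj_on fst e"
          using comp_inj_on[OF _ inj_on_subset[OF \<pi>inj S]] inj_on_imageI2 by blast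
        finally show ?thesis .
      qed
      have "odd (card {v\<in>q ` e. fst ` q ` e \<in> snd v}) \<longleftrightarrow> odd (card {v\<in>e. fst ` e \<in> snd v})"
        if "inj_on fst e"
      proof -
        have "{v\<in>q ` e. fst ` q ` e \<in> snd v} = q ` {v\<in>e. (fst ` e \<in> snd v) \<noteq> (fst v \<in> T (fst ` e))}"
          unfolding f using qS[OF S] by auto
        then have "card {v\<in>q ` e. fst ` q ` e \<in> snd v} = card {v\<in>e. (fst ` e \<in> snd v) \<noteq> (fst v \<in> T (fst ` e))}"
          by (simp add: card_image inj_on_subset[OF inj])
        \<comment> \<open>The first components in \<open>e\<close> are distinct, so the flipped
          vertices of \<open>e\<close> correspond to the flipped points of its projection, and their
          number is even.\<close>
        moreover have "card {v\<in>e. fst v \<in> T (fst ` e)} = card (T (fst ` e))"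
        proof -
          have "fst ` {v\<in>e. fst v \<in> T (fst ` e)} = T (fst ` e)" using T[OF S] by auto
          moreover have "inj_on fst {v\<in>e. fst v \<in> T (fst ` e)}" by (rule inj_on_subset[OF that]) auto
          ultimately show ?thesis using card_image[of fst "{v\<in>e. fst v \<in> T (fst ` e)}"] by presburger
        qed
        ultimately show ?thesis
          using odd_card_xor[OF fe, of "\<lambda>v. fst ` e \<in> snd v" "\<lambda>v. fst v \<in> T (fst ` e)"] T[OF S]
          by presburger
      qed
      then show "q ` e \<in> F0 \<longleftrightarrow> e \<in> F0"
        using e qB by (auto simp: F0_def i1 card_image[OF inj])
    qed (rule qinj)
    moreover have "q (i x) = i (p x)" if x: "x \<in> A" for x
    proof -
      have px: "\<pi> x = p x" using \<pi> x by simp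
      have *: "(S \<in> C x) \<noteq> (x \<in> T S) \<longleftrightarrow> \<pi> ` S \<in> C (\<pi> x)" if S: "S \<subseteq> W" for S
      proof (cases "x \<in> S")
        case True
        then have "x \<in> T S \<longleftrightarrow> x \<in> T0 S" using T[OF S] x by auto
        then show ?thesis using True x by (auto simp: T0_def)
      next
        case False
        then have "x \<notin> T S" "S \<notin> C x" using T[OF S] CS by auto
        moreover have "\<pi> x \<notin> \<pi> ` S"
          using False inj_on_image_mem_iff[OF \<pi>inj _ S] x A by blast
        then have "\<pi> ` S \<notin> C (\<pi> x)" using CS by blast
        ultimately show ?thesis by simp
      qed
      have "{\<pi> ` S | S. S \<subseteq> W \<and> (S \<in> C x) \<noteq> (x \<in> T S)} = C (\<pi> x)"
      proof
        show "C (\<pi> x) \<subseteq> {\<pi> ` S | S. S \<subseteq> W \<and> (S \<in> C x) \<noteq> (x \<in> T S)}"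
        proof
          fix S' assume S': "S' \<in> C (\<pi> x)"
          then have "S' \<subseteq> W" using CX by blast
          then obtain S where "S \<subseteq> W" "S' = \<pi> ` S" using \<pi>(1) by (metis bij_betw_def subset_imageE)
          with * S' show "S' \<in> {\<pi> ` S | S. S \<subseteq> W \<and> (S \<in> C x) \<noteq> (x \<in> T S)}" by blast
        qed
      qed (use * in blast)
      then show ?thesis by (simp add: q_def i_def px)
    qed
    ultimately show ?thesis using qbij by (auto simp: edge_automorphism_def)
  qed
  show ?thesis
    by (rule that[of B F0 i]) (use fB iX emb ext in \<open>auto simp: F0_def\<close>)
qed

text \<open>A vertex over \<open>v \<in> B0\<close> chooses, for each forbidden clique \<open>I\<close> through \<open>v\<close>, a number below
  \<open>card I - 1\<close>, and the choices of the vertices of an edge have to be distinct. By the pigeonhole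
  principle no forbidden clique lifts.\<close>

lemma clique_free_EPPA:
  fixes B0 :: "'v set"
  assumes B0: "finite B0" and F0: "\<And>e. e \<in> F0 \<Longrightarrow> e \<subseteq> B0 \<and> \<eta> (card e)"
    and \<zeta>: "\<And>n. n < \<zeta> n \<Longrightarrow> 2 \<le> n"
    and W: "W \<subseteq> B0" and admW: "admissible \<eta> \<zeta> W (F0 \<inter> Pow W)"
  obtains B :: "('v \<times> ('v set \<Rightarrow> nat)) set" and F i where
    "finite B" "admissible \<eta> \<zeta> B F" "i ` W \<subseteq> B" "edge_embedding W F0 i F"
    "\<And>A q. A \<subseteq> W \<Longrightarrow> q ` A \<subseteq> W \<Longrightarrow> edge_automorphism B0 F0 q \<Longrightarrow>
        \<exists>r. edge_automorphism B F r \<and> (\<forall>x\<in>A. r (i x) = i (q x))"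
proof -
  define bad where "bad I \<longleftrightarrow> I \<subseteq> B0 \<and> (\<exists>n. n < \<zeta> n \<and> card I = \<zeta> n \<and> (\<forall>e\<subseteq>I. card e = n \<longrightarrow> e \<in> F0))" for I
  \<comment> \<open>The value 0 where there is nothing to choose keeps \<open>B\<close> finite and
    lets equality of vertices be tested on the bad sets.\<close>
  define B where "B = {v :: 'v \<times> ('v set \<Rightarrow> nat). fst v \<in> B0 \<and>
    (\<forall>I. bad I \<longrightarrow> fst v \<in> I \<longrightarrow> snd v I < card I - 1) \<and>
    (\<forall>I. \<not> (bad I \<and> fst v \<in> I) \<longrightarrow> snd v I = 0)}"
  define F where "F = {e. e \<subseteq> B \<and> inj_on fst e \<and> fst ` e \<in> F0 \<and>
    (\<forall>v\<in>e. \<forall>w\<in>e. \<forall>I. v \<noteq> w \<longrightarrow> bad I \<longrightarrow> fst v \<in> I \<longrightarrow> fst w \<in> I \<longrightarrow> snd v I \<noteq> snd w I)}"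
  have badB: "I \<subseteq> B0" "finite I" if "bad I" for I using that finite_subset[OF _ B0] by (auto simp: bad_def)
  have Bsnd: "snd v I < card I - 1" if "v \<in> B" "bad I" "fst v \<in> I" for v I
    using that by (simp add: B_def)
  have B0snd: "snd v I = 0" if "v \<in> B" "\<not> (bad I \<and> fst v \<in> I)" for v I
    using that by (simp add: B_def)
  have Bfst: "fst v \<in> B0" if "v \<in> B" for v using that by (simp add: B_def)
  have fB: "finite B"
  proof -
    have "finite {f. \<forall>x. (x \<in> Pow B0 \<longrightarrow> f x \<in> {..card B0}) \<and> (x \<notin> Pow B0 \<longrightarrow> f x = 0)}"
      using B0 by (intro finite_set_of_finite_funs) auto
    moreover have bound: "snd v I \<le> card B0 \<and> (\<not> I \<subseteq> B0 \<longrightarrow> snd v I = 0)" if "v \<in> B" for v I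
    proof (cases "bad I \<and> fst v \<in> I")
      case True
      then have "snd v I < card I - 1" using Bsnd[OF that] by blast
      moreover have "card I \<le> card B0" using True badB B0 card_mono by blast
      ultimately show ?thesis using True badB by auto
    next
      case False
      then show ?thesis using B0snd[OF that] by simp
    qed
    have "snd ` B \<subseteq> {f. \<forall>x. (x \<in> Pow B0 \<longrightarrow> f x \<in> {..card B0}) \<and> (x \<notin> Pow B0 \<longrightarrow> f x = 0)}"
      using bound by (simp add: image_subset_iff)
    ultimately have "finite (snd ` B)" using finite_subset by blast
    moreover have "B \<subseteq> B0 \<times> snd ` B" by (auto simp: B_def image_iff)
    ultimately show ?thesis using B0 by (meson finite_SigmaI finite_subset)
  qed
  have adm: "admissible \<eta> \<zeta> B F"
    unfolding admissible_def
  proof (intro conjI ballI allI impI)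
    fix e assume e: "e \<in> F"
    then show "e \<subseteq> B" by (simp add: F_def)
    then show "finite e" using fB finite_subset by blast
    show "\<eta> (card e)" using e F0[of "fst ` e"] by (simp add: F_def card_image)
  next
    fix n S assume n: "n < \<zeta> n" and S: "S \<subseteq> B" "card S = \<zeta> n"
    show "\<exists>e\<subseteq>S. card e = n \<and> e \<notin> F"
    proof (rule ccontr)
      assume "\<not> ?thesis"
      then have all: "e \<in> F" if "e \<subseteq> S" "card e = n" for e using that by blast
      have fS: "finite S" using S(1) fB finite_subset by blast
      \<comment> \<open>Any two points of the clique \<open>S\<close> lie on an edge. So they have
        distinct first components, the projection of \<open>S\<close> is bad, and the choices made
        at it are distinct.\<close>
      have pair: "\<exists>e\<subseteq>S. v \<in> e \<and> w \<in> e \<and> e \<in> F" if "v \<in> S" "w \<in> S" "v \<noteq> w" for v w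
        using subset_card_containing_pair[OF fS that \<zeta>[OF n]] n S(2) all by (metis less_imp_le)
      have inj: "inj_on fst S"
      proof (rule inj_onI, rule ccontr)
        fix v w assume vw: "v \<in> S" "w \<in> S" "fst v = fst w" "v \<noteq> w"
        then obtain e where "v \<in> e" "w \<in> e" "e \<in> F" using pair by blast
        then show False using vw by (auto simp: F_def inj_on_def)
      qed
      have sub: "fst ` S \<subseteq> B0" using S(1) by (auto simp: B_def)
      have "e' \<in> F0" if e': "e' \<subseteq> fst ` S" "card e' = n" for e'
      proof -
        obtain e where e: "e \<subseteq> S" "e' = fst ` e" using e'(1) by (rule subset_imageE) blast
        then have "card e = n" using e' inj card_image inj_on_subset by metis
        then show ?thesis using all e by (auto simp: F_def)
      qed
      then have bad: "bad (fst ` S)"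
        using n S(2) sub card_image[OF inj] by (auto simp: bad_def)
      have "inj_on (\<lambda>v. snd v (fst ` S)) S"
      proof (rule inj_onI, rule ccontr)
        fix v w assume vw: "v \<in> S" "w \<in> S" "snd v (fst ` S) = snd w (fst ` S)" "v \<noteq> w"
        then obtain e where "v \<in> e" "w \<in> e" "e \<in> F" using pair by blast
        then show False using vw bad by (auto simp: F_def)
      qed
      moreover have "(\<lambda>v. snd v (fst ` S)) ` S \<subseteq> {..<card S - 1}"
      proof
        fix k assume "k \<in> (\<lambda>v. snd v (fst ` S)) ` S"
        then obtain v where v: "v \<in> S" "k = snd v (fst ` S)" by blast
        then have "v \<in> B" "fst v \<in> fst ` S" using S(1) by auto
        then have "snd v (fst ` S) < card (fst ` S) - 1" using Bsnd bad by blast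
        then show "k \<in> {..<card S - 1}" using v by (simp add: card_image[OF inj])
      qed
      ultimately have "card S \<le> card {..<card S - 1}" by (rule card_inj_on_le) simp
      then have "card S \<le> card S - 1" unfolding card_lessThan .
      then show False using n S(2) by linarith
    qed
  qed
  \<comment> \<open>A bad \<open>I\<close> is not inside \<open>W\<close>, because \<open>W\<close>
    is admissible. So \<open>I \<inter> W\<close> has at most \<open>card I - 1\<close> points, and
    they can be given distinct choices.\<close>
  have "\<exists>t. inj_on t (I \<inter> W) \<and> t ` (I \<inter> W) \<subseteq> {..<card I - 1}" if I: "bad I" for I
  proof -
    have "\<not> I \<subseteq> W"
    proof
      assume sub: "I \<subseteq> W"
      obtain n where n: "n < \<zeta> n" "card I = \<zeta> n" "\<And>e. e \<subseteq> I \<Longrightarrow> card e = n \<Longrightarrow> e \<in> F0"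
        using I unfolding bad_def by blast
      then obtain e where "e \<subseteq> I" "card e = n" "e \<notin> F0 \<inter> Pow W"
        using admW sub unfolding admissible_def by blast
      then show False using n(3) sub by blast
    qed
    then have "card (I \<inter> W) < card I" using badB[OF I] by (intro psubset_card_mono) auto
    then have "card (I \<inter> W) \<le> card {..<card I - 1}" by simp
    then show ?thesis using badB[OF I] inj_on_iff_card_le[of "I \<inter> W" "{..<card I - 1}"] by simp
  qed
  then have "\<forall>I. \<exists>t. bad I \<longrightarrow> inj_on t (I \<inter> W) \<and> t ` (I \<inter> W) \<subseteq> {..<card I - 1}" by blast
  from choice[OF this] obtain t where
    t: "\<And>I. bad I \<Longrightarrow> inj_on (t I) (I \<inter> W)" "\<And>I. bad I \<Longrightarrow> t I ` (I \<inter> W) \<subseteq> {..<card I - 1}" by blast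
  define i where "i x = (x, \<lambda>I. if bad I \<and> x \<in> I then t I x else 0)" for x
  have fsti: "fst (i x) = x" for x by (simp add: i_def)
  have sndi: "snd (i x) I = (if bad I \<and> x \<in> I then t I x else 0)" for x I by (simp add: i_def)
  have iB: "i ` W \<subseteq> B"
  proof
    fix v assume "v \<in> i ` W"
    then obtain x where x: "x \<in> W" "v = i x" by blast
    have "t I x < card I - 1" if "bad I" "x \<in> I" for I using t(2)[OF that(1)] that(2) x(1) by blast
    then show "v \<in> B" unfolding B_def using W x by (auto simp: fsti sndi)
  qed
  have emb: "edge_embedding W F0 i F"
    unfolding edge_embedding_def
  proof (intro conjI allI impI)
    show "inj_on i W" by (metis fsti inj_on_inverseI)
    fix e assume e: "e \<subseteq> W"
    have 1: "inj_on fst (i ` e)" by (auto simp: inj_on_def fsti)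
    have 2: "fst ` i ` e = e" by (simp add: image_image fsti)
    have 3: "snd v I \<noteq> snd w I"
      if "v \<in> i ` e" "w \<in> i ` e" "v \<noteq> w" "bad I" "fst v \<in> I" "fst w \<in> I" for v w I
    proof -
      note vw = that
      obtain x y where xy: "v = i x" "x \<in> e" "w = i y" "y \<in> e"
        using vw(1,2) by blast
      have "x \<noteq> y" "x \<in> I \<inter> W" "y \<in> I \<inter> W" using xy that e by (auto simp: fsti)
      then have "t I x \<noteq> t I y" using t(1)[OF that(4)] by (meson inj_onD)
      then show ?thesis using that(4) \<open>x \<in> I \<inter> W\<close> \<open>y \<in> I \<inter> W\<close> by (simp add: xy sndi)
    qed
    have 4: "i ` e \<subseteq> B" using iB e by blast
    show "i ` e \<in> F \<longleftrightarrow> e \<in> F0"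
      unfolding F_def mem_Collect_eq 2 using 1 3 4 by blast
  qed
  have ext: "\<exists>r. edge_automorphism B F r \<and> (\<forall>x\<in>A. r (i x) = i (q x))"
    if A: "A \<subseteq> W" "q ` A \<subseteq> W" and q: "edge_automorphism B0 F0 q" for A q
  proof -
    have qb: "bij_betw q B0 B0" and qF: "\<And>e. e \<subseteq> B0 \<Longrightarrow> q ` e \<in> F0 \<longleftrightarrow> e \<in> F0"
      using q by (auto simp: edge_automorphism_def edge_embedding_def)
    note qi = bij_betw_imp_inj_on[OF qb]
    have qB0: "q ` B0 = B0" using bij_betw_imp_surj_on[OF qb] .
    have qS: "q ` I \<subseteq> B0" "card (q ` I) = card I" if "I \<subseteq> B0" for I
      using that qB0 image_mono card_image inj_on_subset[OF qi] by (metis, metis)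
    have mem: "q x \<in> q ` I \<longleftrightarrow> x \<in> I" if "I \<subseteq> B0" "x \<in> B0" for x I
      using inj_on_image_mem_iff[OF qi that(2,1)] .
    have badq: "bad (q ` I)" if I: "bad I" for I
    proof -
      obtain n where n: "n < \<zeta> n" "card I = \<zeta> n" "\<And>e. e \<subseteq> I \<Longrightarrow> card e = n \<Longrightarrow> e \<in> F0"
        using I unfolding bad_def by blast
      have "e \<in> F0" if e: "e \<subseteq> q ` I" "card e = n" for e
      proof -
        obtain e' where e': "e' \<subseteq> I" "e = q ` e'" using e(1) by (rule subset_imageE) blast
        then show ?thesis using n(3)[of e'] e(2) qF[of e'] qS[of e'] badB(1)[OF I] by auto
      qed
      moreover have "card (q ` I) = \<zeta> n" using n(2) qS(2)[OF badB(1)[OF I]] by simp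
      ultimately show ?thesis unfolding bad_def using n(1) qS(1)[OF badB(1)[OF I]] by blast
    qed
    define pre where "pre J = {x\<in>B0. q x \<in> J}" for J
    have preq: "pre (q ` I) = I" if "I \<subseteq> B0" for I using mem[OF that] that by (auto simp: pre_def)
    have qpre: "q ` pre J = J" "pre J \<subseteq> B0" if "J \<subseteq> B0" for J
      using that qB0 by (force simp: pre_def)+
    have badpre: "bad (pre J)" if J: "bad J" for J
    proof -
      obtain n where n: "n < \<zeta> n" "card J = \<zeta> n" "\<And>e. e \<subseteq> J \<Longrightarrow> card e = n \<Longrightarrow> e \<in> F0"
        using J unfolding bad_def by blast
      note p = qpre[OF badB(1)[OF J]]
      have "e \<in> F0" if e: "e \<subseteq> pre J" "card e = n" for e
      proof -
        have "e \<subseteq> B0" "q ` e \<subseteq> J" using e p by auto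
        then show ?thesis using n(3)[of "q ` e"] e(2) qF[of e] qS[of e] by auto
      qed
      moreover have "card (pre J) = \<zeta> n" using n(2) p(1) qS(2)[OF p(2)] by simp
      ultimately show ?thesis unfolding bad_def using n(1) p(2) by blast
    qed
    \<comment> \<open>Over \<open>I\<close> the choices must be permuted so that the one made by
      \<open>i x\<close> becomes the one that \<open>i (q x)\<close> makes at the image of
      \<open>I\<close>. On \<open>A \<inter> I\<close> this prescribes a partial injection, as
      \<open>t\<close> is injective on the trace of \<open>W\<close> on every bad set, and it
      extends to a permutation.\<close>
    have "\<exists>\<rho>. bij_betw \<rho> {..<card I - 1} {..<card I - 1} \<and> (\<forall>x\<in>A \<inter> I. \<rho> (t I x) = t (q ` I) (q x))"
      if I: "bad I" for I
    proof -
      define p where "p k = t (q ` I) (q (inv_into (I \<inter> W) (t I) k))" for k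
      note tI = t[OF I] and tq = t[OF badq[OF I]]
      have pt: "p (t I x) = t (q ` I) (q x)" if "x \<in> A \<inter> I" for x
        using that A(1) by (simp add: p_def inv_into_f_f[OF tI(1)] subset_iff)
      have s: "t I ` (A \<inter> I) \<subseteq> {..<card I - 1}" using tI(2) A(1) by blast
      have "p ` t I ` (A \<inter> I) = t (q ` I) ` q ` (A \<inter> I)" unfolding image_image using pt by (intro image_cong) auto
      moreover have "q ` (A \<inter> I) \<subseteq> q ` I \<inter> W" using A(2) by blast
      ultimately have pr: "p ` t I ` (A \<inter> I) \<subseteq> {..<card I - 1}"
        using image_mono tq(2)[unfolded qS(2)[OF badB(1)[OF I]]] by (metis subset_trans)
      have "inj_on p (t I ` (A \<inter> I))"
      proof (rule inj_onI)
        fix a b assume "a \<in> t I ` (A \<inter> I)" "b \<in> t I ` (A \<inter> I)" and pp: "p a = p b"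
        then obtain x y where xy: "x \<in> A \<inter> I" "y \<in> A \<inter> I" "a = t I x" "b = t I y" by blast
        then have "t (q ` I) (q x) = t (q ` I) (q y)" using pp pt by simp
        then have "q x = q y" using tq(1) xy A(2) by (auto dest: inj_onD)
        moreover have "x \<in> B0" "y \<in> B0" using xy badB(1)[OF I] by auto
        ultimately have "x = y" using qi by (meson inj_onD)
        then show "a = b" using xy by simp
      qed
      from extend_inj_to_bij[OF finite_lessThan s pr this]
      obtain \<rho> where "bij_betw \<rho> {..<card I - 1} {..<card I - 1}"
        "\<And>k. k \<in> t I ` (A \<inter> I) \<Longrightarrow> \<rho> k = p k" by blast
      then show ?thesis using pt by auto
    qed
    then have "\<forall>I. \<exists>\<rho>. bad I \<longrightarrow> bij_betw \<rho> {..<card I - 1} {..<card I - 1} \<and>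
        (\<forall>x\<in>A \<inter> I. \<rho> (t I x) = t (q ` I) (q x))" by blast
    from choice[OF this] obtain \<rho> where
      \<rho>: "\<And>I. bad I \<Longrightarrow> bij_betw (\<rho> I) {..<card I - 1} {..<card I - 1}"
         "\<And>I x. bad I \<Longrightarrow> x \<in> A \<Longrightarrow> x \<in> I \<Longrightarrow> \<rho> I (t I x) = t (q ` I) (q x)" by blast
    define r where "r v = (q (fst v), \<lambda>J. if bad J \<and> q (fst v) \<in> J then \<rho> (pre J) (snd v (pre J)) else 0)" for v :: "'v \<times> ('v set \<Rightarrow> nat)"
    have fstr: "fst (r v) = q (fst v)" for v by (simp add: r_def)
    have sndr: "snd (r v) J = (if bad J \<and> q (fst v) \<in> J then \<rho> (pre J) (snd v (pre J)) else 0)" for v J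
      by (simp add: r_def)
    have sndrq: "snd (r v) (q ` I) = \<rho> I (snd v I)" if "bad I" "fst v \<in> I" for v I
      using that badq[OF that(1)] preq[OF badB(1)[OF that(1)]] by (simp add: sndr)
    have \<rho>inj: "\<rho> I (snd v I) = \<rho> I (snd w I) \<longleftrightarrow> snd v I = snd w I"
      if "v \<in> B" "w \<in> B" "bad I" "fst v \<in> I" "fst w \<in> I" for v w I
      using inj_on_eq_iff[OF bij_betw_imp_inj_on[OF \<rho>(1)[OF that(3)]]] Bsnd that by simp
    have rB: "r ` B \<subseteq> B"
    proof
      fix u assume "u \<in> r ` B"
      then obtain v where v: "v \<in> B" and u: "u = r v" by blast
      have 1: "fst u \<in> B0" using Bfst[OF v] bij_betwE[OF qb] by (simp add: u fstr)
      have 2: "snd u J < card J - 1" if J: "bad J" "fst u \<in> J" for J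
      proof -
        have m: "fst v \<in> pre J" using J(2) Bfst[OF v] by (simp add: pre_def u fstr)
        have c: "card (pre J) = card J" using qpre[OF badB(1)[OF J(1)]] qS(2) by metis
        show ?thesis using Bsnd[OF v badpre[OF J(1)] m] bij_betwE[OF \<rho>(1)[OF badpre[OF J(1)]]] J c
          by (simp add: u sndr fstr)
      qed
      have 3: "snd u J = 0" if "\<not> (bad J \<and> fst u \<in> J)" for J using that by (auto simp: u sndr fstr)
      show "u \<in> B" unfolding B_def mem_Collect_eq using 1 2 3 by auto
    qed
    have rinj: "inj_on r B"
    proof (rule inj_onI)
      fix v w assume vw: "v \<in> B" "w \<in> B" "r v = r w"
      have f: "fst v = fst w"
        using arg_cong[OF vw(3), of fst] Bfst vw(1,2) inj_on_eq_iff[OF qi] by (simp add: fstr)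
      have "snd v I = snd w I" for I
      proof (cases "bad I \<and> fst v \<in> I")
        case True
        then have "\<rho> I (snd v I) = \<rho> I (snd w I)" using sndrq[of I v] sndrq[of I w] vw(3) f by simp
        then show ?thesis using \<rho>inj True vw f by simp
      next
        case False
        then show ?thesis using B0snd vw f by simp
      qed
      with f show "v = w" by (simp add: prod_eq_iff fun_eq_iff)
    qed
    have rbij: "bij_betw r B B" using rB rinj fB by (simp add: bij_betw_def endo_inj_surj)
    have "edge_embedding B F r F"
      unfolding edge_embedding_def
    proof (intro conjI allI impI)
      fix e assume e: "e \<subseteq> B"
      have S: "fst ` e \<subseteq> B0" using e Bfst by auto
      have inj: "inj_on r e" using inj_on_subset[OF rinj e] .
      have f: "fst ` r ` e = q ` fst ` e" by (simp add: image_image fstr)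
      have i1: "inj_on fst (r ` e) \<longleftrightarrow> inj_on fst e"
      proof -
        have "inj_on fst (r ` e) \<longleftrightarrow> inj_on (q \<circ> fst) e"
          using comp_inj_on_iff[OF inj, of fst] by (simp add: comp_def fstr)
        also have "\<dots> \<longleftrightarrow> inj_on fst e"
          using comp_inj_on[OF _ inj_on_subset[OF qi S]] inj_on_imageI2 by blast
        finally show ?thesis .
      qed
      have c: "(\<forall>I. r v \<noteq> r w \<longrightarrow> bad I \<longrightarrow> fst (r v) \<in> I \<longrightarrow> fst (r w) \<in> I \<longrightarrow> snd (r v) I \<noteq> snd (r w) I) \<longleftrightarrow>
          (\<forall>I. v \<noteq> w \<longrightarrow> bad I \<longrightarrow> fst v \<in> I \<longrightarrow> fst w \<in> I \<longrightarrow> snd v I \<noteq> snd w I)" (is "?L \<longleftrightarrow> ?R")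
        if "v \<in> e" "w \<in> e" for v w
      proof
        have vw: "v \<in> B" "w \<in> B" using that e by auto
        have vwr: "r v = r w \<longleftrightarrow> v = w" using inj_on_eq_iff[OF rinj vw] .
        show ?R if L: ?L
        proof (intro allI impI)
          fix I assume I: "v \<noteq> w" "bad I" "fst v \<in> I" "fst w \<in> I"
          have "snd (r v) (q ` I) \<noteq> snd (r w) (q ` I)"
            using L badq[OF I(2)] I vwr by (simp add: fstr)
          then show "snd v I \<noteq> snd w I" using sndrq I by metis
        qed
        show ?L if R: ?R
        proof (intro allI impI)
          fix J assume J: "r v \<noteq> r w" "bad J" "fst (r v) \<in> J" "fst (r w) \<in> J"
          have m: "fst v \<in> pre J" "fst w \<in> pre J" using J Bfst vw by (auto simp: pre_def fstr)
          then have "snd v (pre J) \<noteq> snd w (pre J)" using R J badpre vwr by blast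
          then have "snd (r v) (q ` pre J) \<noteq> snd (r w) (q ` pre J)"
            using sndrq[OF badpre[OF J(2)]] m \<rho>inj[OF vw badpre[OF J(2)] m] by simp
          then show "snd (r v) J \<noteq> snd (r w) J" using qpre(1)[OF badB(1)[OF J(2)]] by simp
        qed
      qed
      have "r ` e \<subseteq> B" using rB e by blast
      then show "r ` e \<in> F \<longleftrightarrow> e \<in> F"
        unfolding F_def mem_Collect_eq f i1 qF[OF S] ball_simps(9) using e c by (simp cong: ball_cong)
    qed (rule rinj)
    moreover have "r (i x) = i (q x)" if x: "x \<in> A" for x
    proof -
      have xB: "x \<in> B0" using x A(1) W by blast
      have "snd (r (i x)) J = snd (i (q x)) J" for J
      proof (cases "bad J \<and> q x \<in> J")
        case True
        then have J: "bad J" "q x \<in> J" by auto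
        have m: "x \<in> pre J" using J xB by (simp add: pre_def)
        then show ?thesis
          using J badpre[OF J(1)] \<rho>(2)[OF badpre[OF J(1)] x m] qpre(1)[OF badB(1)[OF J(1)]]
          by (simp add: sndr fsti sndi)
      next
        case False
        then show ?thesis by (auto simp: sndr fsti sndi)
      qed
      then show ?thesis by (simp add: prod_eq_iff fun_eq_iff fstr fsti)
    qed
    ultimately show ?thesis using rbij by (auto simp: edge_automorphism_def)
  qed
  show ?thesis by (rule that[of B F i]) (use fB adm iB emb ext in auto)
qed

section \<open>Homogeneous hypergraphs\<close>

lemma edge_embeddingI:
  "inj_on f A \<Longrightarrow> (\<And>e. e \<subseteq> A \<Longrightarrow> f ` e \<in> F' \<longleftrightarrow> e \<in> F) \<Longrightarrow> edge_embedding A F f F'"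
  by (simp add: edge_embedding_def)

lemma edge_embedding_inj: "edge_embedding A F f F' \<Longrightarrow> inj_on f A"
  by (simp add: edge_embedding_def)

lemma edge_embedding_edge: "edge_embedding A F f F' \<Longrightarrow> e \<subseteq> A \<Longrightarrow> f ` e \<in> F' \<longleftrightarrow> e \<in> F"
  by (simp add: edge_embedding_def)

lemma edge_embedding_subset: "edge_embedding A F f F' \<Longrightarrow> A' \<subseteq> A \<Longrightarrow> edge_embedding A' F f F'"
  by (auto simp: edge_embedding_def dest: inj_on_subset)

lemma edge_embedding_cong:
  assumes "edge_embedding A F f F'" "\<And>x. x \<in> A \<Longrightarrow> g x = f x"
  shows "edge_embedding A F g F'"
proof (rule edge_embeddingI)
  show "inj_on g A" using edge_embedding_inj[OF assms(1)] assms(2) inj_on_cong by metis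
  fix e assume e: "e \<subseteq> A"
  have "g ` e = f ` e" using e assms(2) by (intro image_cong) auto
  then show "g ` e \<in> F' \<longleftrightarrow> e \<in> F" using edge_embedding_edge[OF assms(1) e] by simp
qed

lemma edge_embedding_comp:
  assumes "edge_embedding A F f F'" "f ` A \<subseteq> A'" "edge_embedding A' F' g F''"
  shows "edge_embedding A F (g \<circ> f) F''"
proof (rule edge_embeddingI)
  show "inj_on (g \<circ> f) A"
    using comp_inj_on[OF edge_embedding_inj[OF assms(1)] inj_on_subset[OF edge_embedding_inj[OF assms(3)] assms(2)]] .
  fix e assume e: "e \<subseteq> A"
  have "f ` e \<subseteq> A'" using e assms(2) by blast
  then show "(g \<circ> f) ` e \<in> F'' \<longleftrightarrow> e \<in> F"
    using edge_embedding_edge[OF assms(1) e] edge_embedding_edge[OF assms(3)] by (metis image_comp)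
qed

lemma edge_embedding_inv_into:
  assumes "edge_embedding A F f F'"
  shows "edge_embedding (f ` A) F' (inv_into A f) F"
proof (rule edge_embeddingI)
  show "inj_on (inv_into A f) (f ` A)" by (rule inj_on_inv_into) simp
  fix e assume "e \<subseteq> f ` A"
  then obtain e' where e': "e' \<subseteq> A" "e = f ` e'" by (rule subset_imageE)
  then have "inv_into A f ` e = e'" using edge_embedding_inj[OF assms] by (simp add: inv_into_image_cancel)
  then show "inv_into A f ` e \<in> F \<longleftrightarrow> e \<in> F'" using edge_embedding_edge[OF assms e'(1)] e'(2) by simp
qed

lemma edge_embedding_image: "inj_on f A \<Longrightarrow> (\<And>e. e \<in> F \<Longrightarrow> e \<subseteq> A) \<Longrightarrow> edge_embedding A F f ((`) f ` F)"
  by (rule edge_embeddingI) (auto simp: inj_on_image_eq_iff image_iff)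

lemma edge_embedding_Int_Pow:
  "edge_embedding A (F \<inter> Pow A') f F' \<longleftrightarrow> edge_embedding A F f F'" if "A \<subseteq> A'"
  using that by (auto simp: edge_embedding_def)

lemma edge_embedding_Int_Pow_right:
  "edge_embedding A F f (F' \<inter> Pow A') \<longleftrightarrow> edge_embedding A F f F'" if "f ` A \<subseteq> A'"
  using that unfolding edge_embedding_def by blast

lemma admissible_pullback:
  assumes f: "edge_embedding V F f F'" and adm: "admissible \<eta> \<zeta> V' F'" "f ` V \<subseteq> V'"
    and F: "\<And>e. e \<in> F \<Longrightarrow> e \<subseteq> V"
  shows "admissible \<eta> \<zeta> V F"
  unfolding admissible_def
proof (intro conjI ballI allI impI)
  fix e assume e: "e \<in> F"
  then show eV: "e \<subseteq> V" using F by simp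
  have inj: "inj_on f e" using inj_on_subset[OF edge_embedding_inj[OF f] eV] .
  have "f ` e \<in> F'" using edge_embedding_edge[OF f eV] e by simp
  then have "finite (f ` e)" "\<eta> (card (f ` e))" using adm(1) by (auto simp: admissible_def)
  then show "finite e" "\<eta> (card e)" using inj by (auto simp: finite_image_iff card_image)
next
  fix n S assume n: "n < \<zeta> n" and S: "S \<subseteq> V" "card S = \<zeta> n"
  have inj: "inj_on f S" using inj_on_subset[OF edge_embedding_inj[OF f] S(1)] .
  have "f ` S \<subseteq> V'" "card (f ` S) = \<zeta> n" using S adm(2) card_image[OF inj] by auto
  then obtain e where e: "e \<subseteq> f ` S" "card e = n" "e \<notin> F'" using adm(1) n unfolding admissible_def by blast
  obtain e' where e': "e' \<subseteq> S" "e = f ` e'" using e(1) by (rule subset_imageE)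
  then have "card e' = n" using card_image[OF inj_on_subset[OF inj e'(1)]] e(2) by simp
  moreover have "e' \<notin> F" using edge_embedding_edge[OF f, of e'] e' e(3) S(1) by auto
  ultimately show "\<exists>e\<subseteq>S. card e = n \<and> e \<notin> F" using e'(1) by blast
qed

text \<open>HOL-Algebra takes over the notation \<open>inv\<close>.\<close>

abbreviation (input) ginv :: "('a \<Rightarrow> 'a) \<Rightarrow> 'a \<Rightarrow> 'a" where
  "ginv g \<equiv> inv_into UNIV g"

section \<open>Automorphisms and stabilizers of a hypergraph\<close>

definition hyp_Aut :: "'a set set \<Rightarrow> ('a \<Rightarrow> 'a) set" where
  "hyp_Aut E = {g. edge_automorphism UNIV E g}"

definition hyp_stab :: "'a set set \<Rightarrow> 'a set \<Rightarrow> ('a \<Rightarrow> 'a) set" where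
  "hyp_stab E A = {g \<in> hyp_Aut E. \<forall>a\<in>A. g a = a}"

definition hyp_setstab :: "'a set set \<Rightarrow> 'a set \<Rightarrow> ('a \<Rightarrow> 'a) set" where
  "hyp_setstab E A = {g \<in> hyp_Aut E. g ` A = A}"

text \<open>The hypergraph induced on \<open>P \<union> Q\<close> is the free amalgam of
  \<open>P\<close> and \<open>Q\<close> over \<open>P \<inter> Q\<close>.\<close>

definition free_over :: "'a set set \<Rightarrow> 'a set \<Rightarrow> 'a set \<Rightarrow> bool" where
  "free_over E P Q \<longleftrightarrow> (\<forall>e\<in>E. e \<subseteq> P \<union> Q \<longrightarrow> e \<subseteq> P \<or> e \<subseteq> Q)"

lemma hyp_AutI: "bij g \<Longrightarrow> (\<And>e. g ` e \<in> E \<longleftrightarrow> e \<in> E) \<Longrightarrow> g \<in> hyp_Aut E"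
  by (simp add: hyp_Aut_def edge_automorphism_def edge_embedding_def bij_is_inj)

lemma hyp_Aut_bij: "g \<in> hyp_Aut E \<Longrightarrow> bij g"
  by (simp add: hyp_Aut_def edge_automorphism_def)

lemma hyp_Aut_edge: "g \<in> hyp_Aut E \<Longrightarrow> g ` e \<in> E \<longleftrightarrow> e \<in> E"
  by (simp add: hyp_Aut_def edge_automorphism_def edge_embedding_def)

lemma hyp_Aut_eq_iff: "g \<in> hyp_Aut E \<Longrightarrow> g x = g y \<longleftrightarrow> x = y"
  using hyp_Aut_bij bij_is_inj inj_eq by metis

lemma hyp_Aut_inj_on: "g \<in> hyp_Aut E \<Longrightarrow> inj_on g A"
  using hyp_Aut_bij bij_is_inj inj_on_subset by blast

lemma hyp_Aut_embedding: "g \<in> hyp_Aut E \<Longrightarrow> edge_embedding A E g E"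
  by (simp add: edge_embeddingI hyp_Aut_edge hyp_Aut_inj_on)

lemma hyp_Aut_id: "id \<in> hyp_Aut E" by (rule hyp_AutI) auto

lemma hyp_Aut_comp: "g \<in> hyp_Aut E \<Longrightarrow> h \<in> hyp_Aut E \<Longrightarrow> g \<circ> h \<in> hyp_Aut E"
  by (rule hyp_AutI) (simp_all only: hyp_Aut_bij bij_comp hyp_Aut_edge image_comp[symmetric])

lemma ginv_left: "g \<in> hyp_Aut E \<Longrightarrow> ginv g (g x) = x"
  by (simp add: bij_is_inj hyp_Aut_bij inv_f_f)

lemma ginv_right: "g \<in> hyp_Aut E \<Longrightarrow> g (ginv g x) = x"
  by (simp add: bij_is_surj hyp_Aut_bij surj_f_inv_f)

lemma ginv_comp: "g \<in> hyp_Aut E \<Longrightarrow> ginv g \<circ> g = id" "g \<in> hyp_Aut E \<Longrightarrow> g \<circ> ginv g = id"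
  by (auto simp: ginv_left ginv_right)

lemma hyp_Aut_ginv: assumes "g \<in> hyp_Aut E" shows "ginv g \<in> hyp_Aut E"
proof (rule hyp_AutI)
  show "bij (ginv g)" using hyp_Aut_bij[OF assms] by (rule bij_imp_bij_inv)
  fix e
  have "g ` ginv g ` e = e" by (simp add: image_comp ginv_comp[OF assms])
  then show "ginv g ` e \<in> E \<longleftrightarrow> e \<in> E" using hyp_Aut_edge[OF assms] by metis
qed

lemma ginv_eqI: "g \<in> hyp_Aut E \<Longrightarrow> g \<circ> h = id \<Longrightarrow> ginv g = h"
  using hyp_Aut_bij[of g E] by (metis bij_is_inj fun.map_comp id_comp inv_o_cancel o_id)

lemma hyp_stab_subset: "hyp_stab E A \<subseteq> hyp_Aut E" by (auto simp: hyp_stab_def)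

lemma hyp_stab_antimono: "A \<subseteq> B \<Longrightarrow> hyp_stab E B \<subseteq> hyp_stab E A" by (auto simp: hyp_stab_def)

lemma hyp_stab_id: "id \<in> hyp_stab E A" by (simp add: hyp_stab_def hyp_Aut_id)

lemma hyp_stab_comp: "g \<in> hyp_stab E A \<Longrightarrow> h \<in> hyp_stab E A \<Longrightarrow> g \<circ> h \<in> hyp_stab E A"
  by (simp add: hyp_stab_def hyp_Aut_comp)

lemma hyp_stab_ginv: assumes "g \<in> hyp_stab E A" shows "ginv g \<in> hyp_stab E A"
proof -
  have g: "g \<in> hyp_Aut E" "\<And>a. a \<in> A \<Longrightarrow> g a = a" using assms by (auto simp: hyp_stab_def)
  have "ginv g a = a" if "a \<in> A" for a using ginv_left[OF g(1), of a] g(2)[OF that] by simp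
  then show ?thesis by (simp add: hyp_stab_def hyp_Aut_ginv[OF g(1)])
qed

text \<open>The limit M(\<eta>,\<zeta>) with universe \<open>nat\<close>. Universality is postulated
  for vertices in \<open>nat\<close>, since a locale assumption is monomorphic;
  \<open>universal\<close> transfers it to vertices of any type.\<close>

locale homogeneous_hypergraph =
  fixes \<eta> :: "nat \<Rightarrow> bool" and \<zeta> :: "nat \<Rightarrow> nat" and E :: "nat set set"
  assumes admissible: "admissible \<eta> \<zeta> UNIV E"
    and \<eta>_ge2: "\<eta> n \<Longrightarrow> 2 \<le> n"
    and \<zeta>_ge2: "n < \<zeta> n \<Longrightarrow> 2 \<le> n"
    and universal_nat: "finite B \<Longrightarrow> admissible \<eta> \<zeta> B F \<Longrightarrow> \<exists>f :: nat \<Rightarrow> nat. edge_embedding B F f E"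
    and homogeneous: "finite A \<Longrightarrow> edge_embedding A E f E \<Longrightarrow> \<exists>g\<in>hyp_Aut E. \<forall>a\<in>A. g a = f a"
begin

lemma edge_finite: "e \<in> E \<Longrightarrow> finite e" and edge_card: "e \<in> E \<Longrightarrow> \<eta> (card e)"
  using admissible by (auto simp: admissible_def)

lemma missing_edge:
  assumes "n < \<zeta> n" "card S = \<zeta> n"
  obtains e :: "nat set" where "e \<subseteq> S" "card e = n" "e \<notin> E"
  using admissible assms unfolding admissible_def by (meson subset_UNIV)

lemma admissible_induced: "admissible \<eta> \<zeta> A (E \<inter> Pow A)"
  unfolding admissible_def
proof (intro conjI ballI allI impI)
  fix n and S :: "nat set" assume "n < \<zeta> n" "card S = \<zeta> n"
  then obtain e where "e \<subseteq> S" "card e = n" "e \<notin> E" by (rule missing_edge)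
  then show "\<exists>e\<subseteq>S. card e = n \<and> e \<notin> E \<inter> Pow A" by blast
qed (use edge_finite edge_card in auto)

lemma universal:
  assumes "finite B" "admissible \<eta> \<zeta> B F"
  obtains f where "edge_embedding B F f E"
proof -
  obtain c :: "_ \<Rightarrow> nat" where c: "inj_on c B" using finite_imp_inj_to_nat_seg[OF assms(1)] by blast
  have F: "e \<subseteq> B" if "e \<in> F" for e using that assms(2) by (simp add: admissible_def)
  note emb = edge_embedding_image[OF c F]
  have "admissible \<eta> \<zeta> (c ` B) ((`) c ` F)"
    by (rule admissible_pullback[OF edge_embedding_inv_into[OF emb] assms(2)])
       (use F c in \<open>auto simp: inv_into_into\<close>)
  then obtain f where "edge_embedding (c ` B) ((`) c ` F) f E"
    using universal_nat assms(1) by blast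
  from edge_embedding_comp[OF emb order_refl this] show ?thesis using that by blast
qed

text \<open>Universality places \<open>B\<close> somewhere; homogeneity then supplies an
  automorphism that carries the copy of \<open>W\<close> back to \<open>W\<close>.\<close>

lemma universal_over:
  assumes "finite B" "admissible \<eta> \<zeta> B F" "k ` W \<subseteq> B" "edge_embedding W E k F"
  obtains f where "edge_embedding B F f E" "\<And>x. x \<in> W \<Longrightarrow> f (k x) = x"
proof -
  obtain f where f: "edge_embedding B F f E" using universal[OF assms(1,2)] by blast
  have fk: "edge_embedding W E (f \<circ> k) E" using edge_embedding_comp[OF assms(4,3) f] .
  have "finite W"
    using edge_embedding_inj[OF assms(4)] assms(1,3) finite_subset finite_imageD by metis
  then obtain g where g: "g \<in> hyp_Aut E" "\<forall>x\<in>W. g x = (f \<circ> k) x" using homogeneous fk by blast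
  have "edge_embedding B F (ginv g \<circ> f) E"
    using edge_embedding_comp[OF f order_refl hyp_Aut_embedding[OF hyp_Aut_ginv[OF g(1)]]] .
  moreover have "(ginv g \<circ> f) (k x) = x" if "x \<in> W" for x
    using g(2) that ginv_left[OF g(1), of x] by simp
  ultimately show ?thesis using that by blast
qed

text \<open>The two layers of valuations produce a finite hypergraph outside \<open>E\<close>. It
  embeds into \<open>E\<close> over \<open>W\<close>, and homogeneity extends each of its
  automorphisms to an automorphism of \<open>E\<close> that leaves the image \<open>Y\<close>
  invariant.\<close>

lemma EPPA:
  assumes W: "finite W"
  obtains Y where "finite Y" "W \<subseteq> Y"
    "\<And>g A. g \<in> hyp_Aut E \<Longrightarrow> A \<subseteq> W \<Longrightarrow> g ` A \<subseteq> W \<Longrightarrow> \<exists>h\<in>hyp_Aut E. h ` Y = Y \<and> (\<forall>a\<in>A. h a = g a)"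
proof -
  have F: "e \<subseteq> W \<and> e \<noteq> {} \<and> \<eta> (card e)" if "e \<in> E \<inter> Pow W" for e
    using that edge_card[of e] \<eta>_ge2[of "card e"] by auto
  obtain B0 :: "(nat \<times> nat set set) set" and F0 i where
    B0: "finite B0" "\<And>e. e \<in> F0 \<Longrightarrow> e \<subseteq> B0 \<and> \<eta> (card e)" "i ` W \<subseteq> B0" "edge_embedding W (E \<inter> Pow W) i F0"
    and ext0: "\<And>A p. A \<subseteq> W \<Longrightarrow> p ` A \<subseteq> W \<Longrightarrow> edge_embedding A (E \<inter> Pow W) p (E \<inter> Pow W) \<Longrightarrow>
        \<exists>q. edge_automorphism B0 F0 q \<and> (\<forall>x\<in>A. q (i x) = i (p x))"
    using hypergraph_EPPA[OF W F] by metis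
  have "edge_embedding W (E \<inter> Pow W) i (F0 \<inter> Pow (i ` W))"
    using B0(4) edge_embedding_Int_Pow_right[of i W "i ` W"] by simp
  from edge_embedding_inv_into[OF this]
  have admW: "admissible \<eta> \<zeta> (i ` W) (F0 \<inter> Pow (i ` W))"
    by (rule admissible_pullback[OF _ admissible_induced[of W]]) (auto simp: inv_into_into)
  obtain B :: "((nat \<times> nat set set) \<times> ((nat \<times> nat set set) set \<Rightarrow> nat)) set" and F j where
    B: "finite B" "admissible \<eta> \<zeta> B F" "j ` i ` W \<subseteq> B" "edge_embedding (i ` W) F0 j F"
    and ext: "\<And>A q. A \<subseteq> i ` W \<Longrightarrow> q ` A \<subseteq> i ` W \<Longrightarrow> edge_automorphism B0 F0 q \<Longrightarrow>
        \<exists>r. edge_automorphism B F r \<and> (\<forall>x\<in>A. r (j x) = j (q x))"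
    using clique_free_EPPA[OF B0(1,2) \<zeta>_ge2 B0(3) admW] by metis
  have "edge_embedding W E (j \<circ> i) F"
    using edge_embedding_comp[OF _ order_refl B(4), of "E"] B0(4) edge_embedding_Int_Pow[OF order_refl] by metis
  then obtain f where f: "edge_embedding B F f E" "\<And>x. x \<in> W \<Longrightarrow> f (j (i x)) = x"
    using universal_over[OF B(1,2), of "j \<circ> i" W] B(3) by (auto simp: image_comp)
  have ext: "\<exists>h\<in>hyp_Aut E. h ` (f ` B) = f ` B \<and> (\<forall>a\<in>A. h a = g a)"
    if g: "g \<in> hyp_Aut E" and A: "A \<subseteq> W" "g ` A \<subseteq> W" for g A
  proof -
    have "edge_embedding A (E \<inter> Pow W) g (E \<inter> Pow W)"
      using hyp_Aut_embedding[OF g] A by (simp add: edge_embedding_Int_Pow edge_embedding_Int_Pow_right)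
    then obtain q where q: "edge_automorphism B0 F0 q" "\<And>x. x \<in> A \<Longrightarrow> q (i x) = i (g x)"
      using ext0[OF A] by metis
    have "q ` i ` A \<subseteq> i ` W" using q(2) A(2) by auto
    then obtain r where r: "edge_automorphism B F r" "\<And>x. x \<in> i ` A \<Longrightarrow> r (j x) = j (q x)"
      using ext[OF image_mono[OF A(1)] _ q(1)] by metis
    have rB: "r ` B = B" "edge_embedding B F r F"
      using r(1) by (auto simp: edge_automorphism_def bij_betw_def)
    note finv = edge_embedding_inv_into[OF f(1)]
    have fB: "inv_into B f ` f ` B = B" using inv_into_image_cancel[OF edge_embedding_inj[OF f(1)] order_refl] .
    have "edge_embedding (f ` B) E (r \<circ> inv_into B f) F"
      using edge_embedding_comp[OF finv _ rB(2)] fB by simp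
    moreover have "(r \<circ> inv_into B f) ` f ` B \<subseteq> B"
      unfolding image_comp[symmetric] fB using rB(1) by simp
    ultimately have "edge_embedding (f ` B) E (f \<circ> (r \<circ> inv_into B f)) E"
      using edge_embedding_comp[OF _ _ f(1)] by blast
    then obtain h where h: "h \<in> hyp_Aut E" "\<And>y. y \<in> f ` B \<Longrightarrow> h y = f (r (inv_into B f y))"
      using homogeneous[of "f ` B"] B(1) by fastforce
    have hf: "h (f b) = f (r b)" if "b \<in> B" for b
      using h(2)[of "f b"] that inv_into_f_f[OF edge_embedding_inj[OF f(1)] that] by simp
    have "h ` f ` B = f ` r ` B" unfolding image_image using hf by (intro image_cong) auto
    then have "h ` f ` B = f ` B" using rB by simp
    moreover have "h a = g a" if a: "a \<in> A" for a
    proof -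
      have "a \<in> W" "g a \<in> W" using a A by auto
      then show ?thesis using hf[of "j (i a)"] B(3) f(2) r(2) q(2) a by auto
    qed
    ultimately show ?thesis using h(1) by blast
  qed
  have "x \<in> f ` B" if "x \<in> W" for x using f(2)[OF that] B(3) that by (metis imageI image_subset_iff)
  then have "W \<subseteq> f ` B" by blast
  then show ?thesis by (rule that[OF finite_imageI[OF B(1)] _ ext])
qed

text \<open>The union of \<open>Z\<close> and a copy of \<open>Y\<close> that meets it in
  \<open>W\<close> only, without mixed edges, is admissible. It embeds over \<open>Z\<close>, and
  homogeneity turns the map from \<open>Y\<close> to its new place into the automorphism
  \<open>t\<close>.\<close>

lemma free_amalgam:
  assumes fin: "finite Y" "finite Z" and W: "W \<subseteq> Y" "W \<subseteq> Z"
  obtains t where "t \<in> hyp_stab E W" "t ` Y \<inter> Z = W" "free_over E (t ` Y) Z"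
proof -
  obtain N where N: "\<And>z. z \<in> Z \<Longrightarrow> z < N" using fin(2)[unfolded finite_nat_set_iff_bounded] by blast
  \<comment> \<open>The copy keeps \<open>W\<close> and shifts all other points beyond
    \<open>Z\<close>.\<close>
  define c where "c y = (if y \<in> W then y else y + N)" for y
  have cZ: "y \<in> W" if "c y \<in> Z" for y using N[OF that] by (auto simp: c_def split: if_splits)
  have cW: "c y = y" if "y \<in> W" for y using that by (simp add: c_def)
  have cinj: "inj c"
  proof (rule injI)
    fix x y assume eq: "c x = c y"
    have "x \<in> W \<longleftrightarrow> y \<in> W" using cZ[of x] cZ[of y] W(2) cW[of x] cW[of y] eq by fastforce
    then show "x = y" using eq by (simp add: c_def split: if_splits)
  qed
  have cYZ: "e' \<subseteq> W" if "c ` e' \<subseteq> Z" for e' using that cZ by blast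
  have cWi: "c ` e' = e'" if "e' \<subseteq> W" for e' using that cW by force
  define F where "F = (E \<inter> Pow Z) \<union> (`) c ` (E \<inter> Pow Y)"
  have FZ: "e \<in> F \<longleftrightarrow> e \<in> E" if e: "e \<subseteq> Z" for e
  proof -
    have "e \<in> E" if "e \<in> (`) c ` (E \<inter> Pow Y)"
    proof -
      from that obtain x where x: "e = c ` x" "x \<in> E" by blast
      then show ?thesis using cWi[OF cYZ[of x]] e by simp
    qed
    then show ?thesis using e unfolding F_def by blast
  qed
  have FY: "c ` e \<in> F \<longleftrightarrow> e \<in> E" if e: "e \<subseteq> Y" for e
  proof (cases "e \<subseteq> W")
    case True
    then have "e \<subseteq> Z" "c ` e = e" using cWi W(2) by blast+
    then show ?thesis using FZ[of e] by simp
  next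
    case False
    then have "\<not> c ` e \<subseteq> Z" using cYZ by blast
    moreover have "c ` e \<in> (`) c ` (E \<inter> Pow Y) \<longleftrightarrow> e \<in> E"
    proof
      assume "c ` e \<in> (`) c ` (E \<inter> Pow Y)"
      then obtain x where "c ` e = c ` x" "x \<in> E" by blast
      then show "e \<in> E" using inj_image_eq_iff[OF cinj, of e x] by simp
    qed (use e in blast)
    ultimately show ?thesis unfolding F_def by blast
  qed
  have Fsub: "e \<subseteq> Z \<or> e \<subseteq> c ` Y" if "e \<in> F" for e using that unfolding F_def by blast
  have embZ: "edge_embedding Z E id F" by (rule edge_embeddingI) (auto simp: FZ)
  have embY: "edge_embedding Y E c F" using edge_embeddingI[OF inj_on_subset[OF cinj subset_UNIV] FY] .
  have adm: "admissible \<eta> \<zeta> (Z \<union> c ` Y) F"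
    unfolding admissible_def
  proof (intro conjI ballI allI impI)
    fix e assume e: "e \<in> F"
    then show "e \<subseteq> Z \<union> c ` Y" using Fsub by blast
    then show "finite e" by (rule finite_subset) (use fin in simp)
    consider "e \<in> E" | e' where "e' \<in> E" "e = c ` e'" using e unfolding F_def by blast
    then show "\<eta> (card e)"
      using card_image[OF inj_on_subset[OF cinj subset_UNIV]] edge_card by cases simp_all
  next
    fix n and S :: "nat set" assume n: "n < \<zeta> n" and S: "S \<subseteq> Z \<union> c ` Y" "card S = \<zeta> n"
    have fS: "finite S" using finite_subset[OF S(1)] fin by simp
    consider "S \<subseteq> Z" | "S \<subseteq> c ` Y" | p q where "p \<in> S" "p \<notin> Z" "q \<in> S" "q \<notin> c ` Y" by blast
    then show "\<exists>e\<subseteq>S. card e = n \<and> e \<notin> F"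
    proof cases
      case 1
      obtain e where "e \<subseteq> S" "card e = n" "e \<notin> E" using missing_edge[OF n S(2)] .
      then show ?thesis using FZ[of e] 1 by blast
    next
      case 2
      then obtain S' where S': "S' \<subseteq> Y" "S = c ` S'" by (rule subset_imageE)
      then have "card S' = \<zeta> n" using S(2) card_image[OF inj_on_subset[OF cinj subset_UNIV]] by simp
      from missing_edge[OF n this] obtain e where e: "e \<subseteq> S'" "card e = n" "e \<notin> E" .
      then have "c ` e \<subseteq> S" "card (c ` e) = n" "c ` e \<notin> F"
        using S' FY[of e] card_image[OF inj_on_subset[OF cinj subset_UNIV]] by auto
      then show ?thesis by blast
    next
      \<comment> \<open>A clique with points \<open>p\<close> and \<open>q\<close> on different
        sides would have an edge through both, and no edge of \<open>F\<close> is mixed.\<close>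
      case 3
      then have "p \<noteq> q" using S(1) by blast
      then obtain e where e: "e \<subseteq> S" "card e = n" "p \<in> e" "q \<in> e"
        using subset_card_containing_pair[OF fS 3(1,3) _ \<zeta>_ge2[OF n]] n S(2) by (metis less_imp_le)
      then have "e \<notin> F" using Fsub[of e] 3 by blast
      then show ?thesis using e by blast
    qed
  qed
  have finB: "finite (Z \<union> c ` Y)" using fin by simp
  have idZ: "id ` Z \<subseteq> Z \<union> c ` Y" by simp
  obtain f where f: "edge_embedding (Z \<union> c ` Y) F f E" "\<And>x. x \<in> Z \<Longrightarrow> f x = x"
    using universal_over[OF finB adm idZ embZ] by (metis id_apply)
  have "edge_embedding Y E (f \<circ> c) E" using edge_embedding_comp[OF embY _ f(1)] by simp
  then obtain t where t: "t \<in> hyp_Aut E" "\<And>y. y \<in> Y \<Longrightarrow> t y = f (c y)"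
    using homogeneous[OF fin(1)] by fastforce
  have tW: "t x = x" if "x \<in> W" for x using t(2)[OF subsetD[OF W(1) that]] cW[OF that] f(2)[OF subsetD[OF W(2) that]] by simp
  have tY: "t ` Y = f ` c ` Y" unfolding image_image using t(2) by (intro image_cong) auto
  have "t ` Y \<inter> Z \<subseteq> W"
  proof
    fix z assume z: "z \<in> t ` Y \<inter> Z"
    then obtain y where y: "y \<in> Y" "z = f (c y)" using tY by auto
    then have "f (c y) = f z" using f(2)[of z] z by simp
    then have cy: "c y = z" using inj_onD[OF edge_embedding_inj[OF f(1)], of "c y" z] y(1) z by simp
    then have "y \<in> W" using cZ[of y] z by simp
    then show "z \<in> W" using cW[of y] cy by simp
  qed
  moreover have "W \<subseteq> t ` Y \<inter> Z" using tW W by force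
  moreover have "free_over E (t ` Y) Z"
    unfolding free_over_def
  proof (intro ballI impI)
    fix e assume e: "e \<in> E" "e \<subseteq> t ` Y \<union> Z"
    have fZ: "f ` Z = Z" using f(2) by force
    have "e \<subseteq> f ` (Z \<union> c ` Y)" using e(2) unfolding image_Un tY fZ by blast
    then obtain e0 where e0: "e0 \<subseteq> Z \<union> c ` Y" "e = f ` e0" by (rule subset_imageE)
    then have "e0 \<in> F" using edge_embedding_edge[OF f(1) e0(1)] e(1) by simp
    from Fsub[OF this] show "e \<subseteq> t ` Y \<or> e \<subseteq> Z"
      unfolding e0(2) tY using image_mono[of e0 Z f] image_mono[of e0 "c ` Y" f] fZ by metis
  qed
  moreover have "t \<in> hyp_stab E W" using t(1) tW by (simp add: hyp_stab_def)
  ultimately show ?thesis using that by blast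
qed

text \<open>The union of \<open>p\<close> on \<open>P\<close> and \<open>q\<close> on
  \<open>Q\<close> preserves edges because neither source nor target has a mixed edge; the condition
  on the images makes it injective. Homogeneity extends it.\<close>

lemma glue:
  assumes fin: "finite P" "finite Q" and pq: "p \<in> hyp_Aut E" "q \<in> hyp_Aut E"
    and agree: "\<And>x. x \<in> P \<Longrightarrow> x \<in> Q \<Longrightarrow> p x = q x" and int: "p ` P \<inter> q ` Q \<subseteq> p ` (P \<inter> Q)"
    and free: "free_over E P Q" "free_over E (p ` P) (q ` Q)"
  obtains r where "r \<in> hyp_Aut E" "\<And>x. x \<in> P \<Longrightarrow> r x = p x" "\<And>x. x \<in> Q \<Longrightarrow> r x = q x"
proof -
  define f where "f x = (if x \<in> P then p x else q x)" for x
  have fP: "f x = p x" if "x \<in> P" for x using that by (simp add: f_def)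
  have fQ: "f x = q x" if "x \<in> Q" for x using that agree by (simp add: f_def)
  have cross: "x \<in> P \<and> y \<in> Q \<and> x = y" if "x \<in> P" "y \<in> Q" "p x = q y" for x y
  proof -
    note xy = that
    have "p x \<in> p ` P" using xy(1) by (rule imageI)
    moreover have "p x \<in> q ` Q" unfolding xy(3) using xy(2) by (rule imageI)
    ultimately have "p x \<in> p ` (P \<inter> Q)" using int by blast
    then obtain z where z: "z \<in> P" "z \<in> Q" "p x = p z" by blast
    then have "x = z" "q z = q y" using hyp_Aut_eq_iff[OF pq(1), of x z] agree[of z] xy(3) by auto
    then show ?thesis using hyp_Aut_eq_iff[OF pq(2), of z y] z xy by auto
  qed
  have inj: "inj_on f (P \<union> Q)"
  proof (rule inj_onI)
    fix x y assume xy: "x \<in> P \<union> Q" "y \<in> P \<union> Q" and eq: "f x = f y"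
    consider "x \<in> P" "y \<in> P" | "x \<in> P" "y \<in> Q" | "x \<in> Q" "y \<in> P" | "x \<in> Q" "y \<in> Q" using xy by blast
    then show "x = y"
    proof cases
      case 1 then show ?thesis using eq fP hyp_Aut_eq_iff[OF pq(1)] by metis
    next
      case 2 then show ?thesis using eq fP fQ cross by metis
    next
      case 3 then show ?thesis using eq fP fQ cross by metis
    next
      case 4 then show ?thesis using eq fQ hyp_Aut_eq_iff[OF pq(2)] by metis
    qed
  qed
  have imP: "f ` e = p ` e" if "e \<subseteq> P" for e using that fP by (intro image_cong) auto
  have imQ: "f ` e = q ` e" if "e \<subseteq> Q" for e using that fQ by (intro image_cong) auto
  have "edge_embedding (P \<union> Q) E f E"
  proof (rule edge_embeddingI[OF inj])
    fix e assume e: "e \<subseteq> P \<union> Q"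
    have P: "f ` e \<in> E \<longleftrightarrow> e \<in> E" if "e \<subseteq> P" using imP[OF that] hyp_Aut_edge[OF pq(1)] by simp
    have Q: "f ` e \<in> E \<longleftrightarrow> e \<in> E" if "e \<subseteq> Q" using imQ[OF that] hyp_Aut_edge[OF pq(2)] by simp
    have "e \<subseteq> P \<or> e \<subseteq> Q" if fe: "f ` e \<in> E"
    proof -
      have "f ` e \<subseteq> p ` P \<union> q ` Q" using e by (auto simp: f_def)
      then consider "f ` e \<subseteq> p ` P" | "f ` e \<subseteq> q ` Q" using free(2) fe unfolding free_over_def by blast
      then show ?thesis
      proof cases
        case 1
        have "x \<in> P" if x: "x \<in> e" for x
        proof (rule ccontr)
          assume "x \<notin> P"
          then have xQ: "x \<in> Q" using x e by blast
          obtain z where "z \<in> P" "p z = q x" using 1 x fQ[OF xQ] by (metis image_eqI image_subset_iff imageE)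
          then show False using cross xQ \<open>x \<notin> P\<close> by blast
        qed
        then show ?thesis by blast
      next
        case 2
        have "x \<in> Q" if x: "x \<in> e" for x
        proof (rule ccontr)
          assume "x \<notin> Q"
          then have xP: "x \<in> P" using x e by blast
          obtain z where "z \<in> Q" "p x = q z" using 2 x fP[OF xP] by (metis image_eqI image_subset_iff imageE)
          then show False using cross xP \<open>x \<notin> Q\<close> by blast
        qed
        then show ?thesis by blast
      qed
    qed
    moreover have "e \<subseteq> P \<or> e \<subseteq> Q" if "e \<in> E" using that e free(1) unfolding free_over_def by blast
    ultimately show "f ` e \<in> E \<longleftrightarrow> e \<in> E" using P Q by blast
  qed
  then obtain r where "r \<in> hyp_Aut E" "\<And>x. x \<in> P \<union> Q \<Longrightarrow> r x = f x"
    using homogeneous[of "P \<union> Q" f] fin by auto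
  then show ?thesis using that fP fQ by (metis UnCI)
qed

end

section \<open>Perfect families of automorphisms\<close>

text \<open>For finite \<open>A\<close> these are the basic open sets of the topology of pointwise
  convergence.\<close>

definition nbhd :: "'a set set \<Rightarrow> ('a \<Rightarrow> 'a) \<Rightarrow> 'a set \<Rightarrow> ('a \<Rightarrow> 'a) set" where
  "nbhd E g A = {h \<in> hyp_Aut E. \<forall>x\<in>A. h x = g x}"

text \<open>The interior of \<open>D\<close> is dense in that topology, so countably many such sets
  have a comeager intersection.\<close>

definition dense_interior :: "'a set set \<Rightarrow> ('a \<Rightarrow> 'a) set \<Rightarrow> bool" where
  "dense_interior E D \<longleftrightarrow> (\<forall>g\<in>hyp_Aut E. \<forall>A. finite A \<longrightarrow>
     (\<exists>h\<in>hyp_Aut E. \<exists>C. finite C \<and> A \<subseteq> C \<and> (\<forall>x\<in>A. h x = g x) \<and> nbhd E h C \<subseteq> D))"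

lemma nbhdD: "h \<in> nbhd E g A \<Longrightarrow> h \<in> hyp_Aut E" "h \<in> nbhd E g A \<Longrightarrow> x \<in> A \<Longrightarrow> h x = g x"
  by (simp_all add: nbhd_def)

lemma nbhdI: "h \<in> hyp_Aut E \<Longrightarrow> (\<And>x. x \<in> A \<Longrightarrow> h x = g x) \<Longrightarrow> h \<in> nbhd E g A"
  by (simp add: nbhd_def)

lemma dense_interiorE:
  assumes "dense_interior E D" "g \<in> hyp_Aut E" "finite A"
  obtains h C where "h \<in> hyp_Aut E" "finite C" "A \<subseteq> C" "\<And>x. x \<in> A \<Longrightarrow> h x = g x" "nbhd E h C \<subseteq> D"
  using assms unfolding dense_interior_def by metis

lemma dense_interiorI:
  assumes "\<And>g (A :: 'a set). g \<in> hyp_Aut E \<Longrightarrow> finite A \<Longrightarrow>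
     \<exists>h C. h \<in> hyp_Aut E \<and> finite C \<and> (\<forall>x\<in>A. h x = g x) \<and> nbhd E h C \<subseteq> D"
  shows "dense_interior E D"
  unfolding dense_interior_def
proof (intro ballI allI impI)
  fix g and A :: "'a set" assume "g \<in> hyp_Aut E" "finite A"
  then obtain h C where h: "h \<in> hyp_Aut E" "finite C" "\<forall>x\<in>A. h x = g x" "nbhd E h C \<subseteq> D"
    using assms by metis
  have "nbhd E h (A \<union> C) \<subseteq> nbhd E h C" by (auto simp: nbhd_def)
  then show "\<exists>h\<in>hyp_Aut E. \<exists>C. finite C \<and> A \<subseteq> C \<and> (\<forall>x\<in>A. h x = g x) \<and> nbhd E h C \<subseteq> D"
    using h \<open>finite A\<close> by (intro bexI[of _ h] exI[of _ "A \<union> C"]) auto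
qed

lemma dense_interior_translate:
  assumes D: "dense_interior E D" and k: "k \<in> hyp_Aut E"
  shows "dense_interior E {x. x \<circ> k \<in> D}"
proof (rule dense_interiorI)
  fix g and A :: "'a set" assume g: "g \<in> hyp_Aut E" and A: "finite A"
  obtain h C where h: "h \<in> hyp_Aut E" "finite C" "ginv k ` A \<subseteq> C"
      "\<And>x. x \<in> ginv k ` A \<Longrightarrow> h x = (g \<circ> k) x" "nbhd E h C \<subseteq> D"
    using dense_interiorE[OF D hyp_Aut_comp[OF g k] finite_imageI[OF A]] by metis
  define h' where "h' = h \<circ> ginv k"
  have "x \<circ> k \<in> D" if x: "x \<in> nbhd E h' (k ` C)" for x
  proof -
    have "(x \<circ> k) c = h c" if c: "c \<in> C" for c
      using nbhdD(2)[OF x imageI[OF c]] ginv_left[OF k] by (simp add: h'_def)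
    then have "x \<circ> k \<in> nbhd E h C" using hyp_Aut_comp[OF nbhdD(1)[OF x] k] by (rule_tac nbhdI)
    then show ?thesis using h(5) by blast
  qed
  moreover have "h' x = g x" if "x \<in> A" for x
    using h(4)[OF imageI[OF that]] ginv_right[OF k] by (simp add: h'_def)
  moreover have "h' \<in> hyp_Aut E" unfolding h'_def using hyp_Aut_comp[OF h(1) hyp_Aut_ginv[OF k]] .
  ultimately show "\<exists>h C. h \<in> hyp_Aut E \<and> finite C \<and> (\<forall>x\<in>A. h x = g x) \<and> nbhd E h C \<subseteq> {x. x \<circ> k \<in> D}"
    using h(2) by (intro exI[of _ h'] exI[of _ "k ` C"]) auto
qed

definition perm_subgroup :: "'a set set \<Rightarrow> ('a \<Rightarrow> 'a) set \<Rightarrow> bool" where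
  "perm_subgroup E H \<longleftrightarrow> H \<subseteq> hyp_Aut E \<and> id \<in> H \<and> (\<forall>g\<in>H. \<forall>h\<in>H. g \<circ> h \<in> H) \<and> (\<forall>g\<in>H. ginv g \<in> H)"

text \<open>Index below the continuum: no family indexed by \<open>nat set\<close> has its members
  in pairwise distinct left cosets of \<open>H\<close>.\<close>

definition small_index :: "'a set set \<Rightarrow> ('a \<Rightarrow> 'a) set \<Rightarrow> bool" where
  "small_index E H \<longleftrightarrow> (\<forall>c :: nat set \<Rightarrow> _. (\<forall>s. c s \<in> hyp_Aut E) \<longrightarrow> (\<exists>s t. s \<noteq> t \<and> ginv (c s) \<circ> c t \<in> H))"

context
  fixes E :: "nat set set"
  assumes edge_fin: "\<And>e. e \<in> E \<Longrightarrow> finite e"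
begin

text \<open>The sets \<open>A n\<close> exhaust the points, and their images do so too, which makes
  the limit surjective. As edges are finite, each of them is tested at a finite stage.\<close>

lemma hyp_Aut_limit:
  assumes g: "\<And>n. g n \<in> hyp_Aut E"
    and A: "\<And>n. A n \<subseteq> A (Suc n)" "\<And>n. n \<in> A (Suc n)" "\<And>n. n \<in> g (Suc n) ` A (Suc n)"
    and step: "\<And>n x. x \<in> A n \<Longrightarrow> g (Suc n) x = g n x"
  obtains h where "h \<in> hyp_Aut E" "\<And>n x. x \<in> A n \<Longrightarrow> h x = g n x"
proof -
  have mono: "A n \<subseteq> A m" if "n \<le> m" for n m using lift_Suc_mono_le[of A, OF A(1) that] .
  have const: "g m x = g n x" if "n \<le> m" "x \<in> A n" for n m x
    using that(1)
  proof (induction m rule: dec_induct)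
    case (step m)
    then show ?case using assms(5)[of x m] mono[of n m] that(2) by auto
  qed simp
  define h where "h x = g (Suc x) x" for x
  have h: "h x = g n x" if x: "x \<in> A n" for n x
  proof (cases "Suc x \<le> n")
    case True then show ?thesis using const[OF True A(2)] by (simp add: h_def)
  next
    case False
    then have "n \<le> Suc x" by simp
    then show ?thesis unfolding h_def using x by (rule const)
  qed
  have fin: "\<exists>n. e \<subseteq> A n" if e: "finite e" for e
    using e
  proof induction
    case (insert x e)
    then obtain n where "e \<subseteq> A n" by blast
    then have "insert x e \<subseteq> A (max n (Suc x))"
      using mono[of n "max n (Suc x)"] mono[of "Suc x" "max n (Suc x)"] A(2)[of x] by auto
    then show ?case by blast
  qed simp
  have im: "h ` e = g n ` e" if "e \<subseteq> A n" for e n using that h by (intro image_cong) auto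
  have inj: "inj h"
  proof (rule injI)
    fix x y assume eq: "h x = h y"
    obtain n where "{x, y} \<subseteq> A n" using fin[of "{x, y}"] by auto
    then have "x \<in> A n" "y \<in> A n" by auto
    then have "g n x = g n y" using h[of x n] h[of y n] eq by metis
    then show "x = y" using hyp_Aut_eq_iff[OF g] by blast
  qed
  have "surj h"
    unfolding surj_def
  proof
    fix y
    obtain x where "x \<in> A (Suc y)" "y = g (Suc y) x" using A(3) by blast
    then show "\<exists>x. y = h x" using h by metis
  qed
  then have "bij h" using inj by (simp add: bij_def)
  moreover have "h ` e \<in> E \<longleftrightarrow> e \<in> E" for e
  proof (cases "finite e")
    case True
    then obtain n where "e \<subseteq> A n" using fin by blast
    then show ?thesis using im hyp_Aut_edge[OF g] by metis
  next
    case False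
    then have "infinite (h ` e)" using inj by (simp add: finite_image_iff inj_on_subset)
    then show ?thesis using False edge_fin by blast
  qed
  ultimately have "h \<in> hyp_Aut E" by (rule hyp_AutI)
  then show ?thesis using that h by blast
qed

text \<open>The finitely many requirements are met one after another. Neighbourhoods only shrink, so
  requirements already met stay met.\<close>

lemma Mycielski_step:
  assumes T: "finite T" and D: "\<And>j. dense_interior E (D j)"
    and g: "\<And>s. g s \<in> hyp_Aut E" and A: "finite A"
  shows "\<exists>g' A'. (\<forall>s. g' s \<in> nbhd E (g s) A) \<and> finite A' \<and> A \<subseteq> A' \<and>
     (\<forall>s t j. (s, t, j) \<in> T \<longrightarrow> s \<noteq> t \<longrightarrow> (\<forall>x\<in>nbhd E (g' s) A'. \<forall>y\<in>nbhd E (g' t) A'. ginv x \<circ> y \<in> D j))"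
  using T
proof induction
  case empty
  show ?case using g A by (intro exI[of _ g] exI[of _ A]) (auto simp: nbhd_def)
next
  case (insert p T)
  obtain s t j where p: "p = (s, t, j)" by (cases p)
  from insert.IH obtain g' A' where g'0: "\<forall>s. g' s \<in> nbhd E (g s) A" and A': "finite A'" "A \<subseteq> A'"
    and T0: "\<forall>s t j. (s, t, j) \<in> T \<longrightarrow> s \<noteq> t \<longrightarrow>
      (\<forall>x\<in>nbhd E (g' s) A'. \<forall>y\<in>nbhd E (g' t) A'. ginv x \<circ> y \<in> D j)"
    by (elim exE conjE) (rule that)
  note g' = g'0[rule_format] A' and T = T0[rule_format]
  show ?case
  proof (cases "s = t")
    case True
    have "\<forall>s t j. (s, t, j) \<in> insert p T \<longrightarrow> s \<noteq> t \<longrightarrow>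
      (\<forall>x\<in>nbhd E (g' s) A'. \<forall>y\<in>nbhd E (g' t) A'. ginv x \<circ> y \<in> D j)"
      using T0 True p by blast
    then show ?thesis using g'0 A' by (intro exI[of _ g'] exI[of _ A'] conjI)
  next
    case False
    have gs: "g' s \<in> hyp_Aut E" "g' t \<in> hyp_Aut E" using g'(1) nbhdD by blast+
    obtain k C where k: "k \<in> hyp_Aut E" "finite C" "A' \<subseteq> C"
      "\<And>x. x \<in> A' \<Longrightarrow> k x = (ginv (g' s) \<circ> g' t) x" "nbhd E k C \<subseteq> D j"
      using dense_interiorE[OF D hyp_Aut_comp[OF hyp_Aut_ginv[OF gs(1)] gs(2)] g'(2)] by metis
    \<comment> \<open>After this change the quotient of the members at \<open>s\<close> and
      \<open>t\<close> is \<open>k\<close>. For all \<open>x\<close> and \<open>y\<close> near them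
      it still agrees with \<open>k\<close> on \<open>C\<close>, because \<open>A''\<close>
      prescribes \<open>y\<close> on \<open>C\<close> and \<open>x\<close> on the image of
      \<open>C\<close> under \<open>k\<close>.\<close>
    define g'' where "g'' = g'(t := g' s \<circ> k)"
    define A'' where "A'' = C \<union> k ` C"
    have A'': "finite A''" "A' \<subseteq> A''" using k(2,3) by (auto simp: A''_def)
    have agree: "g'' u x = g' u x" if "x \<in> A'" for u x
      using k(4)[OF that] ginv_right[OF gs(1)] by (simp add: g''_def)
    have aut: "g'' u \<in> hyp_Aut E" for u
      using hyp_Aut_comp[OF gs(1) k(1)] g'(1)[of u] by (simp add: g''_def nbhd_def)
    have sub: "nbhd E (g'' u) A'' \<subseteq> nbhd E (g' u) A'" for u
      using agree A''(2) by (auto simp: nbhd_def)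
    have new: "ginv x \<circ> y \<in> D j" if x: "x \<in> nbhd E (g'' s) A''" and y: "y \<in> nbhd E (g'' t) A''" for x y
    proof -
      have xa: "x \<in> hyp_Aut E" and ya: "y \<in> hyp_Aut E" using x y nbhdD by blast+
      have "(ginv x \<circ> y) c = k c" if c: "c \<in> C" for c
      proof -
        have "y c = g' s (k c)" using nbhdD(2)[OF y, of c] c by (simp add: g''_def A''_def)
        moreover have "x (k c) = g' s (k c)"
          using nbhdD(2)[OF x, of "k c"] c False by (simp add: g''_def A''_def)
        ultimately show ?thesis using ginv_left[OF xa, of "k c"] by simp
      qed
      then have "ginv x \<circ> y \<in> nbhd E k C"
        by (intro nbhdI hyp_Aut_comp hyp_Aut_ginv xa ya)
      then show ?thesis using k(5) by blast
    qed
    have old: "ginv x \<circ> y \<in> D j'" if "(s', t', j') \<in> T" "s' \<noteq> t'" "x \<in> nbhd E (g'' s') A''" "y \<in> nbhd E (g'' t') A''" for s' t' j' x y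
      using T[OF that(1,2)] that(3,4) sub by blast
    have "g'' u \<in> nbhd E (g u) A" for u
    proof (rule nbhdI[OF aut])
      fix x assume x: "x \<in> A"
      then show "g'' u x = g u x" using agree[of x u] g'(3) nbhdD(2)[OF g'(1) x] by auto
    qed
    moreover have "\<forall>s' t' j'. (s', t', j') \<in> insert p T \<longrightarrow> s' \<noteq> t' \<longrightarrow>
      (\<forall>x\<in>nbhd E (g'' s') A''. \<forall>y\<in>nbhd E (g'' t') A''. ginv x \<circ> y \<in> D j')"
      unfolding p insert_iff prod.inject using new old by blast
    ultimately show ?thesis
      using A'' g'(3) by (intro exI[of _ g''] exI[of _ A''] conjI) blast+
  qed
qed

text \<open>A Cantor scheme: the nodes of level n are the subsets of \<open>{..<n}\<close>, and a
  branch is a set of natural numbers. Each level treats all pairs of distinct nodes and one more of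
  the dense sets, so the quotient of two distinct branches ends up in every member of
  \<open>\<D>\<close>.\<close>

lemma Mycielski:
  assumes D: "countable \<D>" "\<And>D. D \<in> \<D> \<Longrightarrow> dense_interior E D" and A0: "finite A0"
  obtains c :: "nat set \<Rightarrow> nat \<Rightarrow> nat" where
    "\<And>s. c s \<in> hyp_stab E A0" "\<And>s t D. s \<noteq> t \<Longrightarrow> D \<in> \<D> \<Longrightarrow> ginv (c s) \<circ> c t \<in> D"
proof -
  \<comment> \<open>Inserting \<open>UNIV\<close> makes the enumeration meaningful when
    \<open>\<D>\<close> is empty.\<close>
  define D where "D = from_nat_into (insert UNIV \<D>)"
  have DD: "dense_interior E (D j)" for j
  proof -
    have "dense_interior E UNIV" by (rule dense_interiorI) (metis finite.emptyI subset_UNIV)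
    then show ?thesis using from_nat_into[of "insert UNIV \<D>" j] assms(2) by (auto simp: D_def)
  qed
  have Dsurj: "\<exists>j. D j = D'" if "D' \<in> \<D>" for D'
    using from_nat_into_surj[of "insert UNIV \<D>" D'] that D(1) by (auto simp: D_def)
  define P where "P n x \<longleftrightarrow> (\<forall>s. fst x s \<in> hyp_stab E A0) \<and> finite (snd x) \<and> A0 \<subseteq> snd x"
    for n :: nat and x :: "(nat set \<Rightarrow> nat \<Rightarrow> nat) \<times> nat set"
  \<comment> \<open>A node \<open>s\<close> of the new level extends the node
    \<open>s \<inter> {..<n}\<close> of the old one. Placing \<open>n\<close> in the domain and in
    every image prepares the use of \<open>hyp_Aut_limit\<close>.\<close>
  define Q where "Q n x y \<longleftrightarrow> snd x \<subseteq> snd y \<and> n \<in> snd y \<and>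
     (\<forall>s\<subseteq>{..n}. n \<in> fst y s ` snd y \<and> (\<forall>z\<in>snd x. fst y s z = fst x (s \<inter> {..<n}) z)) \<and>
     (\<forall>s\<subseteq>{..n}. \<forall>t\<subseteq>{..n}. \<forall>j\<le>n. s \<noteq> t \<longrightarrow>
        (\<forall>u\<in>nbhd E (fst y s) (snd y). \<forall>v\<in>nbhd E (fst y t) (snd y). ginv u \<circ> v \<in> D j))"
    for n and x y :: "(nat set \<Rightarrow> nat \<Rightarrow> nat) \<times> nat set"
  have "\<exists>f. \<forall>n. P n (f n) \<and> Q n (f n) (f (Suc n))"
  proof (rule dependent_nat_choice)
    show "\<exists>x. P 0 x" using A0 hyp_stab_id by (intro exI[of _ "(\<lambda>_. id, A0)"]) (simp add: P_def)
    fix x :: "(nat set \<Rightarrow> nat \<Rightarrow> nat) \<times> nat set" and n assume x: "P n x"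
    define g where "g s = fst x (s \<inter> {..<n})" for s
    have fx: "fst x s \<in> hyp_stab E A0" for s using x by (simp add: P_def)
    have gG: "g s \<in> hyp_Aut E" for s using fx hyp_stab_subset unfolding g_def by blast
    have fA: "finite (snd x)" "A0 \<subseteq> snd x" using x by (auto simp: P_def)
    define T where "T = Pow {..n} \<times> Pow {..n} \<times> {..n}"
    have fT: "finite T" by (simp add: T_def)
    from Mycielski_step[of T D g "snd x", OF fT DD gG fA(1)]
    obtain g' A' where g'0: "\<forall>s. g' s \<in> nbhd E (g s) (snd x)" and A': "finite A'" "snd x \<subseteq> A'"
      and T0: "\<forall>s t j. (s, t, j) \<in> T \<longrightarrow> s \<noteq> t \<longrightarrow>
        (\<forall>u\<in>nbhd E (g' s) A'. \<forall>v\<in>nbhd E (g' t) A'. ginv u \<circ> v \<in> D j)"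
      by (elim exE conjE) (rule that)
    note g' = g'0[rule_format] A' and T = T0[rule_format]
    have g'G: "g' s \<in> hyp_Aut E" for s using g'(1) nbhdD by blast
    define A'' where "A'' = A' \<union> {n} \<union> (\<lambda>s. ginv (g' s) n) ` Pow {..n}"
    have A'': "finite A''" "A' \<subseteq> A''" "n \<in> A''" using g'(2) by (auto simp: A''_def)
    have sub: "nbhd E h A'' \<subseteq> nbhd E h A'" for h using A''(2) by (auto simp: nbhd_def)
    have mem: "n \<in> g' s ` A''" if "s \<subseteq> {..n}" for s
    proof -
      have "ginv (g' s) n \<in> A''" using that by (simp add: A''_def)
      then show ?thesis using ginv_right[OF g'G, of s n] by (metis imageI)
    qed
    have "P (Suc n) (g', A'')"
    proof -
      have "g' s \<in> hyp_stab E A0" for s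
      proof -
        have "g' s a = a" if "a \<in> A0" for a
          using nbhdD(2)[OF g'(1), of a s] that fA(2) fx[of "s \<inter> {..<n}"] by (auto simp: g_def hyp_stab_def)
        then show ?thesis using g'G by (simp add: hyp_stab_def)
      qed
      then show ?thesis using A'' g'(3) fA(2) by (auto simp: P_def)
    qed
    moreover have "Q n x (g', A'')"
    proof -
      have "g' s z = fst x (s \<inter> {..<n}) z" if "z \<in> snd x" for s z
        using nbhdD(2)[OF g'(1) that] by (simp add: g_def)
      moreover have "ginv u \<circ> v \<in> D j"
        if "s \<subseteq> {..n}" "t \<subseteq> {..n}" "j \<le> n" "s \<noteq> t" "u \<in> nbhd E (g' s) A''" "v \<in> nbhd E (g' t) A''" for s t j u v
        by (rule T[of s t]) (use that sub in \<open>auto simp: T_def\<close>)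
      ultimately show ?thesis unfolding Q_def using A'' g'(3) mem by auto
    qed
    ultimately show "\<exists>y. P (Suc n) y \<and> Q n x y" by blast
  qed
  then obtain f where fP: "\<And>n. P n (f n)" and fQ: "\<And>n. Q n (f n) (f (Suc n))" by blast
  define g where "g \<sigma> n = fst (f n) (\<sigma> \<inter> {..<n})" for \<sigma> n
  define A where "A n = snd (f n)" for n
  have gs: "g \<sigma> n \<in> hyp_stab E A0" for \<sigma> n using fP[of n] by (simp add: P_def g_def)
  then have gG: "g \<sigma> n \<in> hyp_Aut E" for \<sigma> n using hyp_stab_subset by blast
  have sub: "\<sigma> \<inter> {..<Suc n} \<subseteq> {..n}" for \<sigma> n by auto
  have int: "\<sigma> \<inter> {..<Suc n} \<inter> {..<n} = \<sigma> \<inter> {..<n}" for \<sigma> :: "nat set" and n by auto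
  have A: "A n \<subseteq> A (Suc n)" "n \<in> A (Suc n)" for n using fQ[of n] by (auto simp: Q_def A_def)
  have A3: "n \<in> g \<sigma> (Suc n) ` A (Suc n)" for \<sigma> n
    using fQ[of n] sub[of \<sigma> n] unfolding Q_def A_def g_def by blast
  have step: "g \<sigma> (Suc n) x = g \<sigma> n x" if "x \<in> A n" for \<sigma> n x
    using fQ[of n] sub[of \<sigma> n] that int[of \<sigma> n] unfolding Q_def A_def g_def by metis
  have "\<exists>h. h \<in> hyp_Aut E \<and> (\<forall>n. \<forall>x\<in>A n. h x = g \<sigma> n x)" for \<sigma>
    using hyp_Aut_limit[of "g \<sigma>" A, OF gG A A3 step] by metis
  then obtain c where c: "\<And>\<sigma>. c \<sigma> \<in> hyp_Aut E" "\<And>\<sigma> n x. x \<in> A n \<Longrightarrow> c \<sigma> x = g \<sigma> n x" by metis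
  have cn: "c \<sigma> \<in> nbhd E (g \<sigma> n) (A n)" for \<sigma> n using c by (intro nbhdI)
  have "c \<sigma> \<in> hyp_stab E A0" for \<sigma>
  proof -
    have "A0 \<subseteq> A 0" using fP[of 0] by (simp add: P_def A_def)
    then have "c \<sigma> a = a" if "a \<in> A0" for a using c(2)[of a 0 \<sigma>] gs[of \<sigma> 0] that by (auto simp: hyp_stab_def)
    then show ?thesis using c(1) by (simp add: hyp_stab_def)
  qed
  moreover have "ginv (c \<sigma>) \<circ> c \<tau> \<in> D'" if st: "\<sigma> \<noteq> \<tau>" and D': "D' \<in> \<D>" for \<sigma> \<tau> D'
  proof -
    obtain j where j: "D j = D'" using Dsurj[OF D'] by blast
    obtain i where i: "(i \<in> \<sigma>) \<noteq> (i \<in> \<tau>)" using st by blast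
    \<comment> \<open>At level \<open>Suc n\<close> the two branches have separated and requirement
      \<open>j\<close> is being treated.\<close>
    define n where "n = max i j"
    have "i \<le> n" "j \<le> n" by (auto simp: n_def)
    then have "\<sigma> \<inter> {..<Suc n} \<noteq> \<tau> \<inter> {..<Suc n}" using i by (metis IntD1 IntI le_imp_less_Suc lessThan_iff)
    moreover have "\<forall>s\<subseteq>{..n}. \<forall>t\<subseteq>{..n}. \<forall>j\<le>n. s \<noteq> t \<longrightarrow> (\<forall>u\<in>nbhd E (fst (f (Suc n)) s) (A (Suc n)).
        \<forall>v\<in>nbhd E (fst (f (Suc n)) t) (A (Suc n)). ginv u \<circ> v \<in> D j)"
      using fQ[of n] unfolding Q_def A_def by (elim conjE)
    ultimately have "ginv (c \<sigma>) \<circ> c \<tau> \<in> D j"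
      using sub[of \<sigma> n] sub[of \<tau> n] \<open>j \<le> n\<close> cn[of \<sigma> "Suc n"] cn[of \<tau> "Suc n"]
      unfolding g_def by simp
    then show ?thesis unfolding j .
  qed
  ultimately show ?thesis by (rule that)
qed

text \<open>Two members of the perfect family lie in one left coset of \<open>H\<close>; their
  quotient is the required element.\<close>

lemma small_index_meets_comeager:
  assumes H: "small_index E H"
    and D: "countable \<D>" "\<And>D. D \<in> \<D> \<Longrightarrow> dense_interior E D" and A: "finite A"
  obtains h where "h \<in> H" "h \<in> hyp_stab E A" "\<And>D. D \<in> \<D> \<Longrightarrow> h \<in> D"
proof -
  obtain c :: "nat set \<Rightarrow> nat \<Rightarrow> nat" where
    c: "\<And>s. c s \<in> hyp_stab E A" "\<And>s t D. s \<noteq> t \<Longrightarrow> D \<in> \<D> \<Longrightarrow> ginv (c s) \<circ> c t \<in> D"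
    using Mycielski[OF D A] by metis
  have "c s \<in> hyp_Aut E" for s using c(1) hyp_stab_subset by blast
  then obtain s t where st: "s \<noteq> t" "ginv (c s) \<circ> c t \<in> H" using H unfolding small_index_def by metis
  show ?thesis
    using st(2) hyp_stab_comp[OF hyp_stab_ginv[OF c(1)] c(1)] c(2)[OF st(1)] by (rule that)
qed

text \<open>If \<open>k\<close> is in the stabilizer but not in \<open>H\<close>, then
  \<open>x\<close> and \<open>x \<circ> k\<close> are not both in \<open>H\<close>. Adding the
  translates of the dense sets by \<open>k\<close> gives an \<open>x\<close> for which both elements
  meet all conditions.\<close>

lemma non_open_misses_comeager:
  assumes H: "perm_subgroup E H" and nH: "\<not> hyp_stab E A \<subseteq> H"
    and D: "countable \<D>" "\<And>D. D \<in> \<D> \<Longrightarrow> dense_interior E D" and A: "finite A"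
  obtains h where "h \<notin> H" "h \<in> hyp_stab E A" "\<And>D. D \<in> \<D> \<Longrightarrow> h \<in> D"
proof -
  obtain k where k: "k \<in> hyp_stab E A" "k \<notin> H" using nH by blast
  then have kG: "k \<in> hyp_Aut E" using hyp_stab_subset by blast
  define \<D>' where "\<D>' = \<D> \<union> (\<lambda>D. {x. x \<circ> k \<in> D}) ` \<D>"
  have "countable \<D>'" using D(1) by (simp add: \<D>'_def)
  moreover have "dense_interior E D'" if "D' \<in> \<D>'" for D'
    using that D(2) dense_interior_translate[OF _ kG] by (auto simp: \<D>'_def)
  ultimately obtain c :: "nat set \<Rightarrow> nat \<Rightarrow> nat" where
    c: "\<And>s. c s \<in> hyp_stab E A" "\<And>s t D. s \<noteq> t \<Longrightarrow> D \<in> \<D>' \<Longrightarrow> ginv (c s) \<circ> c t \<in> D"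
    using Mycielski[OF _ _ A] by metis
  define x where "x = ginv (c {}) \<circ> c {0}"
  have xA: "x \<in> hyp_stab E A" unfolding x_def using hyp_stab_comp[OF hyp_stab_ginv[OF c(1)] c(1)] .
  have xG: "x \<in> hyp_Aut E" using xA by (simp add: hyp_stab_def)
  have x: "x \<in> D" "x \<circ> k \<in> D" if "D \<in> \<D>" for D
    using c(2)[of "{}" "{0}"] that unfolding x_def[symmetric] \<D>'_def by auto
  show ?thesis
  proof (cases "x \<in> H")
    case False
    then show ?thesis using xA x(1) by (rule that)
  next
    case True
    have "x \<circ> k \<notin> H"
    proof
      assume "x \<circ> k \<in> H"
      then have "ginv x \<circ> (x \<circ> k) \<in> H" using H True unfolding perm_subgroup_def by blast
      moreover have "ginv x \<circ> (x \<circ> k) = k"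
        using ginv_left[OF xG] by (simp add: fun_eq_iff)
      ultimately show False using k(2) by simp
    qed
    then show ?thesis using hyp_stab_comp[OF xA k(1)] x(2) by (rule that)
  qed
qed

end

section \<open>Generic tuples and the small index property\<close>

context homogeneous_hypergraph begin

text \<open>Besides consisting of automorphisms, the tuple has cofinally many finite invariant sets,
  and every finite extension \<open>b\<close> on \<open>Y\<close> of its action on a finite
  invariant \<open>W\<close> is realized over \<open>W\<close>. Of \<open>b\<close> only the values
  on \<open>Y\<close> are used, so \<open>b\<close> stands for a finite action.\<close>

definition generic :: "nat \<Rightarrow> (nat \<Rightarrow> nat \<Rightarrow> nat) \<Rightarrow> bool" where
  "generic n a \<longleftrightarrow> (\<forall>i<n. a i \<in> hyp_Aut E) \<and>
     (\<forall>W. finite W \<longrightarrow> (\<exists>Y. finite Y \<and> W \<subseteq> Y \<and> (\<forall>i<n. a i ` Y = Y))) \<and>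
     (\<forall>W Y b. finite Y \<longrightarrow> W \<subseteq> Y \<longrightarrow>
        (\<forall>i<n. b i \<in> hyp_Aut E \<and> b i ` Y = Y \<and> a i ` W = W \<and> (\<forall>x\<in>W. b i x = a i x)) \<longrightarrow>
        (\<exists>k\<in>hyp_stab E W. \<forall>i<n. \<forall>y\<in>Y. k (b i y) = a i (k y)))"

lemma generic_aut:
  assumes "generic n a" "i < n"
  shows "a i \<in> hyp_Aut E"
  using assms(1)[unfolded generic_def, THEN conjunct1] assms(2) by simp

lemma generic_invariant:
  assumes "generic n a" "finite W"
  obtains Y where "finite Y" "W \<subseteq> Y" "\<And>i. i < n \<Longrightarrow> a i ` Y = Y"
proof -
  have "\<forall>W. finite W \<longrightarrow> (\<exists>Y. finite Y \<and> W \<subseteq> Y \<and> (\<forall>i<n. a i ` Y = Y))"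
    using assms(1) unfolding generic_def by (elim conjE)
  from this[THEN spec, THEN mp, OF assms(2)]
  obtain Y where Y: "finite Y" "W \<subseteq> Y" "\<forall>i<n. a i ` Y = Y" by (elim exE conjE)
  show ?thesis by (rule that[OF Y(1,2) Y(3)[rule_format]])
qed

lemma generic_extend:
  assumes "generic n a" "finite Y" "W \<subseteq> Y"
    and "\<And>i. i < n \<Longrightarrow> b i \<in> hyp_Aut E" "\<And>i. i < n \<Longrightarrow> b i ` Y = Y" "\<And>i. i < n \<Longrightarrow> a i ` W = W"
      "\<And>i x. i < n \<Longrightarrow> x \<in> W \<Longrightarrow> b i x = a i x"
  obtains k where "k \<in> hyp_stab E W" "\<And>i y. i < n \<Longrightarrow> y \<in> Y \<Longrightarrow> k (b i y) = a i (k y)"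
proof -
  have *: "\<forall>i<n. b i \<in> hyp_Aut E \<and> b i ` Y = Y \<and> a i ` W = W \<and> (\<forall>x\<in>W. b i x = a i x)"
    using assms(4-7) by simp
  have "\<forall>W Y b. finite Y \<longrightarrow> W \<subseteq> Y \<longrightarrow>
        (\<forall>i<n. b i \<in> hyp_Aut E \<and> b i ` Y = Y \<and> a i ` W = W \<and> (\<forall>x\<in>W. b i x = a i x)) \<longrightarrow>
        (\<exists>k\<in>hyp_stab E W. \<forall>i<n. \<forall>y\<in>Y. k (b i y) = a i (k y))"
    using assms(1) unfolding generic_def by (elim conjE)
  from this[THEN spec, THEN spec, THEN spec, THEN mp, THEN mp, THEN mp, OF assms(2,3) *]
  obtain k where k: "k \<in> hyp_stab E W" "\<forall>i<n. \<forall>y\<in>Y. k (b i y) = a i (k y)" by (elim bexE)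
  show ?thesis by (rule that[OF k(1) k(2)[rule_format]])
qed

lemma generic_cong:
  assumes "generic n a" "\<And>i. i < n \<Longrightarrow> a' i = a i"
  shows "generic n a'"
proof -
  have "(\<forall>i<n. Q i (a' i)) \<longleftrightarrow> (\<forall>i<n. Q i (a i))" for Q using assms(2) by simp
  note eq = this[of "\<lambda>i g. g \<in> hyp_Aut E"] this[of "\<lambda>i g. g ` Y = Y" for Y]
    this[of "\<lambda>i g. b i \<in> hyp_Aut E \<and> b i ` Y = Y \<and> g ` W = W \<and> (\<forall>x\<in>W. b i x = g x)" for b Y W]
    this[of "\<lambda>i g. \<forall>y\<in>Y. k (b i y) = g (k y)" for b Y k]
  show ?thesis unfolding generic_def eq using assms(1)[unfolded generic_def] .
qed

lemma generic_0: "generic 0 a"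
  unfolding generic_def
proof (intro conjI allI impI)
  fix W :: "nat set" assume "finite W"
  then show "\<exists>Y. finite Y \<and> W \<subseteq> Y \<and> (\<forall>i<0. a i ` Y = Y)" by (intro exI[of _ W]) simp
next
  fix W Y :: "nat set" and b
  show "\<exists>k\<in>hyp_stab E W. \<forall>i<0. \<forall>y\<in>Y. k (b i y) = a i (k y)"
    by (rule bexI[of _ id]) (simp_all add: hyp_stab_id)
qed simp

definition invariant_hull :: "nat \<Rightarrow> (nat \<Rightarrow> nat \<Rightarrow> nat) \<Rightarrow> nat set \<Rightarrow> (nat \<Rightarrow> nat) set" where
  "invariant_hull n a W = {x. \<exists>Y. finite Y \<and> W \<subseteq> Y \<and> (\<forall>i<n. a i ` Y = Y) \<and> x ` Y = Y}"

text \<open>Take an \<open>a\<close>-invariant finite \<open>V\<close> containing \<open>W\<close>,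
  \<open>A\<close> and the image of \<open>A\<close> under \<open>g\<close>. In a finite
  \<open>Y\<close> from \<open>EPPA\<close>, extensions \<open>b\<close> of \<open>a\<close> on
  \<open>V\<close> and \<open>c\<close> of \<open>g\<close> on \<open>A\<close> act. Genericity of
  \<open>a\<close> moves \<open>Y\<close> over \<open>V\<close> to a set on which \<open>a\<close>
  acts as \<open>b\<close> does; the conjugate of \<open>c\<close> preserves that set and still
  agrees with \<open>g\<close> on \<open>A\<close>.\<close>

lemma dense_invariant_hull:
  assumes a: "generic n a" and W: "finite W"
  shows "dense_interior E (invariant_hull n a W)"
proof (rule dense_interiorI)
  fix g and A :: "nat set" assume g: "g \<in> hyp_Aut E" and A: "finite A"
  have "finite (W \<union> A \<union> g ` A)" using W A by simp
  then obtain V where V: "finite V" "W \<union> A \<union> g ` A \<subseteq> V" "\<And>i. i < n \<Longrightarrow> a i ` V = V"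
    using generic_invariant[OF a] by metis
  obtain Y where Y: "finite Y" "V \<subseteq> Y"
    and ext: "\<And>g A. g \<in> hyp_Aut E \<Longrightarrow> A \<subseteq> V \<Longrightarrow> g ` A \<subseteq> V \<Longrightarrow> \<exists>h\<in>hyp_Aut E. h ` Y = Y \<and> (\<forall>a\<in>A. h a = g a)"
    using EPPA[OF V(1)] by metis
  have "\<exists>h. i < n \<longrightarrow> h \<in> hyp_Aut E \<and> h ` Y = Y \<and> (\<forall>x\<in>V. h x = a i x)" for i
    using ext[OF generic_aut[OF a], of i V] V(3)[of i] by blast
  then obtain b where b: "\<And>i. i < n \<Longrightarrow> b i \<in> hyp_Aut E" "\<And>i. i < n \<Longrightarrow> b i ` Y = Y"
      "\<And>i x. i < n \<Longrightarrow> x \<in> V \<Longrightarrow> b i x = a i x" by metis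
  obtain k where k: "k \<in> hyp_stab E V" "\<And>i y. i < n \<Longrightarrow> y \<in> Y \<Longrightarrow> k (b i y) = a i (k y)"
    using generic_extend[OF a Y b(1,2) V(3) b(3)] by metis
  have sub: "A \<subseteq> V" "g ` A \<subseteq> V" using V(2) by auto
  obtain c where c: "c \<in> hyp_Aut E" "c ` Y = Y" "\<And>x. x \<in> A \<Longrightarrow> c x = g x"
    using ext[OF g sub] by blast
  have kG: "k \<in> hyp_Aut E" and kV: "\<And>x. x \<in> V \<Longrightarrow> k x = x" using k(1) by (auto simp: hyp_stab_def)
  have kiV: "ginv k x = x" if "x \<in> V" for x using ginv_left[OF kG, of x] kV[OF that] by simp
  define h where "h = k \<circ> c \<circ> ginv k"
  have hG: "h \<in> hyp_Aut E" unfolding h_def by (intro hyp_Aut_comp hyp_Aut_ginv kG c)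
  have hA: "h x = g x" if x: "x \<in> A" for x
  proof -
    have "x \<in> V" "g x \<in> V" using x sub by auto
    then show ?thesis using kiV[of x] kV[of "g x"] c(3)[OF x] by (simp add: h_def)
  qed
  have hY: "h ` k ` Y = k ` Y"
  proof -
    have "ginv k ` k ` Y = Y" by (simp add: image_image ginv_left[OF kG])
    then show ?thesis unfolding h_def image_comp[symmetric] using c(2) by simp
  qed
  have aY: "a i ` k ` Y = k ` Y" if i: "i < n" for i
  proof -
    have "a i ` k ` Y = k ` b i ` Y" unfolding image_image using k(2)[OF i] by (intro image_cong) auto
    then show ?thesis using b(2)[OF i] by simp
  qed
  have "x \<in> V \<Longrightarrow> x \<in> k ` Y" for x using kV[of x] Y(2) by (metis imageI subsetD)
  then have VY: "V \<subseteq> k ` Y" by blast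
  have "nbhd E h (k ` Y) \<subseteq> invariant_hull n a W"
  proof
    fix x assume x: "x \<in> nbhd E h (k ` Y)"
    have "x ` k ` Y = h ` k ` Y" using nbhdD(2)[OF x] by (intro image_cong) auto
    then show "x \<in> invariant_hull n a W"
      unfolding invariant_hull_def using hY aY VY V(2) Y(1) by (intro CollectI exI[of _ "k ` Y"]) auto
  qed
  then show "\<exists>h C. h \<in> hyp_Aut E \<and> finite C \<and> (\<forall>x\<in>A. h x = g x) \<and> nbhd E h C \<subseteq> invariant_hull n a W"
    using hG hA Y(1) by (intro exI[of _ h] exI[of _ "k ` Y"] conjI ballI finite_imageI)
qed

definition compatible :: "nat \<Rightarrow> (nat \<Rightarrow> nat \<Rightarrow> nat) \<Rightarrow> nat set \<Rightarrow> nat set \<Rightarrow> (nat \<Rightarrow> nat \<Rightarrow> nat) \<Rightarrow> bool" where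
  "compatible n a W Y b \<longleftrightarrow> W \<subseteq> Y \<and>
     (\<forall>i<n. b i \<in> hyp_Aut E \<and> b i ` Y = Y \<and> a i ` W = W \<and> (\<forall>x\<in>W. b i x = a i x))"

text \<open>Only the values of the \<open>b i\<close> on the finite set \<open>set ys\<close> matter; prescribing them by the lists \<open>t\<close>
  leaves countably many requirements.\<close>

definition extension_set :: "nat \<Rightarrow> (nat \<Rightarrow> nat \<Rightarrow> nat) \<Rightarrow> nat set \<Rightarrow> nat list \<Rightarrow> nat list list \<Rightarrow> (nat \<Rightarrow> nat) set" where
  "extension_set n a W ys t = {x. \<forall>b. compatible (Suc n) (a(n := x)) W (set ys) b \<longrightarrow>
     (\<forall>i<Suc n. map (b i) ys = t ! i) \<longrightarrow>
     (\<exists>k\<in>hyp_stab E W. \<forall>i<Suc n. \<forall>y\<in>set ys. k (b i y) = (a(n := x)) i (k y))}"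

text \<open>After approximating \<open>g\<close> by some \<open>h\<close> with a finite set
  \<open>V\<close> invariant under \<open>a\<close> and \<open>h\<close>, a copy of
  \<open>set ys\<close> is put free from \<open>V\<close> over \<open>W\<close>. There the action
  \<open>b\<close> on the copy and the action of \<open>a\<close> and \<open>h\<close> on
  \<open>V\<close> are glued to \<open>r\<close>. Genericity of \<open>a\<close> realizes the first
  \<open>n\<close> entries of \<open>r\<close> over \<open>V\<close>, and the remaining one is
  transported along.\<close>

lemma dense_extension_set:
  assumes a: "generic n a" and W: "finite W"
  shows "dense_interior E (extension_set n a W ys t)"
proof (rule dense_interiorI)
  fix g and A :: "nat set" assume g: "g \<in> hyp_Aut E" and A: "finite A"
  have "finite (W \<union> A)" using W A by simp
  obtain h C where h: "h \<in> hyp_Aut E" "\<And>x. x \<in> A \<Longrightarrow> h x = g x" "nbhd E h C \<subseteq> invariant_hull n a (W \<union> A)"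
    using dense_interiorE[OF dense_invariant_hull[OF a \<open>finite (W \<union> A)\<close>] g A] by metis
  have "h \<in> invariant_hull n a (W \<union> A)" by (rule subsetD[OF h(3) nbhdI[OF h(1)]]) simp
  then obtain V where V: "finite V" "W \<union> A \<subseteq> V" "\<And>i. i < n \<Longrightarrow> a i ` V = V" "h ` V = V"
    unfolding invariant_hull_def by blast
  let ?goal = "\<exists>h C. h \<in> hyp_Aut E \<and> finite C \<and> (\<forall>x\<in>A. h x = g x) \<and> nbhd E h C \<subseteq> extension_set n a W ys t"
  have same: "compatible (Suc n) (a(n := h)) W (set ys) b" if x: "\<And>z. z \<in> W \<Longrightarrow> x z = h z"
      and b: "compatible (Suc n) (a(n := x)) W (set ys) b" for x b
  proof -
    have "x ` W = h ` W" using x by (intro image_cong) auto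
    then show ?thesis using b x by (simp add: compatible_def less_Suc_eq)
  qed
  show ?goal
  proof (cases "\<exists>b. compatible (Suc n) (a(n := h)) W (set ys) b \<and> (\<forall>i<Suc n. map (b i) ys = t ! i)")
    \<comment> \<open>Compatibility depends on \<open>x\<close> only through its values on
      \<open>W\<close>, so near \<open>h\<close> the condition holds vacuously.\<close>
    case False
    have "x \<in> extension_set n a W ys t" if x: "x \<in> nbhd E h V" for x
    proof -
      have xW: "x z = h z" if "z \<in> W" for z using nbhdD(2)[OF x, of z] V(2) that by blast
      have "\<not> (compatible (Suc n) (a(n := x)) W (set ys) b \<and> (\<forall>i<Suc n. map (b i) ys = t ! i))" for b
        using same[OF xW, of b] False by blast
      then show ?thesis unfolding extension_set_def by blast
    qed
    then have "nbhd E h V \<subseteq> extension_set n a W ys t" by blast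
    then show ?thesis using h(1,2) V(1) by (intro exI[of _ h] exI[of _ V] conjI ballI)
  next
    case True
    define a' where "a' = a(n := h)"
    define Y where "Y = set ys"
    obtain b where b: "compatible (Suc n) a' W Y b" and bt: "\<forall>i<Suc n. map (b i) ys = t ! i"
      using True unfolding a'_def Y_def by blast
    have WY: "W \<subseteq> Y" using b by (simp add: compatible_def)
    have bG: "b i \<in> hyp_Aut E" and bY: "b i ` Y = Y" and aW: "a' i ` W = W"
      and baW: "\<And>x. x \<in> W \<Longrightarrow> b i x = a' i x" if "i < Suc n" for i
      using b that by (simp_all add: compatible_def)
    have a'G: "a' i \<in> hyp_Aut E" and a'V: "a' i ` V = V" if "i < Suc n" for i
      using that h(1) V(3,4) generic_aut[OF a] by (auto simp: a'_def less_Suc_eq)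
    have WV: "W \<subseteq> V" using V(2) by blast
    obtain s where s: "s \<in> hyp_stab E W" "s ` Y \<inter> V = W" "free_over E (s ` Y) V"
      using free_amalgam[OF _ V(1) WY WV] by (metis Y_def finite_set)
    have sG: "s \<in> hyp_Aut E" and sW: "\<And>x. x \<in> W \<Longrightarrow> s x = x" using s(1) by (auto simp: hyp_stab_def)
    have siW: "ginv s x = x" if "x \<in> W" for x using ginv_left[OF sG, of x] sW[OF that] by simp
    have siY: "ginv s ` s ` Y = Y" by (simp add: image_image ginv_left[OF sG])
    have "\<exists>r. r \<in> hyp_Aut E \<and> (\<forall>y\<in>Y. r (s y) = s (b i y)) \<and> (\<forall>x\<in>V. r x = a' i x)" if i: "i < Suc n" for i
    proof -
      define p where "p = s \<circ> b i \<circ> ginv s"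
      have pG: "p \<in> hyp_Aut E" unfolding p_def by (intro hyp_Aut_comp hyp_Aut_ginv sG bG i)
      have pY: "p ` s ` Y = s ` Y" unfolding p_def image_comp[symmetric] siY bY[OF i] ..
      have pW: "p x = a' i x" if x: "x \<in> W" for x
      proof -
        have "a' i x \<in> W" using aW[OF i] x by blast
        then show ?thesis using siW[OF x] baW[OF i x] sW by (simp add: p_def)
      qed
      then have pW': "p ` W = W" using aW[OF i] by (metis image_cong)
      have "p ` (s ` Y) \<inter> a' i ` V \<subseteq> p ` (s ` Y \<inter> V)" unfolding pY a'V[OF i] s(2) pW' ..
      moreover have "p x = a' i x" if "x \<in> s ` Y" "x \<in> V" for x using pW s(2) that by blast
      moreover have "free_over E (p ` s ` Y) (a' i ` V)" unfolding pY a'V[OF i] by (rule s(3))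
      moreover have "finite (s ` Y)" by (simp add: Y_def)
      ultimately obtain r where r: "r \<in> hyp_Aut E" "\<And>x. x \<in> s ` Y \<Longrightarrow> r x = p x" "\<And>x. x \<in> V \<Longrightarrow> r x = a' i x"
        using glue[OF _ V(1) pG a'G[OF i] _ _ s(3)] by metis
      have "r (s y) = s (b i y)" if "y \<in> Y" for y
        using r(2)[OF imageI[OF that]] ginv_left[OF sG, of y] by (simp add: p_def)
      then show ?thesis using r by blast
    qed
    then obtain r where r: "\<And>i. i < Suc n \<Longrightarrow> r i \<in> hyp_Aut E"
        "\<And>i y. i < Suc n \<Longrightarrow> y \<in> Y \<Longrightarrow> r i (s y) = s (b i y)"
        "\<And>i x. i < Suc n \<Longrightarrow> x \<in> V \<Longrightarrow> r i x = a' i x" by metis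
    define Z where "Z = s ` Y \<union> V"
    have fZ: "finite Z" using V(1) by (simp add: Z_def Y_def)
    have VZ: "V \<subseteq> Z" by (simp add: Z_def)
    have rZ: "r i ` Z = Z" if i: "i < Suc n" for i
    proof -
      have "r i ` s ` Y = s ` b i ` Y" unfolding image_image using r(2)[OF i] by (intro image_cong) auto
      moreover have "r i ` V = a' i ` V" using r(3)[OF i] by (intro image_cong) auto
      ultimately show ?thesis unfolding Z_def image_Un using bY[OF i] a'V[OF i] by simp
    qed
    have lt: "i < Suc n" "a' i = a i" if "i < n" for i using that by (auto simp: a'_def)
    have rV: "r i x = a i x" if "i < n" "x \<in> V" for i x
      using r(3)[OF lt(1)[OF that(1)] that(2)] lt(2)[OF that(1)] by simp
    obtain k where k: "k \<in> hyp_stab E V" "\<And>i z. i < n \<Longrightarrow> z \<in> Z \<Longrightarrow> k (r i z) = a i (k z)"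
      using generic_extend[OF a fZ VZ r(1)[OF lt(1)] rZ[OF lt(1)] V(3) rV] by metis
    have kG: "k \<in> hyp_Aut E" and kV: "\<And>x. x \<in> V \<Longrightarrow> k x = x" using k(1) by (auto simp: hyp_stab_def)
    have kiV: "ginv k x = x" if "x \<in> V" for x using ginv_left[OF kG, of x] kV[OF that] by simp
    \<comment> \<open>Since \<open>k\<close> carries the first \<open>n\<close> entries of
      \<open>r\<close> to those of \<open>a\<close>, the last entry is conjugated by the same
      \<open>k\<close>. It agrees with \<open>h\<close> on \<open>V\<close>, which \<open>k\<close>
      fixes, and \<open>k \<circ> s\<close> witnesses the extension.\<close>
    define h' where "h' = k \<circ> r n \<circ> ginv k"
    have h'G: "h' \<in> hyp_Aut E" unfolding h'_def by (intro hyp_Aut_comp hyp_Aut_ginv kG r(1)) simp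
    have h'k: "h' (k z) = k (r n z)" for z by (simp add: h'_def ginv_left[OF kG])
    have h'V: "h' x = h x" if x: "x \<in> V" for x
    proof -
      have "h x \<in> V" using V(4) x by blast
      then show ?thesis using kiV[OF x] r(3)[of n x] x kV by (simp add: h'_def a'_def)
    qed
    have ks: "k \<circ> s \<in> hyp_stab E W"
      using hyp_stab_comp[OF subsetD[OF hyp_stab_antimono[OF WV] k(1)] s(1)] .
    have "x \<in> extension_set n a W ys t" if x: "x \<in> nbhd E h' (V \<union> k ` Z)" for x
      unfolding extension_set_def
    proof (intro CollectI allI impI)
      fix b' assume b't: "\<forall>i<Suc n. map (b' i) ys = t ! i"
      have b'b: "b' i y = b i y" if "i < Suc n" "y \<in> Y" for i y
      proof -
        have "map (b' i) ys = map (b i) ys" using b't bt that(1) by metis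
        then show ?thesis using that(2) by (simp add: Y_def)
      qed
      have "(k \<circ> s) (b' i y) = (a(n := x)) i ((k \<circ> s) y)" if i: "i < Suc n" and y: "y \<in> Y" for i y
      proof -
        have sz: "s y \<in> Z" using y by (simp add: Z_def)
        have 1: "(k \<circ> s) (b' i y) = k (r i (s y))" using r(2)[OF i y] b'b[OF i y] by simp
        show ?thesis
        proof (cases "i = n")
          case True
          have "x (k (s y)) = h' (k (s y))" using nbhdD(2)[OF x] sz by blast
          then show ?thesis unfolding 1 using True h'k by simp
        next
          case False
          then have "i < n" using i by simp
          then show ?thesis unfolding 1 using k(2)[OF _ sz] by simp
        qed
      qed
      then show "\<exists>k\<in>hyp_stab E W. \<forall>i<Suc n. \<forall>y\<in>set ys. k (b' i y) = (a(n := x)) i (k y)"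
        using ks unfolding Y_def by blast
    qed
    then have "nbhd E h' (V \<union> k ` Z) \<subseteq> extension_set n a W ys t" by blast
    moreover have "h' x = g x" if "x \<in> A" for x using h'V[of x] h(2)[OF that] V(2) that by auto
    moreover have "finite (V \<union> k ` Z)" using V(1) fZ by simp
    ultimately show ?thesis using h'G by (intro exI[of _ h'] exI[of _ "V \<union> k ` Z"] conjI ballI)
  qed
qed

text \<open>Only countably many dense conditions are imposed on the new entry, so it can be taken
  inside a subgroup of small index as well as outside a subgroup that is not open.\<close>

lemma generic_step:
  assumes a: "generic n a"
  obtains \<D> where "countable \<D>" "\<And>D. D \<in> \<D> \<Longrightarrow> dense_interior E D"
    "\<And>x. x \<in> hyp_Aut E \<Longrightarrow> (\<And>D. D \<in> \<D> \<Longrightarrow> x \<in> D) \<Longrightarrow> generic (Suc n) (a(n := x))"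
proof -
  define \<D>1 where "\<D>1 = (\<lambda>ws. invariant_hull n a (set ws)) ` UNIV"
  define \<D>2 where "\<D>2 = (\<lambda>(ws, ys, t). extension_set n a (set ws) ys t) ` UNIV"
  have "countable (\<D>1 \<union> \<D>2)" 
    unfolding \<D>1_def \<D>2_def by (intro countable_Un countable_image[OF countableI_type])
  moreover have "dense_interior E D" if "D \<in> \<D>1 \<union> \<D>2" for D
  proof -
    consider ws where "D = invariant_hull n a (set ws)" | ws ys t where "D = extension_set n a (set ws) ys t"
      using \<open>D \<in> \<D>1 \<union> \<D>2\<close> unfolding \<D>1_def \<D>2_def by auto
    then show ?thesis by cases (simp_all add: dense_invariant_hull[OF a] dense_extension_set[OF a])
  qed
  moreover have "generic (Suc n) (a(n := x))"
    if x: "x \<in> hyp_Aut E" and D: "\<And>D. D \<in> \<D>1 \<union> \<D>2 \<Longrightarrow> x \<in> D" for x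
    unfolding generic_def
  proof (intro conjI allI impI)
    fix i assume "i < Suc n"
    then show "(a(n := x)) i \<in> hyp_Aut E" using x generic_aut[OF a, of i] by (cases "i = n") auto
  next
    fix W :: "nat set" assume "finite W"
    then obtain ws where ws: "W = set ws" using finite_list by metis
    have "x \<in> invariant_hull n a W" unfolding ws by (rule D) (auto simp: \<D>1_def)
    then obtain Y where "finite Y" "W \<subseteq> Y" "\<forall>i<n. a i ` Y = Y" "x ` Y = Y"
      unfolding invariant_hull_def by blast
    then show "\<exists>Y. finite Y \<and> W \<subseteq> Y \<and> (\<forall>i<Suc n. (a(n := x)) i ` Y = Y)"
      by (intro exI[of _ Y]) (simp add: less_Suc_eq)
  next
    fix W Y :: "nat set" and b assume Y: "finite Y" "W \<subseteq> Y"
      and b: "\<forall>i<Suc n. b i \<in> hyp_Aut E \<and> b i ` Y = Y \<and> (a(n := x)) i ` W = W \<and> (\<forall>z\<in>W. b i z = (a(n := x)) i z)"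
    obtain ys where ys: "Y = set ys" using finite_list[OF Y(1)] by metis
    obtain ws where ws: "W = set ws" using finite_list[OF finite_subset[OF Y(2,1)]] by metis
    define t where "t = map (\<lambda>i. map (b i) ys) [0..<Suc n]"
    have t: "map (b i) ys = t ! i" if "i < Suc n" for i using that by (simp add: t_def del: upt_Suc)
    have "extension_set n a W ys t \<in> \<D>2" unfolding \<D>2_def ws by (rule image_eqI[of _ _ "(ws, ys, t)"]) auto
    then have "x \<in> extension_set n a W ys t" by (intro D) simp
    moreover have "compatible (Suc n) (a(n := x)) W (set ys) b" using b Y(2) by (simp add: compatible_def ys)
    ultimately show "\<exists>k\<in>hyp_stab E W. \<forall>i<Suc n. \<forall>y\<in>Y. k (b i y) = (a(n := x)) i (k y)"
      using t unfolding extension_set_def ys by blast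
  qed
  ultimately show ?thesis by (rule that)
qed

text \<open>The action of \<open>u\<close> on a larger invariant set is transported by
  \<open>k\<close> and then realized for \<open>v\<close> over the image of \<open>Y\<close>;
  composing \<open>k\<close> with the realizing map extends it.\<close>

lemma generic_forth:
  assumes u: "generic n u" and v: "generic n v" and k: "k \<in> hyp_Aut E" and Y: "finite Y"
    and uY: "\<And>i. i < n \<Longrightarrow> u i ` Y = Y" and kY: "\<And>i y. i < n \<Longrightarrow> y \<in> Y \<Longrightarrow> k (u i y) = v i (k y)"
    and W: "finite W"
  shows "\<exists>k' Y'. k' \<in> hyp_Aut E \<and> finite Y' \<and> Y \<union> W \<subseteq> Y' \<and> (\<forall>y\<in>Y. k' y = k y) \<and>
    (\<forall>i<n. u i ` Y' = Y') \<and> (\<forall>i<n. \<forall>y\<in>Y'. k' (u i y) = v i (k' y))"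
proof -
  have "finite (Y \<union> W)" using Y W by simp
  then obtain Y' where Y': "finite Y'" "Y \<union> W \<subseteq> Y'" "\<And>i. i < n \<Longrightarrow> u i ` Y' = Y'"
    using generic_invariant[OF u] by metis
  define b where "b i = k \<circ> u i \<circ> ginv k" for i
  have bk: "b i (k y) = k (u i y)" for i y by (simp add: b_def ginv_left[OF k])
  have bG: "b i \<in> hyp_Aut E" if "i < n" for i
    unfolding b_def by (intro hyp_Aut_comp hyp_Aut_ginv k generic_aut[OF u that])
  have bY: "b i ` k ` Y' = k ` Y'" if "i < n" for i
  proof -
    have "b i ` k ` Y' = k ` u i ` Y'" by (simp add: image_image bk)
    then show ?thesis using Y'(3)[OF that] by simp
  qed
  have vY: "v i ` k ` Y = k ` Y" if i: "i < n" for i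
  proof -
    have "v i ` k ` Y = k ` u i ` Y" unfolding image_image using kY[OF i] by (intro image_cong) auto
    then show ?thesis using uY[OF i] by simp
  qed
  have bv: "b i x = v i x" if i: "i < n" and x: "x \<in> k ` Y" for i x
  proof -
    obtain y where "x = k y" "y \<in> Y" using x by blast
    then show ?thesis using bk kY[OF i] by simp
  qed
  have sub: "k ` Y \<subseteq> k ` Y'" using Y'(2) by blast
  obtain l where l: "l \<in> hyp_stab E (k ` Y)" "\<And>i z. i < n \<Longrightarrow> z \<in> k ` Y' \<Longrightarrow> l (b i z) = v i (l z)"
    using generic_extend[OF v finite_imageI[OF Y'(1)] sub bG bY vY bv] by metis
  note lk1 = hyp_Aut_comp[OF subsetD[OF hyp_stab_subset l(1)] k]
  have lk2: "(l \<circ> k) y = k y" if "y \<in> Y" for y using l(1) that by (simp add: hyp_stab_def)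
  have lk3: "(l \<circ> k) (u i y) = v i ((l \<circ> k) y)" if "i < n" "y \<in> Y'" for i y
    using l(2)[OF that(1) imageI[OF that(2)]] bk by simp
  show ?thesis
    by (rule exI[of _ "l \<circ> k"], rule exI[of _ Y'], intro conjI ballI allI impI,
        rule lk1, rule Y'(1), rule Y'(2), rule lk2, assumption, rule Y'(3), assumption, rule lk3, assumption+)
qed

text \<open>Back-and-forth: stage m applies \<open>generic_forth\<close> to the current map to put m
  into its domain, and then to the inverse, with \<open>u\<close> and \<open>v\<close> exchanged, to
  put m into its range.\<close>

lemma generic_conjugate:
  assumes u: "generic n u" and v: "generic n v" and k0: "k0 \<in> hyp_Aut E" and Y0: "finite Y0"
    and uY0: "\<And>i. i < n \<Longrightarrow> u i ` Y0 = Y0" and kY0: "\<And>i y. i < n \<Longrightarrow> y \<in> Y0 \<Longrightarrow> k0 (u i y) = v i (k0 y)"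
  obtains k where "k \<in> hyp_Aut E" "\<And>y. y \<in> Y0 \<Longrightarrow> k y = k0 y" "\<And>i x. i < n \<Longrightarrow> k (u i x) = v i (k x)"
proof -
  \<comment> \<open>The clause for \<open>m = 0\<close> ties the start of the chosen sequence to the
    given \<open>k0\<close> and \<open>Y0\<close>.\<close>
  define P where "P m x \<longleftrightarrow> fst x \<in> hyp_Aut E \<and> finite (snd x) \<and> (\<forall>i<n. u i ` snd x = snd x) \<and>
     (\<forall>i<n. \<forall>y\<in>snd x. fst x (u i y) = v i (fst x y)) \<and> (m = 0 \<longrightarrow> x = (k0, Y0))"
    for m :: nat and x :: "(nat \<Rightarrow> nat) \<times> nat set"
  define Q where "Q m x y \<longleftrightarrow> snd x \<subseteq> snd y \<and> m \<in> snd y \<and> m \<in> fst y ` snd y \<and> (\<forall>z\<in>snd x. fst y z = fst x z)"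
    for m and x y :: "(nat \<Rightarrow> nat) \<times> nat set"
  have "\<exists>f. \<forall>m. P m (f m) \<and> Q m (f m) (f (Suc m))"
  proof (rule dependent_nat_choice)
    have "P 0 (k0, Y0)" unfolding P_def fst_conv snd_conv 
      by (intro conjI allI impI ballI, rule k0, rule Y0, rule uY0, assumption, rule kY0, assumption+, rule refl)
    then show "\<exists>x. P 0 x" by blast
    fix x :: "(nat \<Rightarrow> nat) \<times> nat set" and m assume x: "P m x"
    define k Y where "k = fst x" and "Y = snd x"
    note kY = x[unfolded P_def, folded k_def Y_def, THEN conjunct1]
        x[unfolded P_def, folded k_def Y_def, THEN conjunct2, THEN conjunct1]
        x[unfolded P_def, folded k_def Y_def, THEN conjunct2, THEN conjunct2, THEN conjunct1, rule_format]
        x[unfolded P_def, folded k_def Y_def, THEN conjunct2, THEN conjunct2, THEN conjunct2, THEN conjunct1, rule_format]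
    have m: "finite {m}" by simp
    obtain k' Y' where k'0: "k' \<in> hyp_Aut E" "finite Y'" "Y \<union> {m} \<subseteq> Y'" "\<forall>y\<in>Y. k' y = k y"
      "\<forall>i<n. u i ` Y' = Y'" "\<forall>i<n. \<forall>y\<in>Y'. k' (u i y) = v i (k' y)"
      using generic_forth[of n u v k Y "{m}", OF u v kY m] by metis
    note k' = k'0[rule_format]
    have vY': "v i ` k' ` Y' = k' ` Y'" if i: "i < n" for i
    proof -
      have "v i ` k' ` Y' = k' ` u i ` Y'" unfolding image_image using k'(6)[OF i] by (intro image_cong) auto
      then show ?thesis using k'(5)[OF i] by simp
    qed
    have kv: "ginv k' (v i y) = u i (ginv k' y)" if i: "i < n" and y: "y \<in> k' ` Y'" for i y
    proof -
      obtain z where z: "y = k' z" "z \<in> Y'" using y by blast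
      then show ?thesis using k'(6)[OF i z(2)] ginv_left[OF k'(1)] by metis
    qed
    obtain l Z where l0: "l \<in> hyp_Aut E" "finite Z" "k' ` Y' \<union> {m} \<subseteq> Z" "\<forall>y\<in>k' ` Y'. l y = ginv k' y"
      "\<forall>i<n. v i ` Z = Z" "\<forall>i<n. \<forall>y\<in>Z. l (v i y) = u i (l y)"
      using generic_forth[of n v u "ginv k'" "k' ` Y'" "{m}", OF v u hyp_Aut_ginv[OF k'(1)] finite_imageI[OF k'(2)] vY' kv m]
      by metis
    note l = l0[rule_format]
    define k'' where "k'' = ginv l"
    have lk: "k'' (l z) = z" "l (k'' z) = z" for z
      using ginv_left[OF l(1)] ginv_right[OF l(1)] by (simp_all add: k''_def)
    have kk: "k'' y = k' y" if y: "y \<in> Y'" for y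
    proof -
      have "l (k' y) = y" using l(4)[OF imageI[OF y]] ginv_left[OF k'(1)] by simp
      then show ?thesis using lk(1) by metis
    qed
    have ul: "u i ` l ` Z = l ` Z" if i: "i < n" for i
    proof -
      have "u i ` l ` Z = l ` v i ` Z" unfolding image_image using l(6)[OF i] by (intro image_cong) auto
      then show ?thesis using l(5)[OF i] by simp
    qed
    have ku: "k'' (u i y) = v i (k'' y)" if i: "i < n" and y: "y \<in> l ` Z" for i y
    proof -
      obtain z where z: "y = l z" "z \<in> Z" using y by blast
      then show ?thesis using l(6)[OF i z(2)] lk by metis
    qed
    have Y'l: "y \<in> l ` Z" if y: "y \<in> Y'" for y
    proof -
      have "k' y \<in> Z" using l(3) y by blast
      then show ?thesis using kk[OF y] lk(2)[of y] by (metis imageI)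
    qed
    have "P (Suc m) (k'', l ` Z)"
      unfolding P_def fst_conv snd_conv k''_def
      by (intro conjI allI impI ballI, rule hyp_Aut_ginv[OF l(1)], rule finite_imageI[OF l(2)],
          rule ul, assumption, rule ku[unfolded k''_def], assumption+, simp)
    moreover have "Q m x (k'', l ` Z)"
    proof -
      have "Y \<subseteq> l ` Z" "m \<in> l ` Z" using Y'l k'(3) by auto
      moreover have "m \<in> k'' ` l ` Z"
      proof -
        have "m \<in> Z" using l(3) by blast
        then show ?thesis using lk(1)[of m] by (metis imageI)
      qed
      moreover have "k'' z = k z" if "z \<in> Y" for z using kk[of z] k'(4)[OF that] k'(3) that by auto
      ultimately show ?thesis by (simp add: Q_def k_def Y_def)
    qed
    ultimately show "\<exists>y. P (Suc m) y \<and> Q m x y" by blast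
  qed
  then obtain f where fP: "\<And>m. P m (f m)" and fQ: "\<And>m. Q m (f m) (f (Suc m))" by blast
  define k A where "k m = fst (f m)" and "A m = snd (f m)" for m
  have kG: "k m \<in> hyp_Aut E" for m using fP[of m] by (simp add: P_def k_def)
  have A: "A m \<subseteq> A (Suc m)" "m \<in> A (Suc m)" "m \<in> k (Suc m) ` A (Suc m)" for m
    using fQ[of m] unfolding Q_def A_def k_def by blast+
  have step: "k (Suc m) x = k m x" if "x \<in> A m" for m x
    using fQ[of m] that unfolding Q_def A_def k_def by blast
  obtain h where h: "h \<in> hyp_Aut E" "\<And>m x. x \<in> A m \<Longrightarrow> h x = k m x"
    using hyp_Aut_limit[OF edge_finite kG A step] by metis
  have f0: "f 0 = (k0, Y0)" using fP[of 0] by (simp add: P_def)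
  have "h y = k0 y" if "y \<in> Y0" for y using h(2)[of y 0] that f0 by (simp add: A_def k_def)
  moreover have "h (u i x) = v i (h x)" if i: "i < n" for i x
  proof -
    have x: "x \<in> A (Suc x)" using A(2) .
    have P: "u i ` A (Suc x) = A (Suc x)" "k (Suc x) (u i x) = v i (k (Suc x) x)"
      using fP[of "Suc x", unfolded P_def, folded A_def k_def, THEN conjunct2, THEN conjunct2, THEN conjunct1] i
        fP[of "Suc x", unfolded P_def, folded A_def k_def, THEN conjunct2, THEN conjunct2, THEN conjunct2, THEN conjunct1]
        x by blast+
    then have "u i x \<in> A (Suc x)" using x by blast
    then show ?thesis using h(2)[OF x] h(2)[of "u i x" "Suc x"] P(2) by simp
  qed
  ultimately show ?thesis by (rule that[of h, OF h(1)])
qed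

section \<open>The tree of conjugate tuples and the small index property\<close>

definition select :: "(nat \<Rightarrow> nat \<Rightarrow> nat) \<Rightarrow> (nat \<Rightarrow> nat \<Rightarrow> nat) \<Rightarrow> nat set \<Rightarrow> nat \<Rightarrow> nat \<Rightarrow> nat" where
  "select a b s i = (if i \<in> s then a i else b i)"

text \<open>At level \<open>n\<close> of the tree, \<open>g s\<close> conjugates the tuple selected by \<open>s\<close> to \<open>a\<close>.\<close>

definition conj_tree :: "(nat \<Rightarrow> nat) set \<Rightarrow> nat \<Rightarrow> (nat \<Rightarrow> nat \<Rightarrow> nat) \<Rightarrow> (nat \<Rightarrow> nat \<Rightarrow> nat) \<Rightarrow>
    (nat set \<Rightarrow> nat \<Rightarrow> nat) \<Rightarrow> bool" where
  "conj_tree H n a b g \<longleftrightarrow> (\<forall>i<n. a i \<in> H \<and> b i \<notin> H) \<and>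
     (\<forall>s\<subseteq>{..<n}. generic n (select a b s) \<and> g s \<in> hyp_Aut E \<and>
        (\<forall>i<n. \<forall>x. g s (select a b s i x) = a i (g s x)))"

lemma conj_treeD:
  assumes "conj_tree H n a b g" "s \<subseteq> {..<n}"
  shows "generic n (select a b s)" "g s \<in> hyp_Aut E"
    and "i < n \<Longrightarrow> g s (select a b s i x) = a i (g s x)"
proof -
  have "\<forall>s\<subseteq>{..<n}. generic n (select a b s) \<and> g s \<in> hyp_Aut E \<and>
      (\<forall>i<n. \<forall>x. g s (select a b s i x) = a i (g s x))"
    using assms(1) unfolding conj_tree_def by (elim conjE)
  note * = this[THEN spec, THEN mp, OF assms(2)]
  show "generic n (select a b s)" using * by (elim conjE)
  show "g s \<in> hyp_Aut E" using * by (elim conjE)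
  show "g s (select a b s i x) = a i (g s x)" if "i < n"
    using *[THEN conjunct2, THEN conjunct2, THEN spec, THEN mp, OF that] by (rule spec)
qed

text \<open>All tuples selected at level \<open>n\<close> are finitely many, so a single
  \<open>x\<close> in \<open>H\<close> and a single \<open>y\<close> outside \<open>H\<close> extend
  each of them generically. The conjugators are then extended by \<open>generic_conjugate\<close>
  without changing them on \<open>A\<close>.\<close>

lemma conj_tree_step:
  assumes H: "perm_subgroup E H" "small_index E H" and open_H: "\<And>A. finite A \<Longrightarrow> \<not> hyp_stab E A \<subseteq> H"
    and T: "conj_tree H n a b g" and A: "finite A"
  obtains a' b' g' A' where "conj_tree H (Suc n) a' b' g'" "finite A'" "A \<subseteq> A'" "n \<in> A'"
    "\<And>i. i < n \<Longrightarrow> a' i = a i" "\<And>i. i < n \<Longrightarrow> b' i = b i"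
    "\<And>s. s \<subseteq> {..n} \<Longrightarrow> n \<in> g' s ` A'"
    "\<And>s z. s \<subseteq> {..n} \<Longrightarrow> z \<in> A \<Longrightarrow> g' s z = g (s \<inter> {..<n}) z"
proof -
  have TG: "generic n (select a b s)" and gG: "g s \<in> hyp_Aut E"
    and Tg: "\<And>i x. i < n \<Longrightarrow> g s (select a b s i x) = a i (g s x)" if "s \<subseteq> {..<n}" for s
    using conj_treeD[OF T that] by blast+
  have Ta: "generic n a"
    by (rule generic_cong[OF TG[OF order_refl]]) (simp add: select_def)
  have "\<exists>V. finite V \<and> g s ` A \<subseteq> V \<and> (\<forall>i<n. a i ` V = V)" for s
    using generic_invariant[OF Ta finite_imageI[OF A, of "g s"]] by metis
  then obtain V where V: "\<And>s. finite (V s)" "\<And>s. g s ` A \<subseteq> V s" "\<And>s i. i < n \<Longrightarrow> a i ` V s = V s" by metis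
  \<comment> \<open>Fixing \<open>B\<close> pointwise, \<open>x\<close> and \<open>y\<close> act
    trivially on \<open>V s\<close> and on its preimage under \<open>g s\<close>. So on that
    preimage, which contains \<open>A\<close>, \<open>g s\<close> conjugates the extended tuples
    correctly, whichever of \<open>x\<close> and \<open>y\<close> is selected.\<close>
  define B where "B = (\<Union>s\<in>Pow {..<n}. V s \<union> ginv (g s) ` V s)"
  have fB: "finite B" unfolding B_def using V(1) by (intro finite_UN_I) auto
  have BV: "V s \<subseteq> B" "ginv (g s) ` V s \<subseteq> B" if "s \<subseteq> {..<n}" for s
    using that unfolding B_def by (intro order_trans[OF _ UN_upper[of s]]; simp)+
  have "\<exists>\<D>. s \<subseteq> {..<n} \<longrightarrow> countable \<D> \<and> (\<forall>D\<in>\<D>. dense_interior E D) \<and>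
      (\<forall>x\<in>hyp_Aut E. (\<forall>D\<in>\<D>. x \<in> D) \<longrightarrow> generic (Suc n) ((select a b s)(n := x)))" for s
  proof (cases "s \<subseteq> {..<n}")
    case True
    obtain \<D> where "countable \<D>" "\<And>D. D \<in> \<D> \<Longrightarrow> dense_interior E D"
      "\<And>x. x \<in> hyp_Aut E \<Longrightarrow> (\<And>D. D \<in> \<D> \<Longrightarrow> x \<in> D) \<Longrightarrow> generic (Suc n) ((select a b s)(n := x))"
      using generic_step[OF TG[OF True]] by metis
    then show ?thesis by (intro exI[of _ \<D>]) simp
  qed simp
  then obtain \<D> where \<D>: "\<And>s. s \<subseteq> {..<n} \<Longrightarrow> countable (\<D> s) \<and> (\<forall>D\<in>\<D> s. dense_interior E D) \<and>
      (\<forall>x\<in>hyp_Aut E. (\<forall>D\<in>\<D> s. x \<in> D) \<longrightarrow> generic (Suc n) ((select a b s)(n := x)))" by metis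
  define \<C> where "\<C> = (\<Union>s\<in>Pow {..<n}. \<D> s)"
  have \<C>: "countable \<C>" unfolding \<C>_def using \<D> by (intro countable_UN) (auto intro: countable_finite)
  have \<C>d: "dense_interior E D" if "D \<in> \<C>" for D using that \<D> unfolding \<C>_def by blast
  obtain x where x: "x \<in> H" "x \<in> hyp_stab E B" "\<And>D. D \<in> \<C> \<Longrightarrow> x \<in> D"
    using small_index_meets_comeager[OF edge_finite H(2) \<C> \<C>d fB] by metis
  obtain y where y: "y \<notin> H" "y \<in> hyp_stab E B" "\<And>D. D \<in> \<C> \<Longrightarrow> y \<in> D"
    using non_open_misses_comeager[OF edge_finite H(1) open_H[OF fB] \<C> \<C>d fB] by metis
  have gen: "generic (Suc n) ((select a b s)(n := z))"
    if s: "s \<subseteq> {..<n}" and z: "z \<in> hyp_stab E B" "\<And>D. D \<in> \<C> \<Longrightarrow> z \<in> D" for s z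
  proof -
    have "z \<in> hyp_Aut E" using z(1) hyp_stab_subset by blast
    moreover have "\<forall>D\<in>\<D> s. z \<in> D" using z(2) s unfolding \<C>_def by blast
    ultimately show ?thesis using \<D>[OF s] by blast
  qed
  define a' b' where "a' = a(n := x)" and "b' = b(n := y)"
  have sel: "select a' b' s i = ((select a b (s \<inter> {..<n}))(n := (if n \<in> s then x else y))) i" if "i < Suc n" for s i
    using that by (auto simp: select_def a'_def b'_def)
  have gen': "generic (Suc n) (select a' b' s)" for s
  proof (rule generic_cong[OF _ sel])
    show "generic (Suc n) ((select a b (s \<inter> {..<n}))(n := if n \<in> s then x else y))"
      using gen[OF Int_lower2 x(2,3)] gen[OF Int_lower2 y(2,3)] by simp
  qed
  have gena': "generic (Suc n) a'"
    by (rule generic_cong[OF gen'[of UNIV]]) (simp add: select_def)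
  have "\<exists>k. k \<in> hyp_Aut E \<and> (\<forall>z\<in>A. k z = g (s \<inter> {..<n}) z) \<and> (\<forall>i<Suc n. \<forall>z. k (select a' b' s i z) = a' i (k z))" for s
  proof -
    define r where "r = s \<inter> {..<n}"
    have r: "r \<subseteq> {..<n}" by (simp add: r_def)
    define Y where "Y = ginv (g r) ` V r"
    have gi: "g r (ginv (g r) v) = v" for v using ginv_right[OF gG[OF r]] .
    have fY: "finite Y" using V(1) by (simp add: Y_def)
    have fixed: "select a' b' s n v = v" if "v \<in> B" for v
      using that x(2) y(2) by (simp add: select_def a'_def b'_def hyp_stab_def)
    have gY: "g r z \<in> V r" if "z \<in> Y" for z using that gi by (auto simp: Y_def)
    have a'n: "a' n v = v" if "v \<in> B" for v
      using that x(2) by (simp add: a'_def hyp_stab_def)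
    have lt: "select a' b' s i = select a b r i" "a' i = a i" if "i < n" for i
      using that by (auto simp: select_def a'_def b'_def r_def)
    have eq: "g r (select a' b' s i z) = a' i (g r z)" if i: "i < Suc n" and z: "z \<in> Y" for i z
    proof (cases "i = n")
      case True
      have "z \<in> B" using z BV(2)[OF r] by (auto simp: Y_def)
      moreover have "g r z \<in> B" using gY[OF z] BV(1)[OF r] by blast
      ultimately show ?thesis using True fixed a'n by simp
    next
      case False
      then have "i < n" using i by simp
      then show ?thesis using lt Tg[OF r] by simp
    qed
    have inv: "select a' b' s i ` Y = Y" if i: "i < Suc n" for i
    proof (cases "i = n")
      case True
      have "select a' b' s n z = z" if "z \<in> Y" for z
        using fixed BV(2)[OF r] that unfolding Y_def by blast
      then show ?thesis using True by simp
    next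
      case False
      then have i: "i < n" using i by simp
      have "select a b r i (ginv (g r) v) = ginv (g r) (a i v)" for v
      proof -
        have "g r (select a b r i (ginv (g r) v)) = a i v" using Tg[OF r i] gi by simp
        then show ?thesis using ginv_left[OF gG[OF r]] by metis
      qed
      then have "select a b r i ` Y = ginv (g r) ` a i ` V r" unfolding Y_def image_image by simp
      then show ?thesis using lt(1)[OF i] V(3)[OF i] by (simp add: Y_def)
    qed
    obtain k where k: "k \<in> hyp_Aut E" "\<And>y. y \<in> Y \<Longrightarrow> k y = g r y"
        "\<And>i z. i < Suc n \<Longrightarrow> k (select a' b' s i z) = a' i (k z)"
      using generic_conjugate[of "Suc n" "select a' b' s" a' "g r" Y, OF gen'[of s] gena' gG[OF r] fY inv eq] by metis
    have "k z = g r z" if z: "z \<in> A" for z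
    proof -
      have "g r z \<in> V r" using V(2) z by blast
      then have "z \<in> Y" unfolding Y_def using ginv_left[OF gG[OF r], of z] by (metis imageI)
      then show ?thesis by (rule k(2))
    qed
    then show ?thesis using k(1,3) unfolding r_def by blast
  qed
  then obtain g' where g': "\<And>s. g' s \<in> hyp_Aut E" "\<And>s z. z \<in> A \<Longrightarrow> g' s z = g (s \<inter> {..<n}) z"
    "\<And>s i z. i < Suc n \<Longrightarrow> g' s (select a' b' s i z) = a' i (g' s z)" by metis
  define A' where "A' = A \<union> {n} \<union> (\<lambda>s. ginv (g' s) n) ` Pow {..n}"
  have "conj_tree H (Suc n) a' b' g'"
    unfolding conj_tree_def
  proof (intro conjI allI impI gen' g')
    fix i assume "i < Suc n"
    then have "i < n \<or> i = n" by auto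
    moreover have "a i \<in> H" "b i \<notin> H" if "i < n" using T that unfolding conj_tree_def by blast+
    ultimately show "a' i \<in> H" "b' i \<notin> H" using x(1) y(1) by (auto simp: a'_def b'_def)
  qed
  moreover have "finite A'" "A \<subseteq> A'" "n \<in> A'" using A by (auto simp: A'_def)
  moreover have "a' i = a i" "b' i = b i" if "i < n" for i using that by (auto simp: a'_def b'_def)
  moreover have "n \<in> g' s ` A'" if "s \<subseteq> {..n}" for s
  proof -
    have "ginv (g' s) n \<in> A'" using that by (simp add: A'_def)
    then show ?thesis using ginv_right[OF g'(1), of s n] by (metis imageI)
  qed
  ultimately show ?thesis using g'(2) by (rule that)
qed

theorem small_index_open:
  assumes H: "perm_subgroup E H" "small_index E H"
  obtains A where "finite A" "hyp_stab E A \<subseteq> H"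
proof (rule ccontr)
  assume "\<not> thesis"
  then have open_H: "\<not> hyp_stab E A \<subseteq> H" if "finite A" for A using that(1) \<open>\<And>A. finite A \<Longrightarrow> hyp_stab E A \<subseteq> H \<Longrightarrow> thesis\<close> by blast
  define P where "P n x \<longleftrightarrow> (case x of (a, b, g, A) \<Rightarrow> conj_tree H n a b g \<and> finite A)"
    for n :: nat and x :: "(nat \<Rightarrow> nat \<Rightarrow> nat) \<times> (nat \<Rightarrow> nat \<Rightarrow> nat) \<times> (nat set \<Rightarrow> nat \<Rightarrow> nat) \<times> nat set"
  define Q where "Q n x x' \<longleftrightarrow> (case x of (a, b, g, A) \<Rightarrow> case x' of (a', b', g', A') \<Rightarrow>
      A \<subseteq> A' \<and> n \<in> A' \<and> (\<forall>i<n. a' i = a i \<and> b' i = b i) \<and>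
      (\<forall>s\<subseteq>{..n}. n \<in> g' s ` A' \<and> (\<forall>z\<in>A. g' s z = g (s \<inter> {..<n}) z)))"
    for n :: nat and x x' :: "(nat \<Rightarrow> nat \<Rightarrow> nat) \<times> (nat \<Rightarrow> nat \<Rightarrow> nat) \<times> (nat set \<Rightarrow> nat \<Rightarrow> nat) \<times> nat set"
  have "\<exists>f. \<forall>n. P n (f n) \<and> Q n (f n) (f (Suc n))"
  proof (rule dependent_nat_choice)
    have "conj_tree H 0 (\<lambda>_. id) (\<lambda>_. id) (\<lambda>_. id)"
      by (simp add: conj_tree_def generic_0 hyp_Aut_id)
    then show "\<exists>x. P 0 x" by (intro exI[of _ "(\<lambda>_. id, \<lambda>_. id, \<lambda>_. id, {})"]) (simp add: P_def)
    fix x n assume P: "P n x"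
    obtain a b g A where x: "x = (a, b, g, A)" by (cases x)
    have T: "conj_tree H n a b g" and A: "finite A" using P by (auto simp: P_def x)
    show "\<exists>x'. P (Suc n) x' \<and> Q n x x'"
    proof (rule conj_tree_step[OF H open_H T A])
      fix a' b' g' A'
      assume *: "conj_tree H (Suc n) a' b' g'" "finite A'" "A \<subseteq> A'" "n \<in> A'"
        "\<And>i. i < n \<Longrightarrow> a' i = a i" "\<And>i. i < n \<Longrightarrow> b' i = b i"
        "\<And>s. s \<subseteq> {..n} \<Longrightarrow> n \<in> g' s ` A'"
        "\<And>s z. s \<subseteq> {..n} \<Longrightarrow> z \<in> A \<Longrightarrow> g' s z = g (s \<inter> {..<n}) z"
      have "P (Suc n) (a', b', g', A')" using *(1,2) by (simp add: P_def)
      moreover have "Q n x (a', b', g', A')" unfolding Q_def x prod.case using *(3-8) by blast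
      ultimately show "\<exists>x'. P (Suc n) x' \<and> Q n x x'" by blast
    qed
  qed
  then obtain f where fP: "\<And>n. P n (f n)" and fQ: "\<And>n. Q n (f n) (f (Suc n))" by blast
  define a b g A where "a n = fst (f n)" and "b n = fst (snd (f n))"
    and "g n = fst (snd (snd (f n)))" and "A n = snd (snd (snd (f n)))" for n
  have T: "conj_tree H n (a n) (b n) (g n)" for n
    using fP[of n] by (simp add: P_def a_def b_def g_def split: prod.splits)
  have A: "A n \<subseteq> A (Suc n)" "n \<in> A (Suc n)"
    and ab: "\<And>i. i < n \<Longrightarrow> a (Suc n) i = a n i" "\<And>i. i < n \<Longrightarrow> b (Suc n) i = b n i"
    and gA: "\<And>s. s \<subseteq> {..n} \<Longrightarrow> n \<in> g (Suc n) s ` A (Suc n)"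
    and gg: "\<And>s z. s \<subseteq> {..n} \<Longrightarrow> z \<in> A n \<Longrightarrow> g (Suc n) s z = g n (s \<inter> {..<n}) z" for n
    using fQ[of n] by (simp_all add: Q_def a_def b_def g_def A_def split: prod.splits)
  have abm: "a m i = a n i \<and> b m i = b n i" if "n \<le> m" "i < n" for n m i
    using that(1)
  proof (induction m rule: dec_induct)
    case (step m)
    then show ?case using ab[of i m] that(2) by simp
  qed simp
  define a0 b0 where "a0 i = a (Suc i) i" and "b0 i = b (Suc i) i" for i
  have ab0: "a n i = a0 i" "b n i = b0 i" if "i < n" for n i
    using abm[of "Suc i" n i] that by (simp_all add: a0_def b0_def)
  have a0H: "a0 i \<in> H" and b0H: "b0 i \<notin> H" for i
    using T[of "Suc i"] by (auto simp: conj_tree_def a0_def b0_def)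
  define gs where "gs s n = g n (s \<inter> {..<n})" for s n
  have gsG: "gs s n \<in> hyp_Aut E" for s n unfolding gs_def using conj_treeD(2)[OF T] by simp
  have sub: "s \<inter> {..<Suc n} \<subseteq> {..n}" for s :: "nat set" and n by auto
  have int: "s \<inter> {..<Suc n} \<inter> {..<n} = s \<inter> {..<n}" for s :: "nat set" and n by auto
  have gsA: "n \<in> gs s (Suc n) ` A (Suc n)" for s n unfolding gs_def by (rule gA[OF sub])
  have gsstep: "gs s (Suc n) x = gs s n x" if "x \<in> A n" for s n x
    unfolding gs_def using gg[OF sub[of s n] that] unfolding int .
  have gsconj: "gs s n (select a0 b0 s i x) = a0 i (gs s n x)" if "i < n" for s n i x
  proof -
    have "select (a n) (b n) (s \<inter> {..<n}) i = select a0 b0 s i"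
      using ab0 that by (simp add: select_def)
    then show ?thesis using conj_treeD(3)[OF T[of n], of "s \<inter> {..<n}" i x] that ab0(1)[OF that]
      by (simp add: gs_def)
  qed
  have "\<exists>h. h \<in> hyp_Aut E \<and> (\<forall>n. \<forall>x\<in>A n. h x = gs s n x)" for s
    using hyp_Aut_limit[of E "gs s" A, OF edge_finite gsG A gsA[of _ s] gsstep[of _ _ s]] by metis
  then obtain c where c: "\<And>s. c s \<in> hyp_Aut E" "\<And>s n x. x \<in> A n \<Longrightarrow> c s x = gs s n x" by metis
  have cconj: "c s (select a0 b0 s i x) = a0 i (c s x)" for s i x
  proof -
    define y where "y = select a0 b0 s i x"
    define n where "n = Suc (max i (max x y))"
    have mono: "A j \<subseteq> A m" if "j \<le> m" for j m using lift_Suc_mono_le[of A, OF A(1) that] .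
    have "Suc x \<le> n" "Suc y \<le> n" by (auto simp: n_def)
    then have "x \<in> A n" "y \<in> A n" using A(2)[of x] A(2)[of y] mono by blast+
    moreover have "i < n" by (simp add: n_def)
    ultimately show ?thesis using c(2) gsconj[of i n s x] unfolding y_def by simp
  qed
  have "ginv (c s) \<circ> c t \<notin> H" if "s \<noteq> t" for s t
  proof
    assume h: "ginv (c s) \<circ> c t \<in> H"
    define k where "k = ginv (c s) \<circ> c t"
    have kG: "k \<in> hyp_Aut E" unfolding k_def by (intro hyp_Aut_comp hyp_Aut_ginv c)
    have kH: "k \<in> H" "ginv k \<in> H" using h H(1) unfolding perm_subgroup_def k_def by blast+
    have comp: "u \<circ> v \<in> H" if "u \<in> H" "v \<in> H" for u v using H(1) that unfolding perm_subgroup_def by blast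
    have kc: "k (select a0 b0 t i x) = select a0 b0 s i (k x)" for i x
    proof -
      have "c s (select a0 b0 s i (k x)) = a0 i (c t x)"
        unfolding cconj k_def by (simp add: ginv_right[OF c(1)])
      also have "\<dots> = c s (k (select a0 b0 t i x))" unfolding k_def by (simp add: ginv_right[OF c(1)] cconj)
      finally show ?thesis using hyp_Aut_eq_iff[OF c(1)] by metis
    qed
    have k1: "select a0 b0 s i = k \<circ> select a0 b0 t i \<circ> ginv k" for i
      using kc ginv_right[OF kG] by (simp add: fun_eq_iff)
    have k2: "select a0 b0 t i = ginv k \<circ> select a0 b0 s i \<circ> k" for i
      using kc[symmetric] ginv_left[OF kG] by (simp add: fun_eq_iff)
    \<comment> \<open>Conjugation by \<open>k\<close> in \<open>H\<close> preserves membership in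
      \<open>H\<close>, but at an \<open>i\<close> lying in exactly one of \<open>s\<close> and
      \<open>t\<close> one tuple has an entry in \<open>H\<close> and the other does not.\<close>
    have iff: "select a0 b0 s i \<in> H \<longleftrightarrow> select a0 b0 t i \<in> H" for i
      using comp kH k1[of i] k2[of i] by metis
    have "select a0 b0 u i \<in> H \<longleftrightarrow> i \<in> u" for u i using a0H b0H by (simp add: select_def)
    then show False using iff \<open>s \<noteq> t\<close> by blast
  qed
  then show False using H(2) c(1) unfolding small_index_def by metis
qed

end

section \<open>The strong small index property\<close>

lemma perm_subgroupD:
  assumes "perm_subgroup E H"
  shows "H \<subseteq> hyp_Aut E" "id \<in> H" "g \<in> H \<Longrightarrow> h \<in> H \<Longrightarrow> g \<circ> h \<in> H" "g \<in> H \<Longrightarrow> ginv g \<in> H"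
  using assms unfolding perm_subgroup_def by blast+

lemma perm_subgroup_stab: "perm_subgroup E (hyp_stab E A)"
  unfolding perm_subgroup_def
  by (intro conjI ballI hyp_stab_subset hyp_stab_id hyp_stab_comp hyp_stab_ginv)

lemma hyp_stab_conj:
  assumes "g \<in> hyp_Aut E" "x \<in> hyp_stab E (g ` A)"
  shows "ginv g \<circ> x \<circ> g \<in> hyp_stab E A"
proof -
  have x: "x \<in> hyp_Aut E" "\<And>a. a \<in> A \<Longrightarrow> x (g a) = g a" using assms(2) by (auto simp: hyp_stab_def)
  have "(ginv g \<circ> x \<circ> g) a = a" if "a \<in> A" for a using x(2)[OF that] ginv_left[OF assms(1)] by simp
  then show ?thesis
    using hyp_Aut_comp[OF hyp_Aut_comp[OF hyp_Aut_ginv[OF assms(1)] x(1)] assms(1)] by (simp add: hyp_stab_def)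
qed

lemma hyp_stab_image_subset:
  assumes H: "perm_subgroup E H" and h: "h \<in> H" and A: "hyp_stab E A \<subseteq> H"
  shows "hyp_stab E (h ` A) \<subseteq> H"
proof
  fix x assume x: "x \<in> hyp_stab E (h ` A)"
  note S = perm_subgroupD[OF H]
  have hG: "h \<in> hyp_Aut E" using S(1) h by blast
  have "ginv h \<circ> x \<circ> h \<in> H" using hyp_stab_conj[OF hG x] A by blast
  then have "h \<circ> (ginv h \<circ> x \<circ> h) \<circ> ginv h \<in> H" using S(3,4) h by blast
  moreover have "h \<circ> (ginv h \<circ> x \<circ> h) \<circ> ginv h = x" using ginv_right[OF hG] by (simp add: fun_eq_iff)
  ultimately show "x \<in> H" by simp
qed

lemma free_over_subset_right:
  assumes "free_over E P Q" "Q' \<subseteq> Q" "P \<inter> Q \<subseteq> Q'"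
  shows "free_over E P Q'"
  unfolding free_over_def
proof (intro ballI impI)
  fix e assume e: "e \<in> E" "e \<subseteq> P \<union> Q'"
  then have "e \<subseteq> P \<or> e \<subseteq> Q" using assms(1,2) unfolding free_over_def by blast
  then show "e \<subseteq> P \<or> e \<subseteq> Q'" using e(2) assms(3) by blast
qed

lemma free_over_sym: "free_over E P Q \<longleftrightarrow> free_over E Q P"
  unfolding free_over_def by (simp add: Un_commute disj_commute)

context homogeneous_hypergraph begin

text \<open>Free amalgamation of \<open>insert b A\<close> and \<open>A \<union> F\<close> over
  \<open>A\<close> moves \<open>b\<close> off \<open>F\<close>. So points outside \<open>A\<close>
  have infinite orbits over \<open>A\<close>.\<close>

lemma no_algebraicity:
  assumes "finite A" "finite F" "b \<notin> A"
  obtains t where "t \<in> hyp_stab E A" "t b \<notin> F"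
proof -
  have "finite (insert b A)" "finite (A \<union> F)" "A \<subseteq> insert b A" "A \<subseteq> A \<union> F" using assms by auto
  then obtain t where t: "t \<in> hyp_stab E A" "t ` insert b A \<inter> (A \<union> F) = A"
    by (rule free_amalgam)
  have tG: "t \<in> hyp_Aut E" using t(1) hyp_stab_subset by blast
  have "t b \<notin> F"
  proof
    assume "t b \<in> F"
    then have tb: "t b \<in> A" using t(2) by blast
    then have "t (t b) = t b" using t(1) by (simp add: hyp_stab_def)
    then show False using hyp_Aut_eq_iff[OF tG] tb assms(3) by metis
  qed
  then show ?thesis using that t(1) by blast
qed

text \<open>No point outside \<open>A\<close> is fixed by the stabilizer of \<open>A\<close>; in
  particular a finite set can be recovered from its pointwise stabilizer.\<close>

lemma hyp_stab_subset_iff: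
  assumes "finite A"
  shows "hyp_stab E A \<subseteq> hyp_stab E B \<longleftrightarrow> B \<subseteq> A"
proof
  assume sub: "hyp_stab E A \<subseteq> hyp_stab E B"
  show "B \<subseteq> A"
  proof (rule subsetI, rule ccontr)
    fix b assume b: "b \<in> B" "b \<notin> A"
    obtain t where t: "t \<in> hyp_stab E A" "t b \<notin> {b}"
      by (rule no_algebraicity[OF assms _ b(2), of "{b}"]) simp_all
    then have "t \<in> hyp_stab E B" using sub by blast
    then show False using t(2) b(1) by (simp add: hyp_stab_def)
  qed
qed (rule hyp_stab_antimono)

text \<open>Moving \<open>A\<close> over \<open>B\<close> gives a copy \<open>A1\<close> of \<open>A\<close> that is free from \<open>A\<close> over \<open>A \<inter> B\<close>. Some copy \<open>D\<close> is free
  from both \<open>A\<close> and \<open>g ` A\<close>; the stabilizer of \<open>A\<close> moves \<open>A1\<close> to \<open>D\<close>, and that of \<open>D\<close> moves \<open>A\<close> to \<open>g ` A\<close>.\<close>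

lemma hyp_stab_Int:
  assumes H: "perm_subgroup E H" and fin: "finite A" "finite B"
    and AH: "hyp_stab E A \<subseteq> H" and BH: "hyp_stab E B \<subseteq> H"
  shows "hyp_stab E (A \<inter> B) \<subseteq> H"
proof
  fix g assume g: "g \<in> hyp_stab E (A \<inter> B)"
  define C where "C = A \<inter> B"
  note S = perm_subgroupD[OF H]
  have gG: "g \<in> hyp_Aut E" and gC: "\<And>x. x \<in> C \<Longrightarrow> g x = x" using g by (auto simp: hyp_stab_def C_def)
  have "finite (A \<union> B)" "B \<subseteq> A \<union> B" using fin by auto
  then obtain l where l: "l \<in> hyp_stab E B" "l ` (A \<union> B) \<inter> (A \<union> B) = B" "free_over E (l ` (A \<union> B)) (A \<union> B)"
    using free_amalgam by metis
  have lG: "l \<in> hyp_Aut E" and lB: "\<And>x. x \<in> B \<Longrightarrow> l x = x" using l(1) by (auto simp: hyp_stab_def)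
  have lH: "l \<in> H" using l(1) BH by blast
  define A1 where "A1 = l ` A"
  have lA: "a \<in> C \<and> l a = a" if a: "a \<in> A" "l a \<in> A \<union> B" for a
  proof -
    have "l a \<in> B" using a l(2) by blast
    then have "l (l a) = l a" by (rule lB)
    then have "l a = a" using hyp_Aut_eq_iff[OF lG] by metis
    then show ?thesis using \<open>l a \<in> B\<close> a(1) by (simp add: C_def)
  qed
  have CA1: "C \<subseteq> A1" unfolding A1_def C_def using lB by force
  have A1A: "A1 \<inter> A \<subseteq> C" using lA unfolding A1_def by fastforce
  have freeA1: "free_over E A A1"
    unfolding free_over_def
  proof (intro ballI impI)
    fix e assume e: "e \<in> E" "e \<subseteq> A \<union> A1"
    have "e \<subseteq> l ` (A \<union> B) \<union> (A \<union> B)" using e(2) unfolding A1_def by blast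
    then consider "e \<subseteq> l ` (A \<union> B)" | "e \<subseteq> A \<union> B" using l(3) e(1) unfolding free_over_def by blast
    then show "e \<subseteq> A \<or> e \<subseteq> A1"
    proof cases
      case 1
      have "x \<in> A1" if x: "x \<in> e" "x \<in> A" for x
      proof -
        have "x \<in> B" using 1 x l(2) by blast
        then show ?thesis using x CA1 C_def by blast
      qed
      then show ?thesis using e(2) by blast
    next
      case 2
      have "x \<in> A" if x: "x \<in> e" "x \<in> A1" for x
      proof -
        obtain a where a: "a \<in> A" "x = l a" using x(2) A1_def by blast
        then show ?thesis using lA[of a] 2 x(1) by auto
      qed
      then show ?thesis using e(2) by blast
    qed
  qed
  have A1H: "hyp_stab E A1 \<subseteq> H" unfolding A1_def by (rule hyp_stab_image_subset[OF H lH AH])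
  have "finite (A \<union> g ` A)" "C \<subseteq> A" "C \<subseteq> A \<union> g ` A" using fin by (auto simp: C_def)
  then obtain d where d: "d \<in> hyp_stab E C" "d ` A \<inter> (A \<union> g ` A) = C" "free_over E (d ` A) (A \<union> g ` A)"
    using free_amalgam[OF fin(1)] by metis
  have dG: "d \<in> hyp_Aut E" and dC: "\<And>x. x \<in> C \<Longrightarrow> d x = x" using d(1) by (auto simp: hyp_stab_def)
  define D where "D = d ` A"
  have CgA: "C \<subseteq> g ` A" using gC C_def by force
  have freeDA: "free_over E D A"
    by (rule free_over_subset_right[OF d(3)[folded D_def]]) (use d(2) C_def D_def in auto)
  have freeDg: "free_over E D (g ` A)"
    by (rule free_over_subset_right[OF d(3)[folded D_def]]) (use d(2) CgA D_def in auto)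
  have DA: "D \<inter> A \<subseteq> C" "D \<inter> g ` A \<subseteq> C" using d(2) D_def by auto
  have CD: "C \<subseteq> D" using dC \<open>C \<subseteq> A\<close> unfolding D_def by force
  define q where "q = d \<circ> ginv l"
  have qG: "q \<in> hyp_Aut E" unfolding q_def using hyp_Aut_comp[OF dG hyp_Aut_ginv[OF lG]] .
  have ql: "q (l a) = d a" for a by (simp add: q_def ginv_left[OF lG])
  have qA1: "q ` A1 = D" unfolding A1_def D_def image_image ql ..
  have qC: "q x = x" if x: "x \<in> C" for x
  proof -
    have "q (l x) = x" using ql dC[OF x] by simp
    then show ?thesis using lB[of x] x by (simp add: C_def)
  qed
  \<comment> \<open>As \<open>l\<close> is in \<open>H\<close>, the stabilizer of \<open>A1\<close>
    lies in \<open>H\<close>. Fixing \<open>A\<close> pointwise, \<open>u\<close> is in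
    \<open>H\<close> as well, so the stabilizer of \<open>D\<close>, the image of \<open>A1\<close>
    under \<open>u\<close>, lies in \<open>H\<close> too.\<close>
  obtain u where u: "u \<in> hyp_Aut E" "\<And>x. x \<in> A \<Longrightarrow> u x = id x" "\<And>x. x \<in> A1 \<Longrightarrow> u x = q x"
  proof (rule glue[of A A1 id q])
    fix r assume r: "r \<in> hyp_Aut E" "\<And>x. x \<in> A \<Longrightarrow> r x = id x" "\<And>x. x \<in> A1 \<Longrightarrow> r x = q x"
    show thesis by (rule that[of r]) (blast intro: r)+
  next
    show "finite A" "finite A1" "id \<in> hyp_Aut E" "q \<in> hyp_Aut E" "free_over E A A1"
      using fin qG freeA1 by (auto simp: A1_def hyp_Aut_id)
    show "id x = q x" if "x \<in> A" "x \<in> A1" for x using qC[of x] A1A that by auto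
    show "id ` A \<inter> q ` A1 \<subseteq> id ` (A \<inter> A1)" unfolding qA1 using DA(1) CA1 \<open>C \<subseteq> A\<close> by auto
    show "free_over E (id ` A) (q ` A1)" unfolding qA1 using freeDA free_over_sym[of E A D] by simp
  qed
  have uH: "u \<in> H" using u(1,2) AH by (auto simp: hyp_stab_def)
  have "u ` A1 = D" using u(3) qA1 by (metis image_cong)
  then have DH: "hyp_stab E D \<subseteq> H" using hyp_stab_image_subset[OF H uH A1H] by simp
  obtain v where v: "v \<in> hyp_Aut E" "\<And>x. x \<in> D \<Longrightarrow> v x = id x" "\<And>x. x \<in> A \<Longrightarrow> v x = g x"
  proof (rule glue[of D A id g])
    fix r assume r: "r \<in> hyp_Aut E" "\<And>x. x \<in> D \<Longrightarrow> r x = id x" "\<And>x. x \<in> A \<Longrightarrow> r x = g x"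
    show thesis by (rule that[of r]) (blast intro: r)+
  next
    show "finite D" "finite A" "id \<in> hyp_Aut E" "g \<in> hyp_Aut E" "free_over E D A"
      using fin gG freeDA by (auto simp: D_def hyp_Aut_id)
    show "id x = g x" if "x \<in> D" "x \<in> A" for x using gC[of x] DA(1) that by auto
    show "id ` D \<inter> g ` A \<subseteq> id ` (D \<inter> A)" using DA(2) CD \<open>C \<subseteq> A\<close> by auto
    show "free_over E (id ` D) (g ` A)" using freeDg by simp
  qed
  have vH: "v \<in> H" using v(1,2) DH by (auto simp: hyp_stab_def)
  have "ginv v \<circ> g \<in> hyp_stab E A"
  proof -
    have "ginv v (g a) = a" if "a \<in> A" for a using v(3)[OF that] ginv_left[OF v(1), of a] by simp
    then show ?thesis using hyp_Aut_comp[OF hyp_Aut_ginv[OF v(1)] gG] by (simp add: hyp_stab_def)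
  qed
  then have "v \<circ> (ginv v \<circ> g) \<in> H" using S(3) vH AH by blast
  moreover have "v \<circ> (ginv v \<circ> g) = g" using ginv_right[OF v(1)] by (simp add: fun_eq_iff)
  ultimately show "g \<in> H" by simp
qed

theorem strong_small_index:
  assumes H: "perm_subgroup E H" "small_index E H"
  obtains A where "finite A" "hyp_stab E A \<subseteq> H" "H \<subseteq> hyp_setstab E A"
proof -
  obtain A0 where "finite A0" "hyp_stab E A0 \<subseteq> H" using small_index_open[OF H] .
  then have "\<exists>A. (finite A \<and> hyp_stab E A \<subseteq> H) \<and>
      (\<forall>B. (finite B \<and> hyp_stab E B \<subseteq> H) \<longrightarrow> card A \<le> card B)"
    using ex_has_least_nat[of "\<lambda>A. finite A \<and> hyp_stab E A \<subseteq> H" A0 card] by blast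
  then obtain A where A: "finite A" "hyp_stab E A \<subseteq> H"
      and min: "\<And>B. finite B \<Longrightarrow> hyp_stab E B \<subseteq> H \<Longrightarrow> card A \<le> card B" by blast
  have "h ` A = A" if h: "h \<in> H" for h
  proof -
    have hG: "h \<in> hyp_Aut E" using perm_subgroupD(1)[OF H(1)] h by blast
    have "hyp_stab E (A \<inter> h ` A) \<subseteq> H"
      using hyp_stab_Int[OF H(1) A(1) finite_imageI[OF A(1)] A(2) hyp_stab_image_subset[OF H(1) h A(2)]] .
    then have "card A \<le> card (A \<inter> h ` A)" using min A(1) by blast
    then have "A \<inter> h ` A = A" using A(1) by (intro card_seteq) auto
    moreover have "card (h ` A) = card A" using card_image[OF hyp_Aut_inj_on[OF hG]] .
    ultimately have "A = h ` A" using A(1) by (intro card_subset_eq finite_imageI) auto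
    then show ?thesis by simp
  qed
  then have "H \<subseteq> hyp_setstab E A" using perm_subgroupD(1)[OF H(1)] by (auto simp: hyp_setstab_def)
  then show ?thesis using that A by blast
qed

end

section \<open>Group-theoretic recognition of the stabilizers of finite sets\<close>

definition finite_index_in :: "('a \<Rightarrow> 'a) set \<Rightarrow> ('a \<Rightarrow> 'a) set \<Rightarrow> bool" where
  "finite_index_in K H \<longleftrightarrow> (\<exists>R. finite R \<and> R \<subseteq> H \<and> (\<forall>h\<in>H. \<exists>r\<in>R. ginv r \<circ> h \<in> K))"

text \<open>These turn out to be the pointwise stabilizers of the finite sets.\<close>

definition connected_small :: "'a set set \<Rightarrow> ('a \<Rightarrow> 'a) set \<Rightarrow> bool" where
  "connected_small E H \<longleftrightarrow> perm_subgroup E H \<and> small_index E H \<and>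
     (\<forall>K. perm_subgroup E K \<longrightarrow> K \<subseteq> H \<longrightarrow> finite_index_in K H \<longrightarrow> K = H)"

lemma no_inj_nat_set: "\<not> inj (f :: nat set \<Rightarrow> 'c::countable)"
proof
  assume f: "inj f"
  have "inj (to_nat \<circ> f)" using f inj_compose inj_to_nat by blast
  then have "range (inv_into UNIV (to_nat \<circ> f)) = Pow UNIV"
    using inj_imp_surj_inv by auto
  then show False using Cantors_theorem by blast
qed

lemma small_indexI:
  fixes f :: "('a \<Rightarrow> 'a) \<Rightarrow> 'c::countable"
  assumes "\<And>g h. g \<in> hyp_Aut E \<Longrightarrow> h \<in> hyp_Aut E \<Longrightarrow> f g = f h \<Longrightarrow> ginv g \<circ> h \<in> K"
  shows "small_index E K"
  unfolding small_index_def
proof (intro allI impI)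
  fix c :: "nat set \<Rightarrow> 'a \<Rightarrow> 'a" assume c: "\<forall>s. c s \<in> hyp_Aut E"
  have "\<not> inj (\<lambda>s. f (c s))" by (rule no_inj_nat_set)
  then obtain s t where "s \<noteq> t" "f (c s) = f (c t)" unfolding inj_def by blast
  then show "\<exists>s t. s \<noteq> t \<and> ginv (c s) \<circ> c t \<in> K" using assms c by blast
qed

text \<open>The left coset of \<open>g\<close> modulo \<open>K\<close> is determined by the values
  of \<open>g\<close> on a list of \<open>A\<close>, together with the coset, among finitely many,
  of the quotient of \<open>g\<close> by a chosen automorphism with the same values. This leaves
  countably many cosets.\<close>

lemma small_index_finite_index_stab:
  fixes E :: "nat set set"
  assumes K: "perm_subgroup E K" and A: "finite A" and fi: "finite_index_in K (hyp_stab E A)"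
  shows "small_index E K"
proof -
  obtain as where as: "A = set as" using finite_list[OF A] by metis
  obtain R where R: "finite R" "R \<subseteq> hyp_stab E A" "\<And>h. h \<in> hyp_stab E A \<Longrightarrow> \<exists>r\<in>R. ginv r \<circ> h \<in> K"
    using fi unfolding finite_index_in_def by blast
  obtain idx :: "(nat \<Rightarrow> nat) \<Rightarrow> nat" where idx: "inj_on idx R"
    using finite_imp_inj_to_nat_seg[OF R(1)] by blast
  define rep where "rep l = (SOME g. g \<in> hyp_Aut E \<and> map g as = l)" for l
  have rep: "rep (map g as) \<in> hyp_Aut E" "map (rep (map g as)) as = map g as" if "g \<in> hyp_Aut E" for g
    using someI[of "\<lambda>g'. g' \<in> hyp_Aut E \<and> map g' as = map g as" g] that unfolding rep_def by auto
  have "\<exists>r\<in>R. ginv r \<circ> (ginv (rep (map g as)) \<circ> g) \<in> K" if g: "g \<in> hyp_Aut E" for g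
  proof (rule R(3))
    have "ginv (rep (map g as)) (g a) = a" if "a \<in> A" for a
      using ginv_left[OF rep(1)[OF g], of a] rep(2)[OF g] that by (simp add: as)
    then show "ginv (rep (map g as)) \<circ> g \<in> hyp_stab E A"
      using hyp_Aut_comp[OF hyp_Aut_ginv[OF rep(1)[OF g]] g] by (simp add: hyp_stab_def)
  qed
  then obtain r where r: "\<And>g. g \<in> hyp_Aut E \<Longrightarrow> r g \<in> R"
    "\<And>g. g \<in> hyp_Aut E \<Longrightarrow> ginv (r g) \<circ> (ginv (rep (map g as)) \<circ> g) \<in> K" by metis
  show ?thesis
  proof (rule small_indexI[of E "\<lambda>g. (map g as, idx (r g))"])
    fix g h assume gh: "g \<in> hyp_Aut E" "h \<in> hyp_Aut E" "(map g as, idx (r g)) = (map h as, idx (r h))"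
    then have m: "map h as = map g as" and rr: "r h = r g" using idx r(1) by (auto dest: inj_onD)
    define x where "x = rep (map g as)"
    have xG: "x \<in> hyp_Aut E" unfolding x_def by (rule rep(1)[OF gh(1)])
    have rG: "r g \<in> hyp_Aut E" using r(1)[OF gh(1)] R(2) hyp_stab_subset by blast
    define k where "k = ginv (r g) \<circ> (ginv x \<circ> g)"
    have k: "k \<in> K" unfolding k_def x_def by (rule r(2)[OF gh(1)])
    have k': "ginv (r g) \<circ> (ginv x \<circ> h) \<in> K" using r(2)[OF gh(2)] unfolding m rr x_def .
    have kG: "k \<in> hyp_Aut E" using k perm_subgroupD(1)[OF K] by blast
    have "ginv k \<circ> (ginv (r g) \<circ> (ginv x \<circ> h)) \<in> K"
      by (rule perm_subgroupD(3)[OF K perm_subgroupD(4)[OF K k] k'])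
    moreover have "ginv k \<circ> (ginv (r g) \<circ> (ginv x \<circ> h)) = ginv g \<circ> h"
    proof
      fix z
      have "k (ginv g (h z)) = ginv (r g) (ginv x (h z))" by (simp add: k_def ginv_right[OF gh(1)])
      then have "ginv k (ginv (r g) (ginv x (h z))) = ginv g (h z)" using ginv_left[OF kG] by metis
      then show "(ginv k \<circ> (ginv (r g) \<circ> (ginv x \<circ> h))) z = (ginv g \<circ> h) z" by simp
    qed
    ultimately show "ginv g \<circ> h \<in> K" by simp
  qed
qed

lemma finite_index_in_refl: "perm_subgroup E H \<Longrightarrow> finite_index_in H H"
  unfolding finite_index_in_def by (intro exI[of _ "{id}"]) (simp add: perm_subgroup_def)

text \<open>If \<open>H\<close> lies between the pointwise and the setwise stabilizer of a finite
  \<open>A\<close>, then the former has finite index in \<open>H\<close>, as \<open>H\<close>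
  permutes the finite set \<open>A\<close>. Conversely, let \<open>K\<close> have finite index in
  the stabilizer of \<open>A\<close> and contain the stabilizer of a finite \<open>B\<close> that it
  preserves. A point of \<open>B\<close> outside \<open>A\<close> could be moved over
  \<open>A\<close> off the finitely many sets r(B), with r from coset representatives; so
  \<open>B \<subseteq> A\<close>.\<close>

lemma (in homogeneous_hypergraph) connected_small_iff:
  "connected_small E H \<longleftrightarrow> (\<exists>A. finite A \<and> H = hyp_stab E A)"
proof
  assume H: "connected_small E H"
  then have sub: "perm_subgroup E H" and small: "small_index E H"
    and conn: "\<And>K. perm_subgroup E K \<Longrightarrow> K \<subseteq> H \<Longrightarrow> finite_index_in K H \<Longrightarrow> K = H"
    by (auto simp: connected_small_def)
  obtain A where A: "finite A" "hyp_stab E A \<subseteq> H" "H \<subseteq> hyp_setstab E A"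
    using strong_small_index[OF sub small] .
  have "finite_index_in (hyp_stab E A) H"
  proof -
    obtain as where as: "A = set as" using finite_list[OF A(1)] by metis
    define L where "L = (\<lambda>h. map h as) ` H"
    have "L \<subseteq> {l. set l \<subseteq> A \<and> length l = length as}"
      using A(3) by (auto simp: L_def hyp_setstab_def as)
    then have fL: "finite L" using finite_lists_length_eq[OF A(1)] finite_subset by blast
    have "\<exists>h. h \<in> H \<and> map h as = l" if "l \<in> L" for l using that by (auto simp: L_def)
    then obtain rep where rep: "\<And>l. l \<in> L \<Longrightarrow> rep l \<in> H" "\<And>l. l \<in> L \<Longrightarrow> map (rep l) as = l" by metis
    have "\<exists>r\<in>rep ` L. ginv r \<circ> h \<in> hyp_stab E A" if h: "h \<in> H" for h
    proof (rule bexI)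
      define r where "r = rep (map h as)"
      have l: "map h as \<in> L" unfolding L_def using h by (rule imageI)
      then show "r \<in> rep ` L" by (simp add: r_def)
      have rG: "r \<in> hyp_Aut E" and hG: "h \<in> hyp_Aut E"
        using rep(1)[OF l] h perm_subgroupD(1)[OF sub] by (auto simp: r_def)
      have "map r as = map h as" using rep(2)[OF l] by (simp add: r_def)
      then have "ginv r (h a) = a" if "a \<in> A" for a
        using ginv_left[OF rG, of a] that by (simp add: as)
      then show "ginv r \<circ> h \<in> hyp_stab E A"
        using hyp_Aut_comp[OF hyp_Aut_ginv[OF rG] hG] by (simp add: hyp_stab_def)
    qed
    then show ?thesis unfolding finite_index_in_def using fL rep(1) by (intro exI[of _ "rep ` L"]) auto
  qed
  then show "\<exists>A. finite A \<and> H = hyp_stab E A" using conn[OF perm_subgroup_stab A(2)] A(1) by blast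
next
  assume "\<exists>A. finite A \<and> H = hyp_stab E A"
  then obtain A where A: "finite A" "H = hyp_stab E A" by blast
  show "connected_small E H"
    unfolding connected_small_def A(2)
  proof (intro conjI allI impI perm_subgroup_stab)
    show "small_index E (hyp_stab E A)"
      by (rule small_index_finite_index_stab[OF perm_subgroup_stab A(1) finite_index_in_refl[OF perm_subgroup_stab]])
    fix K assume K: "perm_subgroup E K" "K \<subseteq> hyp_stab E A" "finite_index_in K (hyp_stab E A)"
    obtain B where B: "finite B" "hyp_stab E B \<subseteq> K" "K \<subseteq> hyp_setstab E B"
      using strong_small_index[OF K(1) small_index_finite_index_stab[OF K(1) A(1) K(3)]] .
    have "B \<subseteq> A"
    proof (rule subsetI, rule ccontr)
      fix b assume b: "b \<in> B" "b \<notin> A"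
      obtain R where R: "finite R" "R \<subseteq> hyp_stab E A" "\<And>h. h \<in> hyp_stab E A \<Longrightarrow> \<exists>r\<in>R. ginv r \<circ> h \<in> K"
        using K(3) unfolding finite_index_in_def by blast
      have "finite (\<Union>r\<in>R. r ` B)" using R(1) B(1) by simp
      then obtain t where t: "t \<in> hyp_stab E A" "t b \<notin> (\<Union>r\<in>R. r ` B)"
        using no_algebraicity[OF A(1) _ b(2)] by metis
      obtain r where r: "r \<in> R" "ginv r \<circ> t \<in> K" using R(3)[OF t(1)] by blast
      have rG: "r \<in> hyp_Aut E" using r(1) R(2) hyp_stab_subset by blast
      have "ginv r \<circ> t \<in> hyp_setstab E B" using r(2) B(3) by blast
      then have "(ginv r \<circ> t) ` B = B" unfolding hyp_setstab_def by (elim CollectE conjE)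
      then have "ginv r (t b) \<in> B" using b(1) by (metis comp_apply imageI)
      then have "t b \<in> r ` B" using ginv_right[OF rG, of "t b"] by (metis imageI)
      then show False using t(2) r(1) by blast
    qed
    then show "K = hyp_stab E A" using hyp_stab_antimono[of B A E] B(2) K(2) by blast
  qed
qed

section \<open>Isomorphisms of automorphism groups\<close>

locale aut_iso =
  fixes E E' :: "nat set set" and \<phi> :: "(nat \<Rightarrow> nat) \<Rightarrow> (nat \<Rightarrow> nat)"
  assumes bij: "bij_betw \<phi> (hyp_Aut E) (hyp_Aut E')"
    and hom: "g \<in> hyp_Aut E \<Longrightarrow> h \<in> hyp_Aut E \<Longrightarrow> \<phi> (g \<circ> h) = \<phi> g \<circ> \<phi> h"
begin

abbreviation "\<psi> \<equiv> inv_into (hyp_Aut E) \<phi>"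

lemma img: "g \<in> hyp_Aut E \<Longrightarrow> \<phi> g \<in> hyp_Aut E'"
  using bij_betwE[OF bij] by blast

lemma image_full: "\<phi> ` hyp_Aut E = hyp_Aut E'"
  using bij_betw_imp_surj_on[OF bij] .

lemma \<psi>_img: "g \<in> hyp_Aut E' \<Longrightarrow> \<psi> g \<in> hyp_Aut E"
  using bij_betwE[OF bij_betw_inv_into[OF bij]] by blast

lemma \<psi>_\<phi>: "g \<in> hyp_Aut E \<Longrightarrow> \<psi> (\<phi> g) = g"
  by (rule bij_betw_inv_into_left[OF bij])

lemma \<phi>_\<psi>: "g \<in> hyp_Aut E' \<Longrightarrow> \<phi> (\<psi> g) = g"
  by (rule bij_betw_inv_into_right[OF bij])

lemma sym: "aut_iso E' E \<psi>"
proof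
  show "bij_betw \<psi> (hyp_Aut E') (hyp_Aut E)" by (rule bij_betw_inv_into[OF bij])
  fix g h assume gh: "g \<in> hyp_Aut E'" "h \<in> hyp_Aut E'"
  have "\<phi> (\<psi> g \<circ> \<psi> h) = g \<circ> h" using hom[OF \<psi>_img[OF gh(1)] \<psi>_img[OF gh(2)]] \<phi>_\<psi> gh by simp
  then show "\<psi> (g \<circ> h) = \<psi> g \<circ> \<psi> h"
    using \<psi>_\<phi>[OF hyp_Aut_comp[OF \<psi>_img[OF gh(1)] \<psi>_img[OF gh(2)]]] by simp
qed

lemma map_id: "\<phi> id = id"
proof -
  have "\<phi> id \<circ> \<phi> id = \<phi> id" using hom[OF hyp_Aut_id hyp_Aut_id] by simp
  then have "\<phi> id (\<phi> id x) = \<phi> id x" for x by (metis comp_apply)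
  then show ?thesis using hyp_Aut_eq_iff[OF img[OF hyp_Aut_id]] by (simp add: fun_eq_iff)
qed

lemma map_ginv: "g \<in> hyp_Aut E \<Longrightarrow> \<phi> (ginv g) = ginv (\<phi> g)"
  using hom[of g "ginv g"] hyp_Aut_ginv[of g E] ginv_comp(2)[of g E] map_id ginv_eqI[OF img, of g "\<phi> (ginv g)"]
  by simp

lemma \<psi>_image: "H \<subseteq> hyp_Aut E \<Longrightarrow> \<psi> ` \<phi> ` H = H"
  by (rule inv_into_image_cancel[OF bij_betw_imp_inj_on[OF bij]])

lemma image_subgroup:
  assumes "perm_subgroup E H"
  shows "perm_subgroup E' (\<phi> ` H)"
  unfolding perm_subgroup_def
proof (intro conjI ballI)
  note S = perm_subgroupD[OF assms]
  show "\<phi> ` H \<subseteq> hyp_Aut E'" using img S(1) by blast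
  show "id \<in> \<phi> ` H" using S(2) map_id by (metis imageI)
  show "g \<circ> h \<in> \<phi> ` H" if "g \<in> \<phi> ` H" "h \<in> \<phi> ` H" for g h
  proof -
    obtain x y where xy: "x \<in> H" "y \<in> H" "g = \<phi> x" "h = \<phi> y"
      using \<open>g \<in> \<phi> ` H\<close> \<open>h \<in> \<phi> ` H\<close> by (elim imageE)
    then have "g \<circ> h = \<phi> (x \<circ> y)" using hom S(1) by (simp add: subset_iff)
    then show ?thesis using S(3)[OF xy(1,2)] by (metis imageI)
  qed
  show "ginv g \<in> \<phi> ` H" if "g \<in> \<phi> ` H" for g
  proof -
    obtain x where x: "x \<in> H" "g = \<phi> x" using \<open>g \<in> \<phi> ` H\<close> by (elim imageE)
    then have "ginv g = \<phi> (ginv x)" using map_ginv[of x] S(1) by auto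
    then show ?thesis using S(4)[OF x(1)] by (metis imageI)
  qed
qed

lemma image_small:
  assumes "small_index E H"
  shows "small_index E' (\<phi> ` H)"
  unfolding small_index_def
proof (intro allI impI)
  fix c :: "nat set \<Rightarrow> nat \<Rightarrow> nat" assume c: "\<forall>s. c s \<in> hyp_Aut E'"
  then have c': "\<psi> (c s) \<in> hyp_Aut E" for s using \<psi>_img by blast
  then obtain s t where st: "s \<noteq> t" "ginv (\<psi> (c s)) \<circ> \<psi> (c t) \<in> H"
    using assms[unfolded small_index_def, THEN spec, of "\<lambda>s. \<psi> (c s)"] by blast
  have "\<phi> (ginv (\<psi> (c s)) \<circ> \<psi> (c t)) = ginv (c s) \<circ> c t"
    using hom[OF hyp_Aut_ginv[OF c'] c'] map_ginv[OF c'] \<phi>_\<psi> c by simp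
  then show "\<exists>s t. s \<noteq> t \<and> ginv (c s) \<circ> c t \<in> \<phi> ` H" using st by (metis imageI)
qed

lemma image_connected:
  assumes "connected_small E H"
  shows "connected_small E' (\<phi> ` H)"
  unfolding connected_small_def
proof (intro conjI allI impI)
  have H: "perm_subgroup E H" "small_index E H"
    and conn: "\<And>K. perm_subgroup E K \<Longrightarrow> K \<subseteq> H \<Longrightarrow> finite_index_in K H \<Longrightarrow> K = H"
    using assms by (auto simp: connected_small_def)
  show "perm_subgroup E' (\<phi> ` H)" by (rule image_subgroup[OF H(1)])
  show "small_index E' (\<phi> ` H)" by (rule image_small[OF H(2)])
  note HG = perm_subgroupD(1)[OF H(1)]
  fix K assume K: "perm_subgroup E' K" "K \<subseteq> \<phi> ` H" "finite_index_in K (\<phi> ` H)"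
  note KG = perm_subgroupD(1)[OF K(1)]
  have 1: "perm_subgroup E (\<psi> ` K)" by (rule aut_iso.image_subgroup[OF sym K(1)])
  have 2: "\<psi> ` K \<subseteq> H" using image_mono[OF K(2), of \<psi>] \<psi>_image[OF HG] by simp
  obtain R where R: "finite R" "R \<subseteq> \<phi> ` H" "\<And>h. h \<in> \<phi> ` H \<Longrightarrow> \<exists>r\<in>R. ginv r \<circ> h \<in> K"
    using K(3) unfolding finite_index_in_def by blast
  have "\<exists>r\<in>\<psi> ` R. ginv r \<circ> h \<in> \<psi> ` K" if h: "h \<in> H" for h
  proof -
    obtain r where r: "r \<in> R" "ginv r \<circ> \<phi> h \<in> K" using R(3)[OF imageI[OF h]] by blast
    have hG: "h \<in> hyp_Aut E" using h HG by blast
    have rG: "r \<in> hyp_Aut E'" using r(1) R(2) HG img by blast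
    have "\<psi> (ginv r \<circ> \<phi> h) = ginv (\<psi> r) \<circ> h"
      using aut_iso.hom[OF sym hyp_Aut_ginv[OF rG] img[OF hG]] aut_iso.map_ginv[OF sym rG] \<psi>_\<phi>[OF hG] by simp
    then have "ginv (\<psi> r) \<circ> h \<in> \<psi> ` K" using r(2) by (metis imageI)
    then show ?thesis using r(1) by blast
  qed
  moreover have "\<psi> ` R \<subseteq> H" using image_mono[OF R(2), of \<psi>] \<psi>_image[OF HG] by simp
  ultimately have "finite_index_in (\<psi> ` K) H" unfolding finite_index_in_def using R(1) by blast
  then have "\<psi> ` K = H" by (rule conn[OF 1 2])
  moreover have "\<phi> ` \<psi> ` K = K" unfolding image_image using \<phi>_\<psi> KG by (simp add: subset_iff)
  ultimately show "K = \<phi> ` H" by simp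
qed

end

text \<open>Under \<open>connected_small_iff\<close> larger finite sets have smaller stabilizers. So
  point stabilizers are the maximal proper \<open>connected_small\<close> subgroups, a property
  preserved by \<phi>.\<close>

lemma point_stabilizer_image:
  assumes iso: "aut_iso E E' \<phi>" and M: "homogeneous_hypergraph \<eta> \<zeta> E" and N: "homogeneous_hypergraph \<eta>' \<zeta>' E'"
  shows "\<exists>b. \<phi> ` hyp_stab E {a} = hyp_stab E' {b}"
proof -
  interpret aut_iso E E' \<phi> by (rule iso)
  interpret M: homogeneous_hypergraph \<eta> \<zeta> E by (rule M)
  interpret N: homogeneous_hypergraph \<eta>' \<zeta>' E' by (rule N)
  interpret inv: aut_iso E' E \<psi> by (rule sym)
  have full: "hyp_stab E {} = hyp_Aut E" "hyp_stab E' {} = hyp_Aut E'" by (auto simp: hyp_stab_def)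
  have "connected_small E' (\<phi> ` hyp_stab E {a})"
    by (rule image_connected, rule M.connected_small_iff[THEN iffD2], rule exI[of _ "{a}"]) simp
  then obtain A where A: "finite A" "\<phi> ` hyp_stab E {a} = hyp_stab E' A"
    unfolding N.connected_small_iff by (elim exE conjE)
  have sa: "hyp_stab E {a} = \<psi> ` hyp_stab E' A" using \<psi>_image[OF hyp_stab_subset, of "{a}"] A(2) by simp
  have "A \<noteq> {}"
  proof
    assume "A = {}"
    then have "hyp_stab E {a} = hyp_stab E {}" using sa inv.image_full full by simp
    then show False using M.hyp_stab_subset_iff[of "{}" "{a}"] by simp
  qed
  then obtain b where b: "b \<in> A" by blast
  have "connected_small E (\<psi> ` hyp_stab E' {b})"
    by (rule inv.image_connected, rule N.connected_small_iff[THEN iffD2], rule exI[of _ "{b}"]) simp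
  then obtain C where C: "finite C" "\<psi> ` hyp_stab E' {b} = hyp_stab E C"
    unfolding M.connected_small_iff by (elim exE conjE)
  have sb: "hyp_stab E' {b} = \<phi> ` hyp_stab E C"
    unfolding C(2)[symmetric] image_image using \<phi>_\<psi> hyp_stab_subset[of E' "{b}"] by (simp add: subset_iff)
  have "hyp_stab E {a} \<subseteq> hyp_stab E C"
    unfolding sa C(2)[symmetric] using hyp_stab_antimono[of "{b}" A E'] b by (intro image_mono) simp
  then have "C \<subseteq> {a}" using M.hyp_stab_subset_iff[of "{a}" C] by simp
  moreover have "C \<noteq> {}"
  proof
    assume "C = {}"
    then have "hyp_stab E' {b} = hyp_stab E' {}" using sb image_full full by simp
    then show False using N.hyp_stab_subset_iff[of "{}" "{b}"] by simp
  qed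
  ultimately have "C = {a}" by blast
  then show ?thesis using sb by blast
qed

text \<open>A point is determined by its stabilizer, so \<phi> induces the bijection
  \<open>f\<close>. Equivariance holds because \<phi> respects conjugation and the stabilizer of
  \<open>g x\<close> is a conjugate of that of \<open>x\<close>.\<close>

lemma point_bijection:
  assumes iso: "aut_iso E E' \<phi>" and M: "homogeneous_hypergraph \<eta> \<zeta> E" and N: "homogeneous_hypergraph \<eta>' \<zeta>' E'"
  obtains f where "bij f" "\<And>g x. g \<in> hyp_Aut E \<Longrightarrow> \<phi> g (f x) = f (g x)"
proof -
  interpret aut_iso E E' \<phi> by (rule iso)
  interpret M: homogeneous_hypergraph \<eta> \<zeta> E by (rule M)
  interpret N: homogeneous_hypergraph \<eta>' \<zeta>' E' by (rule N)
  have singM: "a = b" if "hyp_stab E {a} \<subseteq> hyp_stab E {b}" for a b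
    using M.hyp_stab_subset_iff[of "{a}" "{b}"] that by simp
  have singN: "a = b" if "hyp_stab E' {a} \<subseteq> hyp_stab E' {b}" for a b
    using N.hyp_stab_subset_iff[of "{a}" "{b}"] that by simp
  obtain f where f: "\<And>a. \<phi> ` hyp_stab E {a} = hyp_stab E' {f a}"
    using point_stabilizer_image[OF iso M N] by metis
  obtain f' where f': "\<And>b. \<psi> ` hyp_stab E' {b} = hyp_stab E {f' b}"
    using point_stabilizer_image[OF sym N M] by metis
  have f'f: "f' (f a) = a" for a
    using f'[of "f a"] f[of a] \<psi>_image[OF hyp_stab_subset, of "{a}"] singM by simp
  have ff': "f (f' b) = b" for b
  proof -
    have "\<phi> ` \<psi> ` hyp_stab E' {b} = hyp_stab E' {b}"
      unfolding image_image using \<phi>_\<psi> hyp_stab_subset[of E' "{b}"] by (simp add: subset_iff)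
    then show ?thesis using f'[of b] f[of "f' b"] singN by simp
  qed
  have "bij f" by (rule o_bij[of f' f]) (simp_all add: fun_eq_iff f'f ff')
  moreover have "\<phi> g (f x) = f (g x)" if g: "g \<in> hyp_Aut E" for g x
  proof (rule singN, rule subsetI)
    fix y assume y: "y \<in> hyp_stab E' {\<phi> g (f x)}"
    have yG: "y \<in> hyp_Aut E'" using y hyp_stab_subset by blast
    have "ginv (\<phi> g) \<circ> y \<circ> \<phi> g \<in> hyp_stab E' {f x}"
      by (rule hyp_stab_conj[OF img[OF g]]) (use y in simp)
    then obtain z where z: "z \<in> hyp_stab E {x}" "ginv (\<phi> g) \<circ> y \<circ> \<phi> g = \<phi> z" unfolding f[symmetric] by blast
    have zG: "z \<in> hyp_Aut E" and zx: "z x = x" using z(1) by (auto simp: hyp_stab_def)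
    define w where "w = g \<circ> z \<circ> ginv g"
    have "\<phi> w = \<phi> g \<circ> \<phi> z \<circ> ginv (\<phi> g)"
      unfolding w_def using hom[OF hyp_Aut_comp[OF g zG] hyp_Aut_ginv[OF g]] hom[OF g zG] map_ginv[OF g] by simp
    also have "\<dots> = y" unfolding z(2)[symmetric] using ginv_right[OF img[OF g]] by (simp add: fun_eq_iff)
    finally have "\<phi> w = y" .
    moreover have "w \<in> hyp_stab E {g x}"
      using hyp_Aut_comp[OF hyp_Aut_comp[OF g zG] hyp_Aut_ginv[OF g]] zx ginv_left[OF g]
      by (simp add: hyp_stab_def w_def)
    ultimately show "y \<in> hyp_stab E' {f (g x)}" using f[of "g x"] by (metis imageI)
  qed
  ultimately show ?thesis by (rule that)
qed

section \<open>Recovering the parameters from the permutation group\<close>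

lemma homogeneous_hypergraph_pullback:
  assumes N: "homogeneous_hypergraph \<eta> \<zeta> E" and f: "bij f"
  shows "homogeneous_hypergraph \<eta> \<zeta> {e. f ` e \<in> E}"
proof -
  interpret N: homogeneous_hypergraph \<eta> \<zeta> E by (rule N)
  define E2 where "E2 = {e. f ` e \<in> E}"
  have emb: "edge_embedding A E2 f E" for A
    by (rule edge_embeddingI[OF inj_on_subset[OF bij_is_inj[OF f] subset_UNIV]]) (simp add: E2_def)
  have ff: "f ` ginv f ` e = e" for e using f by (simp add: image_image bij_is_surj surj_f_inv_f)
  have embi: "edge_embedding A E (ginv f) E2" for A
    by (rule edge_embeddingI[OF inj_on_subset[OF bij_is_inj[OF bij_imp_bij_inv[OF f]] subset_UNIV]])
       (simp add: E2_def ff)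
  have "homogeneous_hypergraph \<eta> \<zeta> E2"
  proof
    show "admissible \<eta> \<zeta> UNIV E2" by (rule admissible_pullback[OF emb N.admissible]) auto
    show "2 \<le> n" if "\<eta> n" for n using N.\<eta>_ge2 that .
    show "2 \<le> n" if "n < \<zeta> n" for n using N.\<zeta>_ge2 that .
    show "\<exists>h :: nat \<Rightarrow> nat. edge_embedding B F h E2" if "finite B" "admissible \<eta> \<zeta> B F" for B F
    proof -
      obtain h :: "nat \<Rightarrow> nat" where "edge_embedding B F h E" using N.universal_nat[OF \<open>finite B\<close> \<open>admissible \<eta> \<zeta> B F\<close>] by blast
      from edge_embedding_comp[OF this order_refl embi] show ?thesis by blast
    qed
    show "\<exists>g\<in>hyp_Aut E2. \<forall>a\<in>A. g a = h a" if A: "finite A" and h: "edge_embedding A E2 h E2" for A h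
    proof -
      have gf: "ginv f (f x) = x" for x using f by (simp add: bij_is_inj inv_f_f)
      have "edge_embedding (f ` A) E (ginv f) E2" by (rule embi)
      moreover have "ginv f ` f ` A \<subseteq> A" by (simp add: image_image gf)
      ultimately have "edge_embedding (f ` A) E (f \<circ> (h \<circ> ginv f)) E"
        using edge_embedding_comp[OF edge_embedding_comp[OF _ _ h] order_refl emb] by blast
      then obtain g where g: "g \<in> hyp_Aut E" "\<And>y. y \<in> f ` A \<Longrightarrow> g y = f (h (ginv f y))"
        using N.homogeneous[of "f ` A"] A by fastforce
      define g2 where "g2 = ginv f \<circ> g \<circ> f"
      have "g2 \<in> hyp_Aut E2"
      proof (rule hyp_AutI)
        show "bij g2" unfolding g2_def by (intro bij_comp f bij_imp_bij_inv hyp_Aut_bij[OF g(1)])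
        fix e
        have "f ` g2 ` e = g ` f ` e" unfolding g2_def image_comp[symmetric] ff ..
        then show "g2 ` e \<in> E2 \<longleftrightarrow> e \<in> E2" using hyp_Aut_edge[OF g(1)] by (simp add: E2_def)
      qed
      moreover have "g2 a = h a" if "a \<in> A" for a using g(2)[OF imageI[OF that]] by (simp add: g2_def gf)
      ultimately show ?thesis by blast
    qed
  qed
  then show ?thesis by (simp add: E2_def)
qed

text \<open>Pulling \<open>E'\<close> back along the bijection of points reduces isomorphic groups
  to equal permutation groups.\<close>

lemma aut_iso_same_group:
  assumes iso: "aut_iso E E' \<phi>" and M: "homogeneous_hypergraph \<eta> \<zeta> E" and N: "homogeneous_hypergraph \<eta>' \<zeta>' E'"
  obtains E2 where "homogeneous_hypergraph \<eta>' \<zeta>' E2" "hyp_Aut E2 = hyp_Aut E"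
proof -
  interpret aut_iso E E' \<phi> by (rule iso)
  obtain f where f: "bij f" "\<And>g x. g \<in> hyp_Aut E \<Longrightarrow> \<phi> g (f x) = f (g x)"
    using point_bijection[OF iso M N] by metis
  define E2 where "E2 = {e. f ` e \<in> E'}"
  have ff: "f (ginv f x) = x" "ginv f (f x) = x" for x
    using f(1) by (simp_all add: bij_is_surj surj_f_inv_f bij_is_inj inv_f_f)
  have "g \<in> hyp_Aut E2" if g: "g \<in> hyp_Aut E" for g
  proof (rule hyp_AutI[OF hyp_Aut_bij[OF g]])
    fix e
    have "f ` g ` e = \<phi> g ` f ` e" unfolding image_image using f(2)[OF g] by simp
    then show "g ` e \<in> E2 \<longleftrightarrow> e \<in> E2" using hyp_Aut_edge[OF img[OF g]] by (simp add: E2_def)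
  qed
  moreover have "g \<in> hyp_Aut E" if g: "g \<in> hyp_Aut E2" for g
  proof -
    define h where "h = f \<circ> g \<circ> ginv f"
    have "h \<in> hyp_Aut E'"
    proof (rule hyp_AutI)
      show "bij h" unfolding h_def by (intro bij_comp f(1) bij_imp_bij_inv hyp_Aut_bij[OF g])
      fix e
      have "f ` ginv f ` e = e" by (simp add: image_image ff)
      then have "e \<in> E' \<longleftrightarrow> ginv f ` e \<in> E2" by (simp add: E2_def)
      also have "\<dots> \<longleftrightarrow> g ` ginv f ` e \<in> E2" using hyp_Aut_edge[OF g] by simp
      also have "\<dots> \<longleftrightarrow> h ` e \<in> E'" unfolding E2_def h_def by (simp add: image_comp comp_assoc)
      finally show "h ` e \<in> E' \<longleftrightarrow> e \<in> E'" by simp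
    qed
    then obtain g' where g': "g' \<in> hyp_Aut E" "\<phi> g' = h" using image_full by (metis imageE)
    have "f (g' x) = f (g x)" for x using f(2)[OF g'(1), of x] g'(2) ff by (simp add: h_def)
    then have "g' = g" using ff(2) by (metis ext)
    then show ?thesis using g'(1) by simp
  qed
  ultimately have "hyp_Aut E2 = hyp_Aut E" by blast
  then show ?thesis using that homogeneous_hypergraph_pullback[OF N f(1)] by (simp add: E2_def)
qed

text \<open>By homogeneity \<open>m\<close> extends from \<open>A\<close> to an automorphism of
  \<open>E\<close>, which is also one of \<open>E'\<close>. Applied in both directions: the two
  hypergraphs have the same finite partial isomorphisms, though perhaps different edges.\<close>

lemma edge_embedding_transfer:
  assumes M: "homogeneous_hypergraph \<eta> \<zeta> E" and same: "hyp_Aut E' = hyp_Aut E"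
    and A: "finite A" and m: "edge_embedding A E m E"
  shows "edge_embedding A E' m E'"
proof -
  interpret M: homogeneous_hypergraph \<eta> \<zeta> E by (rule M)
  obtain g where g: "g \<in> hyp_Aut E" "\<And>a. a \<in> A \<Longrightarrow> g a = m a" using M.homogeneous[OF A m] by blast
  have "edge_embedding A E' g E'" by (rule hyp_Aut_embedding) (use g(1) same in simp)
  then show ?thesis by (rule edge_embedding_cong) (simp add: g(2))
qed

text \<open>Map k points without edges to k points whose only edge is the full set. On proper
  subsets this preserves \<open>E\<close>, hence \<open>E'\<close>. Without k-edges in
  \<open>E'\<close>, the whole map would preserve \<open>E'\<close>, hence \<open>E\<close>, which
  it does not.\<close>

lemma arities_subset:
  assumes M: "homogeneous_hypergraph \<eta> \<zeta> E" and N: "homogeneous_hypergraph \<eta>' \<zeta>' E'"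
    and same: "hyp_Aut E' = hyp_Aut E" and k: "\<eta> k"
  shows "\<eta>' k"
proof (rule ccontr)
  assume k': "\<not> \<eta>' k"
  interpret M: homogeneous_hypergraph \<eta> \<zeta> E by (rule M)
  interpret N: homogeneous_hypergraph \<eta>' \<zeta>' E' by (rule N)
  define B where "B = {..<k}"
  have B: "finite B" "card B = k" by (simp_all add: B_def)
  have sub: "\<exists>e\<subseteq>S. card e = n" if "n < \<zeta> n" "card S = \<zeta> n" for n and S :: "nat set"
    using obtain_subset_with_card_n[of n S] that by (metis less_imp_le)
  have "admissible \<eta> \<zeta> B {}" unfolding admissible_def using sub by simp
  then obtain m0 where m0: "edge_embedding B {} m0 E" using M.universal[OF B(1)] by metis
  have "\<exists>e\<subseteq>S. card e = n \<and> e \<noteq> B" if n: "n < \<zeta> n" and S: "S \<subseteq> B" "card S = \<zeta> n" for n S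
  proof -
    obtain e where e: "e \<subseteq> S" "card e = n" using sub n S(2) by blast
    have "card S \<le> k" using card_mono[OF B(1) S(1)] B(2) by simp
    then have "card e \<noteq> card B" using n e(2) S(2) B(2) by simp
    then show ?thesis using e by blast
  qed
  then have "admissible \<eta> \<zeta> B {B}" unfolding admissible_def using B k by simp
  then obtain m1 where m1: "edge_embedding B {B} m1 E" using M.universal[OF B(1)] by metis
  define A where "A = m0 ` B"
  define m where "m = m1 \<circ> inv_into B m0"
  have inj0: "inj_on m0 B" by (rule edge_embedding_inj[OF m0])
  have invA: "inv_into B m0 ` A = B" unfolding A_def by (rule inv_into_image_cancel[OF inj0 order_refl])
  have minj: "inj_on m A"
    unfolding m_def A_def
    by (rule comp_inj_on[OF inj_on_inv_into[OF order_refl]])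
       (simp add: inv_into_image_cancel[OF inj0 order_refl] edge_embedding_inj[OF m1])
  have cA: "finite A" "card A = k" using B card_image[OF inj0] by (simp_all add: A_def)
  have m_edge: "m ` e \<in> E \<longleftrightarrow> e = A" and e_edge: "e \<notin> E" if e: "e \<subseteq> A" for e
  proof -
    obtain e' where e': "e' \<subseteq> B" "e = m0 ` e'" using e unfolding A_def by (rule subset_imageE)
    have inv: "inv_into B m0 ` e = e'" unfolding e'(2) by (rule inv_into_image_cancel[OF inj0 e'(1)])
    have "m ` e \<in> E \<longleftrightarrow> e' = B"
      unfolding m_def image_comp[symmetric] inv using edge_embedding_edge[OF m1 e'(1)] by simp
    also have "\<dots> \<longleftrightarrow> e = A" unfolding e'(2) A_def using inj_on_image_eq_iff[OF inj0 e'(1) order_refl] by simp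
    finally show "m ` e \<in> E \<longleftrightarrow> e = A" .
    show "e \<notin> E" using edge_embedding_edge[OF m0 e'(1)] e'(2) by simp
  qed
  have proper: "edge_embedding S E m E" if S: "S \<subset> A" for S
  proof (rule edge_embeddingI)
    show "inj_on m S" using minj S inj_on_subset by blast
    fix e assume "e \<subseteq> S"
    then have "e \<subseteq> A" "e \<noteq> A" using S by auto
    then show "m ` e \<in> E \<longleftrightarrow> e \<in> E" using m_edge e_edge by blast
  qed
  have "edge_embedding A E' m E'"
  proof (rule edge_embeddingI[OF minj])
    fix e assume e: "e \<subseteq> A"
    show "m ` e \<in> E' \<longleftrightarrow> e \<in> E'"
    proof (cases "e = A")
      case True
      have "card (m ` A) = k" using card_image[OF minj] cA by simp
      then show ?thesis using True N.edge_card k' cA(2) by metis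
    next
      case False
      then have "e \<subset> A" using e by blast
      then have "edge_embedding e E' m E'"
        using edge_embedding_transfer[OF M same _ proper] cA(1) finite_subset[OF e] by blast
      then show ?thesis by (rule edge_embedding_edge) simp
    qed
  qed
  then have "edge_embedding A E m E"
    by (rule edge_embedding_transfer[OF N same[symmetric] cA(1)])
  then have "m ` A \<in> E \<longleftrightarrow> A \<in> E" by (rule edge_embedding_edge) simp
  then show False using m_edge[OF order_refl] e_edge[OF order_refl] by simp
qed

text \<open>If \<open>E'\<close> admitted every pattern of \<open>k\<close>-edges on \<open>\<zeta> k\<close> points, then comparing the patterns
  of \<open>k\<close>-edges of \<open>E\<close> and of \<open>E'\<close> would give an injection of a finite power set into itself that
  misses the complete pattern.\<close>

lemma clique_bound_le:
  assumes M: "homogeneous_hypergraph \<eta> \<zeta> E" and N: "homogeneous_hypergraph \<eta>' \<zeta>' E'"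
    and same: "hyp_Aut E' = hyp_Aut E" and k: "\<eta>' k" "k < \<zeta> k"
  shows "k < \<zeta>' k \<and> \<zeta>' k \<le> \<zeta> k"
proof (rule ccontr)
  assume large: "\<not> ?thesis"
  interpret M: homogeneous_hypergraph \<eta> \<zeta> E by (rule M)
  interpret N: homogeneous_hypergraph \<eta>' \<zeta>' E' by (rule N)
  define A where "A = {..<\<zeta> k}"
  define K where "K = {e. e \<subseteq> A \<and> card e = k}"
  define L where "L = {e\<in>E'. e \<subseteq> A \<and> card e < k}"
  have A: "finite A" "card A = \<zeta> k" by (simp_all add: A_def)
  have fK: "finite K" by (rule finite_subset[of _ "Pow A"]) (auto simp: K_def A(1))
  have fe: "finite e" if "e \<subseteq> A" for e using finite_subset[OF that A(1)] .
  \<comment> \<open>The edges below size \<open>k\<close> are copied from \<open>E'\<close>, which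
    has no forbidden clique; by \<open>large\<close>, \<open>A\<close> has too few points for a
    forbidden clique of size-\<open>k\<close> edges; larger edges do not occur.\<close>
  have "admissible \<eta>' \<zeta>' A (L \<union> W)" if W: "W \<subseteq> K" for W
    unfolding admissible_def
  proof (intro conjI ballI allI impI)
    fix e assume "e \<in> L \<union> W"
    then have "e \<in> E' \<and> e \<subseteq> A \<or> e \<subseteq> A \<and> card e = k" using W by (auto simp: L_def K_def)
    then show "e \<subseteq> A" "finite e" "\<eta>' (card e)" using fe N.edge_card k(1) by auto
  next
    fix n S assume n: "n < \<zeta>' n" and S: "S \<subseteq> A" "card S = \<zeta>' n"
    have le: "card S \<le> \<zeta> k" using card_mono[OF A(1) S(1)] A(2) by simp
    consider "n < k" | "n = k" | "k < n" by linarith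
    then show "\<exists>e\<subseteq>S. card e = n \<and> e \<notin> L \<union> W"
    proof cases
      case 1
      obtain e where e: "e \<subseteq> S" "card e = n" "e \<notin> E'" using N.missing_edge[OF n S(2)] .
      then have "e \<notin> L \<union> W" using 1 W by (auto simp: L_def K_def)
      then show ?thesis using e by blast
    next
      case 2
      then show ?thesis using n S(2) le large by simp
    next
      case 3
      have "n \<le> card S" using n S(2) by simp
      then obtain e where e: "e \<subseteq> S" "card e = n" by (rule obtain_subset_with_card_n)
      then have "e \<notin> L \<union> W" using 3 W by (auto simp: L_def K_def)
      then show ?thesis using e by blast
    qed
  qed
  then have "\<exists>m. W \<subseteq> K \<longrightarrow> edge_embedding A (L \<union> W) m E'" for W
    using N.universal[OF A(1)] by metis
  then obtain m where m: "\<And>W. W \<subseteq> K \<Longrightarrow> edge_embedding A (L \<union> W) (m W) E'" by metis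
  define pat where "pat W = {e\<in>K. m W ` e \<in> E}" for W
  have "inj_on pat (Pow K)"
  proof (rule inj_onI)
    fix W V assume "W \<in> Pow K" "V \<in> Pow K" and pat: "pat W = pat V"
    then have W: "W \<subseteq> K" and V: "V \<subseteq> K" by auto
    note mW = m[OF W] and mV = m[OF V]
    have inj: "inj_on (m W) A" by (rule edge_embedding_inj[OF mW])
    define h where "h = m V \<circ> inv_into A (m W)"
    have h: "h ` m W ` e = m V ` e" if "e \<subseteq> A" for e
      unfolding h_def image_comp[symmetric] inv_into_image_cancel[OF inj that] ..
    have hinj: "inj_on h (m W ` e)" if "e \<subseteq> A" for e
      unfolding h_def
      by (rule comp_inj_on[OF inj_on_inv_into[OF image_mono[OF that]]])
         (simp add: inv_into_image_cancel[OF inj that] inj_on_subset[OF edge_embedding_inj[OF mV] that])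
    \<comment> \<open>Below size \<open>k\<close> both copies carry the pattern \<open>L\<close>, so
      \<open>h\<close> preserves \<open>E'\<close> and hence \<open>E\<close>. With equal patterns
      of k-edges of \<open>E\<close>, it preserves \<open>E\<close> on every k-subset, hence
      \<open>E'\<close>, which gives \<open>W = V\<close>.\<close>
    have low: "edge_embedding (m W ` e) E h E" if e: "e \<subseteq> A" "card e < k" for e
    proof (rule edge_embedding_transfer[OF N same[symmetric]])
      show "finite (m W ` e)" using fe[OF e(1)] by simp
      show "edge_embedding (m W ` e) E' h E'"
      proof (rule edge_embeddingI[OF hinj[OF e(1)]])
        fix d assume "d \<subseteq> m W ` e"
        then obtain d' where d': "d' \<subseteq> e" "d = m W ` d'" by (rule subset_imageE)
        have dA: "d' \<subseteq> A" using d'(1) e(1) by blast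
        have "card d' < k" using card_mono[OF fe[OF e(1)] d'(1)] e(2) by simp
        then have nK: "d' \<notin> K" by (simp add: K_def)
        have "h ` d \<in> E' \<longleftrightarrow> d' \<in> L \<union> V" unfolding d'(2) h[OF dA] by (rule edge_embedding_edge[OF mV dA])
        also have "\<dots> \<longleftrightarrow> d' \<in> L \<union> W" using nK W V by blast
        also have "\<dots> \<longleftrightarrow> d \<in> E'" unfolding d'(2) using edge_embedding_edge[OF mW dA] by simp
        finally show "h ` d \<in> E' \<longleftrightarrow> d \<in> E'" .
      qed
    qed
    have "e \<in> W \<longleftrightarrow> e \<in> V" if e: "e \<in> K" for e
    proof -
      have eA: "e \<subseteq> A" "card e = k" using e by (auto simp: K_def)
      have nL: "e \<notin> L" using eA by (simp add: L_def)
      have "edge_embedding (m W ` e) E h E"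
      proof (rule edge_embeddingI[OF hinj[OF eA(1)]])
        fix d assume "d \<subseteq> m W ` e"
        then obtain d' where d': "d' \<subseteq> e" "d = m W ` d'" by (rule subset_imageE)
        show "h ` d \<in> E \<longleftrightarrow> d \<in> E"
        proof (cases "d' = e")
          case True
          have "m V ` e \<in> E \<longleftrightarrow> m W ` e \<in> E" using pat e unfolding pat_def by blast
          then show ?thesis unfolding d'(2) True h[OF eA(1)] .
        next
          case False
          then have "card d' < k" using psubset_card_mono[OF fe[OF eA(1)], of d'] d'(1) eA(2) by blast
          then have "edge_embedding (m W ` d') E h E" using low d'(1) eA(1) by blast
          then show ?thesis unfolding d'(2) by (rule edge_embedding_edge) simp
        qed
      qed
      then have "edge_embedding (m W ` e) E' h E'"
        by (rule edge_embedding_transfer[OF M same, rotated]) (simp add: fe[OF eA(1)])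
      then have "h ` m W ` e \<in> E' \<longleftrightarrow> m W ` e \<in> E'" by (rule edge_embedding_edge) simp
      then show ?thesis
        unfolding h[OF eA(1)] edge_embedding_edge[OF mW eA(1)] edge_embedding_edge[OF mV eA(1)] using nL by simp
    qed
    then show "W = V" using W V by blast
  qed
  moreover have "pat ` Pow K \<subseteq> Pow K" by (auto simp: pat_def)
  ultimately have "pat ` Pow K = Pow K" using fK by (intro endo_inj_surj) auto
  then obtain W where W: "W \<subseteq> K" "pat W = K" by (metis PowD PowI imageE order_refl)
  have inj: "inj_on (m W) A" by (rule edge_embedding_inj[OF m[OF W(1)]])
  have "card (m W ` A) = \<zeta> k" using card_image[OF inj] A(2) by simp
  from M.missing_edge[OF k(2) this] obtain e where e: "e \<subseteq> m W ` A" "card e = k" "e \<notin> E" .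
  obtain e' where e': "e' \<subseteq> A" "e = m W ` e'" using e(1) by (rule subset_imageE)
  have "card e' = k" using card_image[OF inj_on_subset[OF inj e'(1)]] e(2) e'(2) by simp
  then have "e' \<in> pat W" using W(2) e'(1) by (simp add: K_def)
  then show False using e(3) e'(2) by (simp add: pat_def)
qed

lemma parameters_eq:
  assumes M: "homogeneous_hypergraph \<eta> \<zeta> E" and N: "homogeneous_hypergraph \<eta>' \<zeta>' E'"
    and same: "hyp_Aut E' = hyp_Aut E" and \<zeta>: "zeta_param \<eta> \<zeta>" "zeta_param \<eta>' \<zeta>'"
  shows "\<eta> = \<eta>' \<and> \<zeta> = \<zeta>'"
proof -
  have eq: "\<eta> k \<longleftrightarrow> \<eta>' k" for k
    using arities_subset[OF M N same, of k] arities_subset[OF N M same[symmetric], of k] by blast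
  moreover have "\<zeta> k = \<zeta>' k" for k
  proof (cases "\<eta> k")
    case True
    then have "k \<le> \<zeta> k" "k \<le> \<zeta>' k" using \<zeta> eq[of k] unfolding zeta_param_def by metis+
    moreover have "k < \<zeta>' k \<and> \<zeta>' k \<le> \<zeta> k" if "k < \<zeta> k"
      using clique_bound_le[OF M N same _ that] True eq by blast
    moreover have "k < \<zeta> k \<and> \<zeta> k \<le> \<zeta>' k" if "k < \<zeta>' k"
      using clique_bound_le[OF N M same[symmetric] True that] .
    ultimately show ?thesis by linarith
  next
    case False
    then show ?thesis using \<zeta> eq[of k] unfolding zeta_param_def by metis
  qed
  ultimately show ?thesis by blast
qed

section \<open>From relational structures to hypergraphs\<close>

definition hyp_rel :: "'a set set \<Rightarrow> nat \<Rightarrow> 'a list set" where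
  "hyp_rel F n = {xs. length xs = n \<and> distinct xs \<and> set xs \<in> F}"

lemma embedding_hyp_rel_iff:
  assumes M: "\<And>n. rel M n = hyp_rel F n" and N: "\<And>n. rel N n = hyp_rel F' n"
    and fin: "\<And>e. e \<in> F \<Longrightarrow> finite e" "\<And>e. e \<in> F' \<Longrightarrow> finite e"
  shows "embedding f M N \<longleftrightarrow> f ` univ M \<subseteq> univ N \<and> edge_embedding (univ M) F f F'"
proof
  assume f: "embedding f M N"
  then have inj: "inj_on f (univ M)" and im: "f ` univ M \<subseteq> univ N"
    and r: "\<And>n xs. length xs = n \<Longrightarrow> set xs \<subseteq> univ M \<Longrightarrow> xs \<in> rel M n \<longleftrightarrow> map f xs \<in> rel N n"
    unfolding embedding_def by blast+
  have "edge_embedding (univ M) F f F'"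
  proof (rule edge_embeddingI[OF inj])
    fix e assume e: "e \<subseteq> univ M"
    note inje = inj_on_subset[OF inj e]
    show "f ` e \<in> F' \<longleftrightarrow> e \<in> F"
    proof (cases "finite e")
      case True
      then obtain xs where xs: "set xs = e" "distinct xs" using finite_distinct_list by blast
      have "xs \<in> hyp_rel F (length xs) \<longleftrightarrow> map f xs \<in> hyp_rel F' (length xs)"
        using r[OF refl, of xs] e xs(1) unfolding M N by simp
      then show ?thesis using xs inje by (simp add: hyp_rel_def distinct_map)
    next
      case False
      then have "infinite (f ` e)" using inje by (simp add: finite_image_iff)
      then show ?thesis using False fin by blast
    qed
  qed
  then show "f ` univ M \<subseteq> univ N \<and> edge_embedding (univ M) F f F'" using im by blast
next
  assume f: "f ` univ M \<subseteq> univ N \<and> edge_embedding (univ M) F f F'"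
  then have inj: "inj_on f (univ M)" by (simp add: edge_embedding_def)
  have "xs \<in> rel M n \<longleftrightarrow> map f xs \<in> rel N n" if "length xs = n" "set xs \<subseteq> univ M" for n xs
  proof -
    have "distinct (map f xs) \<longleftrightarrow> distinct xs"
      using inj_on_subset[OF inj that(2)] by (simp add: distinct_map)
    moreover have "f ` set xs \<in> F' \<longleftrightarrow> set xs \<in> F"
      using f edge_embedding_edge that(2) by blast
    ultimately show ?thesis unfolding M N hyp_rel_def using that(1) by simp
  qed
  then show "embedding f M N" unfolding embedding_def using f inj by blast
qed

lemma symmetric_hyp_rel: "symmetric_rel n (hyp_rel F n)"
  unfolding symmetric_rel_def hyp_rel_def by auto

text \<open>Together with \<open>K_admissible\<close>: for finite structures given by edges,
  \<open>admissible\<close> is membership in the class.\<close>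

lemma hyp_rel_in_K:
  assumes V: "finite V" and adm: "admissible \<eta> \<zeta> V F"
  shows "\<lparr>univ = V, rel = hyp_rel F\<rparr> \<in> K_eta_zeta \<eta> \<zeta>" (is "?S \<in> _")
proof -
  have F: "e \<subseteq> V" "\<eta> (card e)" "finite e" if "e \<in> F" for e using adm that by (auto simp: admissible_def)
  have "L_structure \<eta> ?S"
    unfolding L_structure_def using F by (auto simp: hyp_rel_def) (metis distinct_card)
  moreover have "irreflexive_rel (hyp_rel F n)" for n by (simp add: irreflexive_rel_def hyp_rel_def)
  ultimately have K: "?S \<in> K_eta \<eta>" using V by (simp add: K_eta_def symmetric_hyp_rel)
  have "\<not> embeds (complete_hypergraph n (\<zeta> n)) (reduct n ?S)" if n: "n < \<zeta> n" for n
  proof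
    assume "embeds (complete_hypergraph n (\<zeta> n)) (reduct n ?S)"
    then obtain f where f: "inj_on f {..<\<zeta> n}" "f ` {..<\<zeta> n} \<subseteq> V"
      "\<And>xs. length xs = n \<Longrightarrow> set xs \<subseteq> {..<\<zeta> n} \<Longrightarrow> distinct xs \<Longrightarrow> map f xs \<in> hyp_rel F n"
      unfolding embeds_def embedding_def complete_hypergraph_def reduct_def by (auto split: if_splits)
    have "card (f ` {..<\<zeta> n}) = \<zeta> n" using card_image[OF f(1)] by simp
    then obtain e where e: "e \<subseteq> f ` {..<\<zeta> n}" "card e = n" "e \<notin> F"
      using adm n f(2) unfolding admissible_def by blast
    obtain d where d: "d \<subseteq> {..<\<zeta> n}" "e = f ` d" using e(1) by (rule subset_imageE)
    have "finite d" using finite_subset[OF d(1)] by simp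
    then obtain xs where xs: "set xs = d" "distinct xs" using finite_distinct_list by blast
    have "card d = n" using card_image[OF inj_on_subset[OF f(1) d(1)]] e(2) d(2) by simp
    then have "length xs = n" using xs distinct_card by fastforce
    then have "map f xs \<in> hyp_rel F n" using f(3) xs d(1) by simp
    then have "f ` d \<in> F" using xs(1) by (simp add: hyp_rel_def)
    then show False using e(3) d(2) by simp
  qed
  then show ?thesis using K by (simp add: K_eta_zeta_def)
qed

lemma K_admissible:
  assumes S: "\<lparr>univ = V, rel = hyp_rel F\<rparr> \<in> K_eta_zeta \<eta> \<zeta>" and F: "\<And>e. e \<in> F \<Longrightarrow> e \<subseteq> V"
  shows "admissible \<eta> \<zeta> V F"
proof -
  let ?S = "\<lparr>univ = V, rel = hyp_rel F\<rparr>"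
  have V: "finite V" and L: "L_structure \<eta> ?S" using S by (simp_all add: K_eta_zeta_def K_eta_def)
  have free: "\<not> embeds (complete_hypergraph n (\<zeta> n)) (reduct n ?S)" if "n < \<zeta> n" for n
    using S that by (simp add: K_eta_zeta_def)
  show ?thesis
    unfolding admissible_def
  proof (intro conjI ballI allI impI)
    fix e assume e: "e \<in> F"
    then show "e \<subseteq> V" by (rule F)
    then show fe: "finite e" using V by (rule finite_subset)
    obtain xs where xs: "set xs = e" "distinct xs" using finite_distinct_list[OF fe] by blast
    have "xs \<in> rel ?S (card e)" using xs e distinct_card[OF xs(2)] by (simp add: hyp_rel_def)
    then show "\<eta> (card e)" using L unfolding L_structure_def by blast
  next
    fix n C assume n: "n < \<zeta> n" and C: "C \<subseteq> V" "card C = \<zeta> n"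
    show "\<exists>e\<subseteq>C. card e = n \<and> e \<notin> F"
    proof (rule ccontr)
      assume "\<not> ?thesis"
      then have all: "e \<in> F" if "e \<subseteq> C" "card e = n" for e using that by blast
      have "finite C" using C(1) V by (rule finite_subset)
      then obtain f where f: "bij_betw f {..<\<zeta> n} C"
        using C(2) by (metis bij_betw_iff_card card_lessThan finite_lessThan)
      have inj: "inj_on f {..<\<zeta> n}" by (rule bij_betw_imp_inj_on[OF f])
      have fC: "f ` d \<subseteq> C" if "d \<subseteq> {..<\<zeta> n}" for d using bij_betw_imp_surj_on[OF f] that by blast
      have "distinct xs \<longleftrightarrow> map f xs \<in> hyp_rel F n" if xs: "length xs = n" "set xs \<subseteq> {..<\<zeta> n}" for xs
      proof
        assume d: "distinct xs"
        have "card (f ` set xs) = n"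
          using card_image[OF inj_on_subset[OF inj xs(2)]] distinct_card[OF d] xs(1) by simp
        then have "f ` set xs \<in> F" using all fC[OF xs(2)] by blast
        then show "map f xs \<in> hyp_rel F n"
          using xs d inj_on_subset[OF inj xs(2)] by (simp add: hyp_rel_def distinct_map)
      next
        assume "map f xs \<in> hyp_rel F n"
        then show "distinct xs" unfolding hyp_rel_def using distinct_map by blast
      qed
      then have "embedding f (complete_hypergraph n (\<zeta> n)) (reduct n ?S)"
        unfolding embedding_def complete_hypergraph_def reduct_def using inj fC[OF order_refl] C(1) by auto
      then show False using free[OF n] by (auto simp: embeds_def)
    qed
  qed
qed

text \<open>By symmetry a support determines all its orderings. One edge set can serve all arities,
  because the arity of a tuple without repetitions is the size of its support.\<close>

lemma rel_eq_hyp_rel: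
  assumes L: "\<And>xs k. xs \<in> R k \<Longrightarrow> length xs = k" and irr: "\<And>xs k. xs \<in> R k \<Longrightarrow> distinct xs"
    and sym: "\<And>xs k \<sigma>. xs \<in> R k \<Longrightarrow> \<sigma> permutes {..<k} \<Longrightarrow> permute_list \<sigma> xs \<in> R k"
  shows "R n = hyp_rel {set xs | xs k. xs \<in> R k} n"
proof (rule Set.set_eqI, rule iffI)
  fix xs assume "xs \<in> R n"
  then show "xs \<in> hyp_rel {set xs | xs k. xs \<in> R k} n" using L[of xs n] irr[of xs n] by (auto simp: hyp_rel_def)
next
  fix xs assume "xs \<in> hyp_rel {set xs | xs k. xs \<in> R k} n"
  then obtain ys k where ys: "length xs = n" "distinct xs" "set xs = set ys" "ys \<in> R k" by (auto simp: hyp_rel_def)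
  have "mset xs = mset ys" using ys(2,3) irr[OF ys(4)] set_eq_iff_mset_eq_distinct by blast
  then obtain \<sigma> where \<sigma>: "\<sigma> permutes {..<length ys}" "permute_list \<sigma> ys = xs" by (rule mset_eq_permutation)
  have k: "length ys = k" by (rule L[OF ys(4)])
  have "length ys = length xs" using \<sigma>(2) by (metis length_permute_list)
  then have "k = n" using k ys(1) by simp
  then show "xs \<in> R n" using sym[OF ys(4), of \<sigma>] \<sigma> k by simp
qed

text \<open>Members of the age live on \<open>nat\<close>; through \<open>c\<close> every finite
  part of \<open>M\<close> becomes one, so the defining properties of the class apply to it.\<close>

lemma age_transport:
  assumes M: "L_structure \<eta> M" and A: "A \<subseteq> univ M" "finite A" and c: "inj_on c A"
  shows "\<lparr>univ = c ` A, rel = (\<lambda>n. map c ` {xs \<in> rel M n. set xs \<subseteq> A})\<rparr> \<in> age \<eta> M" (is "?S \<in> _")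
proof -
  have L: "\<eta> n \<and> length xs = n" if "xs \<in> rel M n" for xs n using M that unfolding L_structure_def by blast
  have "L_structure \<eta> ?S" unfolding L_structure_def using L by auto
  moreover have "embedding (inv_into A c) ?S M"
    unfolding embedding_def
  proof (intro conjI allI impI)
    show "inj_on (inv_into A c) (univ ?S)" using inj_on_inv_into[OF order_refl[of "c ` A"]] by simp
    show "inv_into A c ` univ ?S \<subseteq> univ M" using inv_into_image_cancel[OF c order_refl] A(1) by simp
    fix n xs assume xs: "length xs = n \<and> set xs \<subseteq> univ ?S"
    then have "set xs \<subseteq> c ` A" by simp
    then have "\<forall>x\<in>set xs. x = c (inv_into A c x) \<and> inv_into A c x \<in> A"
      by (auto simp: f_inv_into_f inv_into_into)
    then have ys: "xs = map c (map (inv_into A c) xs)" "set (map (inv_into A c) xs) \<subseteq> A"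
      by (auto simp: map_idI)
    define ys where "ys = map (inv_into A c) xs"
    have yA: "set ys \<subseteq> A" and xy: "xs = map c ys" using ys by (simp_all add: ys_def)
    have "map c zs = map c ys \<longleftrightarrow> zs = ys" if "set zs \<subseteq> A" for zs
      by (rule inj_on_map_eq_map, rule inj_on_subset[OF c]) (use that yA in blast)
    then have "xs \<in> rel ?S n \<longleftrightarrow> (\<exists>zs. zs \<in> rel M n \<and> set zs \<subseteq> A \<and> zs = ys)"
      unfolding xy by (simp add: image_iff eq_commute[of "map c ys"] cong: conj_cong)
    then have "xs \<in> rel ?S n \<longleftrightarrow> ys \<in> rel M n" using yA by simp
    then show "xs \<in> rel ?S n \<longleftrightarrow> map (inv_into A c) xs \<in> rel M n" by (simp add: ys_def)
  qed
  ultimately show ?thesis using A(2) by (auto simp: age_def embeds_def)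
qed

section \<open>The group Aut M as a permutation group on the natural numbers\<close>

locale hypergraph_copy =
  fixes M :: "'a rstruct" and E :: "nat set set" and b :: "'a \<Rightarrow> nat"
  assumes b: "bij_betw b (univ M) UNIV"
    and carrier_Aut: "carrier (Aut M) = {g \<in> Bij (univ M). \<forall>e\<subseteq>univ M. b ` g ` e \<in> E \<longleftrightarrow> b ` e \<in> E}"
begin

abbreviation "b' \<equiv> inv_into (univ M) b"

definition to_perm :: "('a \<Rightarrow> 'a) \<Rightarrow> nat \<Rightarrow> nat" where
  "to_perm g = b \<circ> g \<circ> b'"

definition of_perm :: "(nat \<Rightarrow> nat) \<Rightarrow> 'a \<Rightarrow> 'a" where
  "of_perm h = (\<lambda>x\<in>univ M. b' (h (b x)))"

lemma b_b': "b (b' x) = x"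
  using bij_betw_inv_into_right[OF b] by simp

lemma b'_b: "x \<in> univ M \<Longrightarrow> b' (b x) = x"
  by (rule bij_betw_inv_into_left[OF b])

lemma b'_univ: "b' x \<in> univ M"
  using bij_betwE[OF bij_betw_inv_into[OF b]] by simp

lemma to_perm_apply: "to_perm g x = b (g (b' x))"
  by (simp add: to_perm_def)

lemma carrier_closed: "g \<in> carrier (Aut M) \<Longrightarrow> x \<in> univ M \<Longrightarrow> g x \<in> univ M"
  unfolding carrier_Aut Bij_def using bij_betwE by blast

lemma to_perm_aut:
  assumes g: "g \<in> carrier (Aut M)"
  shows "to_perm g \<in> hyp_Aut E"
proof (rule hyp_AutI)
  have "bij_betw g (univ M) (univ M)" using g unfolding carrier_Aut Bij_def by blast
  then show "bij (to_perm g)"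
    unfolding to_perm_def by (rule bij_betw_trans[OF bij_betw_inv_into[OF b] bij_betw_trans[OF _ b]])
  fix e
  have sub: "b' ` e \<subseteq> univ M" using b'_univ by blast
  have "b ` b' ` e = e" by (simp add: image_image b_b')
  moreover have "to_perm g ` e = b ` g ` b' ` e" by (simp add: image_image to_perm_def)
  ultimately show "to_perm g ` e \<in> E \<longleftrightarrow> e \<in> E" using g sub unfolding carrier_Aut by auto
qed

lemma of_perm_carrier:
  assumes h: "h \<in> hyp_Aut E"
  shows "of_perm h \<in> carrier (Aut M)"
proof -
  have "bij_betw (b' \<circ> (h \<circ> b)) (univ M) (univ M)"
    by (rule bij_betw_trans[OF bij_betw_trans[OF b hyp_Aut_bij[OF h]] bij_betw_inv_into[OF b]])
  then have "bij_betw (of_perm h) (univ M) (univ M)"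
    by (rule bij_betw_cong[THEN iffD1, rotated]) (simp add: of_perm_def)
  moreover have "of_perm h \<in> extensional (univ M)" by (simp add: of_perm_def)
  moreover have "b ` of_perm h ` e \<in> E \<longleftrightarrow> b ` e \<in> E" if e: "e \<subseteq> univ M" for e
  proof -
    have "b ` of_perm h ` e = h ` b ` e"
      unfolding image_image using e by (intro image_cong) (auto simp: of_perm_def b_b')
    then show ?thesis using hyp_Aut_edge[OF h] by simp
  qed
  ultimately show ?thesis by (simp add: carrier_Aut Bij_def)
qed

lemma to_perm_of_perm: "to_perm (of_perm h) = h"
  by (simp add: fun_eq_iff to_perm_def of_perm_def b'_univ b_b')

lemma of_perm_to_perm:
  assumes g: "g \<in> carrier (Aut M)"
  shows "of_perm (to_perm g) = g"
proof (rule extensionalityI)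
  show "of_perm (to_perm g) \<in> extensional (univ M)" by (simp add: of_perm_def)
  show "g \<in> extensional (univ M)" using g by (simp add: carrier_Aut Bij_def)
  show "of_perm (to_perm g) x = g x" if "x \<in> univ M" for x
    using that carrier_closed[OF g that] by (simp add: of_perm_def to_perm_def b'_b)
qed

lemma to_perm_inj: "g \<in> carrier (Aut M) \<Longrightarrow> h \<in> carrier (Aut M) \<Longrightarrow> to_perm g = to_perm h \<Longrightarrow> g = h"
  using of_perm_to_perm by metis

lemma to_perm_bij: "bij_betw to_perm (carrier (Aut M)) (hyp_Aut E)"
  by (rule bij_betwI[of _ _ _ of_perm]) (auto simp: to_perm_aut of_perm_carrier to_perm_of_perm of_perm_to_perm)

lemma mult_Aut:
  assumes "g \<in> carrier (Aut M)" "h \<in> carrier (Aut M)"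
  shows "g \<otimes>\<^bsub>Aut M\<^esub> h = compose (univ M) g h"
  using assms unfolding carrier_Aut by (simp add: Aut_def BijGroup_def)

lemma to_perm_mult:
  assumes "g \<in> carrier (Aut M)" "h \<in> carrier (Aut M)"
  shows "to_perm (g \<otimes>\<^bsub>Aut M\<^esub> h) = to_perm g \<circ> to_perm h"
proof
  fix x
  have "h (b' x) \<in> univ M" using carrier_closed[OF assms(2) b'_univ] .
  then show "to_perm (g \<otimes>\<^bsub>Aut M\<^esub> h) x = (to_perm g \<circ> to_perm h) x"
    unfolding mult_Aut[OF assms] by (simp add: to_perm_def compose_def b'_univ b'_b)
qed

lemma mult_closed:
  assumes "g \<in> carrier (Aut M)" "h \<in> carrier (Aut M)"
  shows "g \<otimes>\<^bsub>Aut M\<^esub> h \<in> carrier (Aut M)"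
proof -
  have "compose (univ M) g h = of_perm (to_perm g \<circ> to_perm h)"
  proof
    fix x
    show "compose (univ M) g h x = of_perm (to_perm g \<circ> to_perm h) x"
      using carrier_closed[OF assms(2), of x] carrier_closed[OF assms(1), of "h x"]
      by (simp add: compose_def of_perm_def to_perm_def b'_b)
  qed
  then show ?thesis
    unfolding mult_Aut[OF assms] using of_perm_carrier[OF hyp_Aut_comp[OF to_perm_aut[OF assms(1)] to_perm_aut[OF assms(2)]]]
    by simp
qed

lemma one_Aut: "\<one>\<^bsub>Aut M\<^esub> = of_perm id"
  by (simp add: Aut_def BijGroup_def of_perm_def b'_b cong: restrict_cong)

lemma group_Aut: "group (Aut M)"
proof (rule groupI)
  have one: "\<one>\<^bsub>Aut M\<^esub> \<in> carrier (Aut M)" unfolding one_Aut by (rule of_perm_carrier[OF hyp_Aut_id])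
  then show "\<one>\<^bsub>Aut M\<^esub> \<in> carrier (Aut M)" .
  fix x assume x: "x \<in> carrier (Aut M)"
  show "\<one>\<^bsub>Aut M\<^esub> \<otimes>\<^bsub>Aut M\<^esub> x = x"
    by (rule to_perm_inj[OF mult_closed[OF one x] x]) (simp add: to_perm_mult[OF one x], simp add: one_Aut to_perm_of_perm)
  have inv: "of_perm (ginv (to_perm x)) \<in> carrier (Aut M)"
    by (rule of_perm_carrier[OF hyp_Aut_ginv[OF to_perm_aut[OF x]]])
  have "of_perm (ginv (to_perm x)) \<otimes>\<^bsub>Aut M\<^esub> x = \<one>\<^bsub>Aut M\<^esub>"
    by (rule to_perm_inj[OF mult_closed[OF inv x] one])
       (simp only: to_perm_mult[OF inv x] one_Aut to_perm_of_perm ginv_comp(1)[OF to_perm_aut[OF x]])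
  then show "\<exists>y\<in>carrier (Aut M). y \<otimes>\<^bsub>Aut M\<^esub> x = \<one>\<^bsub>Aut M\<^esub>" using inv by blast
  fix y assume y: "y \<in> carrier (Aut M)"
  show "x \<otimes>\<^bsub>Aut M\<^esub> y \<in> carrier (Aut M)" by (rule mult_closed[OF x y])
  fix z assume z: "z \<in> carrier (Aut M)"
  show "x \<otimes>\<^bsub>Aut M\<^esub> y \<otimes>\<^bsub>Aut M\<^esub> z = x \<otimes>\<^bsub>Aut M\<^esub> (y \<otimes>\<^bsub>Aut M\<^esub> z)"
    by (rule to_perm_inj[OF mult_closed[OF mult_closed[OF x y] z] mult_closed[OF x mult_closed[OF y z]]])
       (simp only: to_perm_mult mult_closed x y z comp_assoc)
qed

lemma to_perm_one: "to_perm \<one>\<^bsub>Aut M\<^esub> = id"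
  by (simp add: one_Aut to_perm_of_perm)

lemma perm_subgroup_image:
  assumes H: "subgroup H (Aut M)"
  shows "perm_subgroup E (to_perm ` H)"
  unfolding perm_subgroup_def
proof (intro conjI ballI)
  interpret group "Aut M" by (rule group_Aut)
  have sub: "H \<subseteq> carrier (Aut M)" by (rule subgroup.subset[OF H])
  show "to_perm ` H \<subseteq> hyp_Aut E" using sub to_perm_aut by blast
  show "id \<in> to_perm ` H" using subgroup.one_closed[OF H] to_perm_one by (metis imageI)
  show "g \<circ> h \<in> to_perm ` H" if "g \<in> to_perm ` H" "h \<in> to_perm ` H" for g h
  proof -
    obtain x y where xy: "x \<in> H" "y \<in> H" "g = to_perm x" "h = to_perm y"
      using \<open>g \<in> to_perm ` H\<close> \<open>h \<in> to_perm ` H\<close> by (elim imageE)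
    then have "g \<circ> h = to_perm (x \<otimes>\<^bsub>Aut M\<^esub> y)"
      using to_perm_mult[OF subsetD[OF sub xy(1)] subsetD[OF sub xy(2)]] by simp
    then show ?thesis using subgroup.m_closed[OF H xy(1,2)] by (metis imageI)
  qed
  show "ginv g \<in> to_perm ` H" if "g \<in> to_perm ` H" for g
  proof -
    obtain x where x: "x \<in> H" "g = to_perm x" using \<open>g \<in> to_perm ` H\<close> by (elim imageE)
    have xc: "x \<in> carrier (Aut M)" using x(1) sub by blast
    have "to_perm x \<circ> to_perm (inv\<^bsub>Aut M\<^esub> x) = id"
      using to_perm_mult[OF xc inv_closed[OF xc]] r_inv[OF xc] to_perm_one by simp
    then have "ginv g = to_perm (inv\<^bsub>Aut M\<^esub> x)" unfolding x(2) by (rule ginv_eqI[OF to_perm_aut[OF xc]])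
    then show ?thesis using subgroup.m_inv_closed[OF H x(1)] by (metis imageI)
  qed
qed

lemma small_index_image:
  assumes H: "subgroup H (Aut M)" and small: "(rcosets\<^bsub>Aut M\<^esub> H) \<prec> (UNIV :: nat set set)"
  shows "small_index E (to_perm ` H)"
  unfolding small_index_def
proof (intro allI impI, rule ccontr)
  interpret group "Aut M" by (rule group_Aut)
  fix c :: "nat set \<Rightarrow> nat \<Rightarrow> nat" assume "\<forall>s. c s \<in> hyp_Aut E"
  then have c: "c s \<in> hyp_Aut E" for s by blast
  assume no: "\<not> (\<exists>s t. s \<noteq> t \<and> ginv (c s) \<circ> c t \<in> to_perm ` H)"
  \<comment> \<open>\<open>small_index\<close> speaks of left cosets, the index in
    \<open>Aut M\<close> of right cosets; inversion exchanges them.\<close>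
  define a where "a s = of_perm (ginv (c s))" for s
  have ac: "a s \<in> carrier (Aut M)" for s unfolding a_def by (rule of_perm_carrier[OF hyp_Aut_ginv[OF c]])
  have "inj (\<lambda>s. H #>\<^bsub>Aut M\<^esub> a s)"
  proof (rule injI)
    fix s t assume "H #>\<^bsub>Aut M\<^esub> a s = H #>\<^bsub>Aut M\<^esub> a t"
    then have "a s \<in> H #>\<^bsub>Aut M\<^esub> a t" using rcos_self[OF ac H] by metis
    then obtain h where h: "h \<in> H" "a s = h \<otimes>\<^bsub>Aut M\<^esub> a t" unfolding r_coset_def by blast
    have hc: "h \<in> carrier (Aut M)" using h(1) subgroup.subset[OF H] by blast
    have "ginv (c s) = to_perm h \<circ> ginv (c t)"
      using arg_cong[OF h(2), of to_perm] to_perm_mult[OF hc ac] by (simp add: a_def to_perm_of_perm)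
    then have "ginv (c s) \<circ> c t = to_perm h" using ginv_left[OF c] by (simp add: fun_eq_iff)
    then have "ginv (c s) \<circ> c t \<in> to_perm ` H" using h(1) by (metis imageI)
    then show "s = t" using no by blast
  qed
  moreover have "range (\<lambda>s. H #>\<^bsub>Aut M\<^esub> a s) \<subseteq> rcosets\<^bsub>Aut M\<^esub> H"
    using ac by (auto simp: RCOSETS_def)
  ultimately have "(UNIV :: nat set set) \<lesssim> rcosets\<^bsub>Aut M\<^esub> H" unfolding lepoll_def by blast
  then show False using small lepoll_antisym unfolding lesspoll_def by blast
qed

lemma strong_small_index_property:
  assumes E: "homogeneous_hypergraph \<eta> \<zeta> E"
  shows "strong_small_index_property M"
  unfolding strong_small_index_property_def
proof (intro allI impI)
  fix H assume "subgroup H (Aut M) \<and> (rcosets\<^bsub>Aut M\<^esub> H) \<prec> (UNIV :: nat set set)"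
  then have H: "subgroup H (Aut M)" and small: "(rcosets\<^bsub>Aut M\<^esub> H) \<prec> (UNIV :: nat set set)" by blast+
  obtain A where A: "finite A" "hyp_stab E A \<subseteq> to_perm ` H" "to_perm ` H \<subseteq> hyp_setstab E A"
    using homogeneous_hypergraph.strong_small_index[OF E perm_subgroup_image[OF H] small_index_image[OF H small]] .
  have sub: "H \<subseteq> carrier (Aut M)" by (rule subgroup.subset[OF H])
  have "pointwise_stab M (b' ` A) \<subseteq> H"
  proof
    fix g assume "g \<in> pointwise_stab M (b' ` A)"
    then have g: "g \<in> carrier (Aut M)" "\<And>a. a \<in> A \<Longrightarrow> g (b' a) = b' a" by (auto simp: pointwise_stab_def)
    have "to_perm g \<in> hyp_stab E A"
      using to_perm_aut[OF g(1)] g(2) by (simp add: hyp_stab_def to_perm_apply b_b')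
    then obtain h where "h \<in> H" "to_perm g = to_perm h" using A(2) by blast
    then show "g \<in> H" using to_perm_inj[OF g(1)] sub by blast
  qed
  moreover have "H \<subseteq> setwise_stab M (b' ` A)"
  proof
    fix g assume g: "g \<in> H"
    have gc: "g \<in> carrier (Aut M)" using g sub by blast
    have "to_perm g ` A = A" using A(3) g unfolding hyp_setstab_def by blast
    moreover have "g ` b' ` A = b' ` to_perm g ` A"
      unfolding image_image to_perm_apply using b'_b carrier_closed[OF gc b'_univ] by simp
    ultimately show "g \<in> setwise_stab M (b' ` A)" using gc by (simp add: setwise_stab_def)
  qed
  moreover have "finite (b' ` A)" "b' ` A \<subseteq> univ M" using A(1) b'_univ by auto
  ultimately show "\<exists>A. finite A \<and> A \<subseteq> univ M \<and> pointwise_stab M A \<subseteq> H \<and> H \<subseteq> setwise_stab M A" by blast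
qed

end

lemma Aut_iso_imp_aut_iso:
  assumes M: "hypergraph_copy M E b" and N: "hypergraph_copy N E' c" and iso: "Aut M \<cong> Aut N"
  obtains \<phi> where "aut_iso E E' \<phi>"
proof -
  interpret M: hypergraph_copy M E b by (rule M)
  interpret N: hypergraph_copy N E' c by (rule N)
  obtain \<theta> where \<theta>: "\<theta> \<in> iso (Aut M) (Aut N)" using iso unfolding is_iso_def by blast
  then have hom: "\<theta> \<in> hom (Aut M) (Aut N)" and bij: "bij_betw \<theta> (carrier (Aut M)) (carrier (Aut N))"
    by (auto simp: iso_def)
  define \<phi> where "\<phi> = N.to_perm \<circ> (\<theta> \<circ> M.of_perm)"
  have "bij_betw M.of_perm (hyp_Aut E) (carrier (Aut M))"
    by (rule bij_betwI[of _ _ _ M.to_perm])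
       (auto simp: M.to_perm_aut M.of_perm_carrier M.to_perm_of_perm M.of_perm_to_perm)
  then have "bij_betw \<phi> (hyp_Aut E) (hyp_Aut E')"
    unfolding \<phi>_def by (intro bij_betw_trans[OF bij_betw_trans[OF _ bij] N.to_perm_bij])
  moreover have "\<phi> (g \<circ> h) = \<phi> g \<circ> \<phi> h" if g: "g \<in> hyp_Aut E" and h: "h \<in> hyp_Aut E" for g h
  proof -
    note gc = M.of_perm_carrier[OF g] and hc = M.of_perm_carrier[OF h]
    have "M.of_perm (g \<circ> h) = M.of_perm g \<otimes>\<^bsub>Aut M\<^esub> M.of_perm h"
      by (rule M.to_perm_inj[OF M.of_perm_carrier[OF hyp_Aut_comp[OF g h]] M.mult_closed[OF gc hc]])
         (simp only: M.to_perm_of_perm M.to_perm_mult[OF gc hc])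
    then have "\<theta> (M.of_perm (g \<circ> h)) = \<theta> (M.of_perm g) \<otimes>\<^bsub>Aut N\<^esub> \<theta> (M.of_perm h)"
      using hom_mult[OF hom gc hc] by simp
    then show ?thesis
      using N.to_perm_mult[OF bij_betw_apply[OF bij gc] bij_betw_apply[OF bij hc]] by (simp add: \<phi>_def)
  qed
  ultimately have "aut_iso E E' \<phi>" by (rule aut_iso.intro)
  then show ?thesis by (rule that)
qed

text \<open>Irreflexivity, symmetry and clique-freeness concern finite sets of points and are read
  off from the age; so \<open>M\<close> is given by a set \<open>F\<close> of edges. An enumeration
  of its universe carries \<open>F\<close> to \<open>E\<close>, the age yields universality and
  ultrahomogeneity yields homogeneity.\<close>

lemma random_free_hypergraph_copy:
  fixes M :: "'a rstruct"
  assumes par: "eta_param \<eta>" "zeta_param \<eta> \<zeta>" and M: "random_free_hypergraph \<eta> \<zeta> M"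
  obtains E b where "homogeneous_hypergraph \<eta> \<zeta> E" "hypergraph_copy M E b"
proof -
  define U where "U = univ M"
  have L: "L_structure \<eta> M" and count: "countable U" and uh: "ultrahomogeneous M" and age: "age \<eta> M = K_eta_zeta \<eta> \<zeta>"
    using M by (auto simp: random_free_hypergraph_def fraisse_limit_def U_def)
  have \<eta>2: "2 \<le> n" if "\<eta> n" for n
  proof -
    have "n \<noteq> 0" "n \<noteq> 1" using par(1) that unfolding eta_param_def by metis+
    then show ?thesis by simp
  qed
  have \<zeta>2: "2 \<le> n" if "n < \<zeta> n" for n
    using \<eta>2[of n] par(2) that unfolding zeta_param_def by (metis not_less_zero)
  have RM: "\<eta> k" "length xs = k" "set xs \<subseteq> U" if "xs \<in> rel M k" for xs k
    using L that unfolding L_structure_def U_def by blast+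
  have inj_nat: "\<exists>c :: 'a \<Rightarrow> nat. inj_on c A" if "finite A" for A
    using finite_imp_inj_to_nat_seg[OF that] by blast
  have K: "\<lparr>univ = c ` A, rel = (\<lambda>n. map c ` {xs \<in> rel M n. set xs \<subseteq> A})\<rparr> \<in> K_eta_zeta \<eta> \<zeta>"
    if "A \<subseteq> U" "finite A" "inj_on c A" for A c
    using age_transport[OF L _ that(2,3)] that(1) age by (simp add: U_def)
  \<comment> \<open>A tuple of \<open>M\<close> is tested on a copy of its finite support in
    \<open>nat\<close>, which belongs to the class.\<close>
  have irr_sym: "distinct xs \<and> (\<sigma> permutes {..<k} \<longrightarrow> permute_list \<sigma> xs \<in> rel M k)" if xs: "xs \<in> rel M k" for xs k \<sigma>
  proof -
    obtain c :: "'a \<Rightarrow> nat" where c: "inj_on c (set xs)" using inj_nat[of "set xs"] by blast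
    define R where "R = map c ` {ys \<in> rel M k. set ys \<subseteq> set xs}"
    have "\<lparr>univ = c ` set xs, rel = (\<lambda>n. map c ` {ys \<in> rel M n. set ys \<subseteq> set xs})\<rparr> \<in> K_eta \<eta>"
      using K[OF RM(3)[OF xs] finite_set c] unfolding K_eta_zeta_def by blast
    then have IR: "irreflexive_rel R" and SR: "symmetric_rel k R"
      using RM(1)[OF xs] unfolding K_eta_def R_def by simp_all
    have mx: "map c xs \<in> R" using xs by (simp add: R_def)
    have d: "distinct (map c xs)" using IR mx unfolding irreflexive_rel_def by blast
    have s: "permute_list \<sigma> (map c xs) \<in> R" if p: "\<sigma> permutes {..<k}"
      using SR[unfolded symmetric_rel_def, THEN spec[of _ \<sigma>], THEN spec[of _ "map c xs"], THEN mp] p RM(2)[OF xs] mx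
      by simp
    have "permute_list \<sigma> xs \<in> rel M k" if p: "\<sigma> permutes {..<k}"
    proof -
      have pl: "\<sigma> permutes {..<length xs}" using p RM(2)[OF xs] by simp
      have "map c (permute_list \<sigma> xs) \<in> R" using s[OF p] permute_list_map[OF pl, of c] by simp
      then obtain ys where ys: "ys \<in> rel M k" "set ys \<subseteq> set xs" "map c (permute_list \<sigma> xs) = map c ys"
        unfolding R_def by blast
      have "inj_on c (set (permute_list \<sigma> xs) \<union> set ys)"
        by (rule inj_on_subset[OF c]) (use ys(2) pl in simp)
      then have "permute_list \<sigma> xs = ys" using ys(3) inj_on_map_eq_map by blast
      then show ?thesis using ys(1) by simp
    qed
    then show ?thesis using d by (simp add: distinct_map)
  qed
  define F where "F = {set xs | xs k. xs \<in> rel M k}"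
  have relM: "rel M n = hyp_rel F n" for n
    unfolding F_def by (rule rel_eq_hyp_rel) (use RM(2) irr_sym in blast)+
  have FU: "e \<subseteq> U" and Ffin: "finite e" if "e \<in> F" for e using that RM(3) by (auto simp: F_def)
  have admA: "admissible \<eta> \<zeta> A (F \<inter> Pow A)" if A: "A \<subseteq> U" "finite A" for A
  proof -
    obtain c :: "'a \<Rightarrow> nat" where c: "inj_on c A" using inj_nat[OF A(2)] by blast
    define F' where "F' = (`) c ` (F \<inter> Pow A)"
    have "map c ` {xs \<in> rel M n. set xs \<subseteq> A} = hyp_rel F' n" for n
    proof (rule equalityI; rule subsetI)
      fix ys assume "ys \<in> map c ` {xs \<in> rel M n. set xs \<subseteq> A}"
      then obtain xs where xs: "ys = map c xs" "xs \<in> hyp_rel F n" "set xs \<subseteq> A" unfolding relM by blast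
      then show "ys \<in> hyp_rel F' n"
        using inj_on_subset[OF c xs(3)] by (auto simp: hyp_rel_def F'_def distinct_map)
    next
      fix ys assume ys: "ys \<in> hyp_rel F' n"
      then obtain e where e: "e \<in> F" "e \<subseteq> A" "set ys = c ` e" by (auto simp: hyp_rel_def F'_def)
      define xs where "xs = map (inv_into A c) ys"
      have sx: "set xs = e" unfolding xs_def set_map e(3) by (rule inv_into_image_cancel[OF c e(2)])
      have "c ` e \<subseteq> c ` A" using e(2) by blast
      then have "map (c \<circ> inv_into A c) ys = ys" using e(3) by (intro map_idI) (auto simp: f_inv_into_f)
      then have yx: "ys = map c xs" by (simp add: xs_def)
      moreover have "distinct xs" using ys yx by (simp add: hyp_rel_def distinct_map)
      ultimately have "xs \<in> rel M n" unfolding relM using ys sx e(1) by (simp add: hyp_rel_def)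
      then show "ys \<in> map c ` {xs \<in> rel M n. set xs \<subseteq> A}" using yx sx e(2) by blast
    qed
    then have "\<lparr>univ = c ` A, rel = hyp_rel F'\<rparr> \<in> K_eta_zeta \<eta> \<zeta>" using K[OF A c] by simp
    then have "admissible \<eta> \<zeta> (c ` A) F'" by (rule K_admissible) (auto simp: F'_def)
    moreover have "edge_embedding A (F \<inter> Pow A) c F'" unfolding F'_def by (rule edge_embedding_image[OF c]) simp
    ultimately show ?thesis using admissible_pullback[OF _ _ order_refl] by blast
  qed
  have admU: "admissible \<eta> \<zeta> U F"
    unfolding admissible_def
  proof (intro conjI ballI allI impI)
    fix e assume e: "e \<in> F"
    show "e \<subseteq> U" "finite e" using FU[OF e] Ffin[OF e] .
    show "\<eta> (card e)" using admA[OF FU[OF e] Ffin[OF e]] e unfolding admissible_def by blast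
  next
    fix n S assume n: "n < \<zeta> n" and S: "S \<subseteq> U" "card S = \<zeta> n"
    have "finite S" using n S(2) by (intro card_ge_0_finite) simp
    then obtain e where "e \<subseteq> S" "card e = n" "e \<notin> F \<inter> Pow S"
      using admA[OF S(1)] n S(2) unfolding admissible_def by blast
    then show "\<exists>e\<subseteq>S. card e = n \<and> e \<notin> F" by blast
  qed
  have univ_emb: "\<exists>f. f ` B \<subseteq> U \<and> edge_embedding B F' f F"
    if B: "finite B" and adm: "admissible \<eta> \<zeta> B F'" for B :: "nat set" and F'
  proof -
    have "\<lparr>univ = B, rel = hyp_rel F'\<rparr> \<in> age \<eta> M" unfolding age by (rule hyp_rel_in_K[OF that])
    then obtain f where "embedding f \<lparr>univ = B, rel = hyp_rel F'\<rparr> M" unfolding age_def embeds_def by blast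
    then show ?thesis
      using embedding_hyp_rel_iff[of "\<lparr>univ = B, rel = hyp_rel F'\<rparr>" F' M F f] relM Ffin adm
      by (auto simp: admissible_def U_def)
  qed
  have "infinite U"
  proof
    assume fU: "finite U"
    \<comment> \<open>Edgeless hypergraphs of every finite size belong to the class, so
      \<open>M\<close> contains arbitrarily many points.\<close>
    have "\<exists>e\<subseteq>S. card e = n" if "n < \<zeta> n" "card S = \<zeta> n" for n and S :: "nat set"
      using obtain_subset_with_card_n[of n S] that by (metis less_imp_le)
    then have "admissible \<eta> \<zeta> {..<Suc (card U)} {}" by (simp add: admissible_def)
    then obtain f where f: "f ` {..<Suc (card U)} \<subseteq> U" "edge_embedding {..<Suc (card U)} {} f F"
      using univ_emb by blast
    have "Suc (card U) \<le> card U" using card_inj_on_le[OF edge_embedding_inj[OF f(2)] f(1) fU] by simp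
    then show False by simp
  qed
  then obtain b :: "'a \<Rightarrow> nat" where b: "bij_betw b U UNIV" using to_nat_on_infinite[OF count] by blast
  define b' where "b' = inv_into U b"
  define E where "E = (`) b ` F"
  have bU: "b ` U = UNIV" and binj: "inj_on b U" using b by (auto simp: bij_betw_def)
  have bb': "b (b' x) = x" for x unfolding b'_def using bij_betw_inv_into_right[OF b] by simp
  have b'U: "b' x \<in> U" for x unfolding b'_def using bU by (intro inv_into_into) simp
  have emb: "edge_embedding U F b E" unfolding E_def by (rule edge_embedding_image[OF binj FU])
  have emb': "edge_embedding UNIV E b' F" using edge_embedding_inv_into[OF emb] unfolding bU b'_def .
  have carrier: "carrier (Aut M) = {g \<in> Bij U. \<forall>e\<subseteq>U. b ` g ` e \<in> E \<longleftrightarrow> b ` e \<in> E}"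
  proof -
    have "isomorphism g M M \<longleftrightarrow> (\<forall>e\<subseteq>U. b ` g ` e \<in> E \<longleftrightarrow> b ` e \<in> E)" if g: "g \<in> Bij U" for g
    proof -
      have gb: "g ` U = U" "inj_on g U" using g by (auto simp: Bij_def bij_betw_def)
      have "isomorphism g M M \<longleftrightarrow> edge_embedding U F g F"
        unfolding isomorphism_def using embedding_hyp_rel_iff[of M F M F g] relM Ffin gb by (simp add: U_def)
      also have "\<dots> \<longleftrightarrow> (\<forall>e\<subseteq>U. g ` e \<in> F \<longleftrightarrow> e \<in> F)" using gb by (simp add: edge_embedding_def)
      also have "\<dots> \<longleftrightarrow> (\<forall>e\<subseteq>U. b ` g ` e \<in> E \<longleftrightarrow> b ` e \<in> E)"
      proof -
        have "g ` e \<subseteq> U" if "e \<subseteq> U" for e using that gb(1) by blast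
        then show ?thesis using edge_embedding_edge[OF emb] by metis
      qed
      finally show ?thesis .
    qed
    then show ?thesis unfolding Aut_def U_def[symmetric] by auto
  qed
  have copy: "hypergraph_copy M E b"
    using b carrier unfolding U_def by (rule hypergraph_copy.intro)
  interpret C: hypergraph_copy M E b by (rule copy)
  have "homogeneous_hypergraph \<eta> \<zeta> E"
  proof
    show "admissible \<eta> \<zeta> UNIV E" by (rule admissible_pullback[OF emb' admU]) (use b'U in auto)
    show "2 \<le> n" if "\<eta> n" for n using \<eta>2[OF that] .
    show "2 \<le> n" if "n < \<zeta> n" for n using \<zeta>2[OF that] .
    show "\<exists>f :: nat \<Rightarrow> nat. edge_embedding B F' f E" if "finite B" "admissible \<eta> \<zeta> B F'" for B F'
      using univ_emb[OF that] edge_embedding_comp[OF _ _ emb] by blast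
    show "\<exists>g\<in>hyp_Aut E. \<forall>a\<in>A. g a = h a" if A: "finite A" and h: "edge_embedding A E h E" for A h
    proof -
      define A' where "A' = b' ` A"
      define f where "f = b' \<circ> (h \<circ> b)"
      have A': "A' \<subseteq> U" "finite A'" "b ` A' = A" using b'U A by (auto simp: A'_def image_image bb')
      have fA': "f ` A' \<subseteq> U" using b'U by (auto simp: f_def)
      have "edge_embedding A' F (h \<circ> b) E"
        using edge_embedding_comp[OF edge_embedding_subset[OF emb A'(1)] _ h] A'(3) by simp
      then have fe: "edge_embedding A' F f F"
        unfolding f_def using edge_embedding_comp[OF _ subset_UNIV emb'] by blast
      have "edge_embedding A' (F \<inter> Pow A') f (F \<inter> Pow (f ` A'))"
        unfolding edge_embedding_Int_Pow[OF order_refl] edge_embedding_Int_Pow_right[OF order_refl] by (rule fe)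
      moreover have rs: "rel (substruct M V) n = hyp_rel (F \<inter> Pow V) n" for V n
        unfolding substruct_def using relM by (auto simp: hyp_rel_def)
      moreover have us: "univ (substruct M V) = V" for V by (simp add: substruct_def)
      ultimately have "isomorphism f (substruct M A') (substruct M (f ` A'))"
        unfolding isomorphism_def
        using embedding_hyp_rel_iff[of "substruct M A'" "F \<inter> Pow A'" "substruct M (f ` A')" "F \<inter> Pow (f ` A')" f] Ffin
        by simp
      then obtain g where g: "g \<in> carrier (Aut M)" "\<And>a. a \<in> A' \<Longrightarrow> g a = f a"
        using uh A' fA' unfolding ultrahomogeneous_def U_def by (metis finite_imageI)
      have "C.to_perm g a = h a" if a: "a \<in> A" for a
      proof -
        have "C.to_perm g a = b (g (b' a))" by (simp add: C.to_perm_apply b'_def U_def)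
        also have "\<dots> = b (f (b' a))" using g(2) a by (simp add: A'_def)
        finally show ?thesis by (simp add: f_def bb')
      qed
      then show ?thesis using C.to_perm_aut[OF g(1)] by blast
    qed
  qed
  then show ?thesis using copy by (rule that)
qed

section \<open>The two cases of the theorem\<close>

lemma random_hypergraph_free:
  assumes "random_hypergraph \<eta> M"
  shows "zeta_param \<eta> (\<lambda>n. if \<eta> n then n else 0)" "random_free_hypergraph \<eta> (\<lambda>n. if \<eta> n then n else 0) M"
proof -
  have "K_eta_zeta \<eta> (\<lambda>n. if \<eta> n then n else 0) = K_eta \<eta>" by (simp add: K_eta_zeta_def)
  then show "random_free_hypergraph \<eta> (\<lambda>n. if \<eta> n then n else 0) M"
    using assms by (simp add: random_free_hypergraph_def random_hypergraph_def)
qed (simp add: zeta_param_def)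

lemma random_free_hypergraph_Aut_not_iso:
  assumes M: "eta_param \<eta>" "zeta_param \<eta> \<zeta>" "random_free_hypergraph \<eta> \<zeta> M"
    and N: "eta_param \<eta>'" "zeta_param \<eta>' \<zeta>'" "random_free_hypergraph \<eta>' \<zeta>' N"
    and ne: "(\<eta>, \<zeta>) \<noteq> (\<eta>', \<zeta>')"
  shows "\<not> Aut M \<cong> Aut N"
proof
  assume iso: "Aut M \<cong> Aut N"
  obtain E b where E: "homogeneous_hypergraph \<eta> \<zeta> E" "hypergraph_copy M E b"
    using random_free_hypergraph_copy[OF M] .
  obtain E' c where E': "homogeneous_hypergraph \<eta>' \<zeta>' E'" "hypergraph_copy N E' c"
    using random_free_hypergraph_copy[OF N] .
  obtain \<phi> where \<phi>: "aut_iso E E' \<phi>" using Aut_iso_imp_aut_iso[OF E(2) E'(2) iso] .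
  obtain E2 where E2: "homogeneous_hypergraph \<eta>' \<zeta>' E2" "hyp_Aut E2 = hyp_Aut E"
    using aut_iso_same_group[OF \<phi> E(1) E'(1)] .
  show False using parameters_eq[OF E(1) E2(1,2) M(2) N(2)] ne by simp
qed

lemma random_free_hypergraph_SSIP:
  assumes "eta_param \<eta>" "zeta_param \<eta> \<zeta>" "random_free_hypergraph \<eta> \<zeta> M"
  shows "strong_small_index_property M"
proof -
  obtain E b where E: "homogeneous_hypergraph \<eta> \<zeta> E" "hypergraph_copy M E b"
    using random_free_hypergraph_copy[OF assms] .
  then show ?thesis using hypergraph_copy.strong_small_index_property by blast
qed

theorem theorem1p4:
  "(\<forall>\<eta> \<eta>' (M :: 'a rstruct) (N :: 'b rstruct).
      eta_param \<eta> \<and> eta_param \<eta>' \<and> random_hypergraph \<eta> M \<and> random_hypergraph \<eta>' N \<and>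
      \<eta> \<noteq> \<eta>' \<longrightarrow> \<not> (Aut M \<cong> Aut N)) \<and>
   (\<forall>\<eta> \<zeta> \<eta>' \<zeta>' (M :: 'a rstruct) (N :: 'b rstruct).
      eta_param \<eta> \<and> zeta_param \<eta> \<zeta> \<and> eta_param \<eta>' \<and> zeta_param \<eta>' \<zeta>' \<and>
      random_free_hypergraph \<eta> \<zeta> M \<and> random_free_hypergraph \<eta>' \<zeta>' N \<and>
      (\<eta>, \<zeta>) \<noteq> (\<eta>', \<zeta>') \<longrightarrow> \<not> (Aut M \<cong> Aut N)) \<and>
   (\<forall>\<eta> (M :: 'a rstruct).
      eta_param \<eta> \<and> random_hypergraph \<eta> M \<longrightarrow> strong_small_index_property M) \<and>
   (\<forall>\<eta> \<zeta> (M :: 'a rstruct).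
      eta_param \<eta> \<and> zeta_param \<eta> \<zeta> \<and> random_free_hypergraph \<eta> \<zeta> M \<longrightarrow>
      strong_small_index_property M)"
proof (intro conjI allI impI)
  fix \<eta> \<eta>' and M :: "'a rstruct" and N :: "'b rstruct"
  assume *: "eta_param \<eta> \<and> eta_param \<eta>' \<and> random_hypergraph \<eta> M \<and> random_hypergraph \<eta>' N \<and> \<eta> \<noteq> \<eta>'"
  then have M: "random_hypergraph \<eta> M" and N: "random_hypergraph \<eta>' N" by blast+
  show "\<not> Aut M \<cong> Aut N"
    by (rule random_free_hypergraph_Aut_not_iso[OF _ random_hypergraph_free[OF M] _ random_hypergraph_free[OF N]])
       (use * in simp_all)
next
  fix \<eta> \<zeta> \<eta>' \<zeta>' and M :: "'a rstruct" and N :: "'b rstruct"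
  assume "eta_param \<eta> \<and> zeta_param \<eta> \<zeta> \<and> eta_param \<eta>' \<and> zeta_param \<eta>' \<zeta>' \<and>
      random_free_hypergraph \<eta> \<zeta> M \<and> random_free_hypergraph \<eta>' \<zeta>' N \<and> (\<eta>, \<zeta>) \<noteq> (\<eta>', \<zeta>')"
  then show "\<not> Aut M \<cong> Aut N" using random_free_hypergraph_Aut_not_iso by blast
next
  fix \<eta> and M :: "'a rstruct"
  assume "eta_param \<eta> \<and> random_hypergraph \<eta> M"
  then show "strong_small_index_property M"
    using random_free_hypergraph_SSIP random_hypergraph_free by blast
next
  fix \<eta> \<zeta> and M :: "'a rstruct"
  assume "eta_param \<eta> \<and> zeta_param \<eta> \<zeta> \<and> random_free_hypergraph \<eta> \<zeta> M"
  then show "strong_small_index_property M" using random_free_hypergraph_SSIP by blast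
qed

end
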